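(* The operator $\mathcal{A}$ with domain $D(\mathcal{A})$, as defined in the context, generates a positive $C_0$-semigroup of contractions on $X$, denoted $\mathcal{T}(t)=e^{\mathcal{A}t}$, $t\ge 0$.
   Context: Let $0<L<\infty$, $\lambda_1>0$, $\lambda_2>0$. For $i=1,2$ let $\mu_i(x)\ge 0$, $x\in[0,L]$, be repair rates satisfying: $\int_0^l\mu_i(x)\,dx<\infty$ for every $0<l<L$; $\int_0^L\mu_i(x)\,dx=\infty$; and there is a positive integer $N$ such that $\lim_{x\to L}\mu_i(x)(L-x)^N<\infty$ for $i=1,2$. Let $X=\mathbb{R}\times L^1(0,L)\times L^1(0,L)$ with norm $\|(p_0,p_1,p_2)\|_X=|p_0|+\|p_1\|_{L^1(0,L)}+\|p_2\|_{L^1(0,L)}$, a Banach lattice with the componentwise (a.e.) order. The operator $\mathcal{A}:D(\mathcal{A})\subset X\to X$ acts on $\vec p=(p_0,p_1,p_2)^T$ by $$\mathcal{A}\vec p=\begin{pmatrix}-(\lambda_1+\lambda_2)p_0+\int_0^L\mu_1(x)p_1(x)\,dx+\int_0^L\mu_2(x)p_2(x)\,dx\\ -p_1'(x)-(\mu_1(x)+\lambda_2)p_1(x)\\ -p_2'(x)-\mu_2(x)p_2(x)\end{pmatrix},$$ with domain $$D(\mathcal{A})=\Big\{\vec p\in X:\ p_i\in W^{1,1}(0,L),\ \mu_ip_i\in L^1(0,L),\ i=1,2,\ \ p_1(0)=\lambda_1p_0,\ \ p_2(0)=\lambda_2p_0+\lambda_2\int_0^Lp_1(x)\,dx\Big\}.$$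 *)

theory Defs
  imports "HOL-Analysis.Analysis" "HOL-Library.Product_Order"
begin

section \<open>Lebesgue classes of integrable functions\<close>

text \<open>
  The type of equivalence classes, modulo equality almost everywhere, of Lebesgue integrable
  functions on the real line. Since an interval depending on a real number cannot be a type,
  \<open>L\<^sup>1(0,L)\<close> appears below as the subspace of the classes that vanish almost everywhere
  outside \<open>(0,L)\<close> (extension by zero).
\<close>

definition L1_eq :: "(real \<Rightarrow> real) \<Rightarrow> (real \<Rightarrow> real) \<Rightarrow> bool" where
  "L1_eq f g \<longleftrightarrow>
     integrable lebesgue f \<and> integrable lebesgue g \<and> (AE x in lebesgue. f x = g x)"

lemma part_equivp_L1_eq: "part_equivp L1_eq"
proof (rule part_equivpI)
  show "\<exists>f. L1_eq f f"
    by (rule exI[of _ "\<lambda>_. 0"]) (simp add: L1_eq_def)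
  show "symp L1_eq"
    by (rule sympI) (auto simp: L1_eq_def eq_commute)
  show "transp L1_eq"
    by (rule transpI) (auto simp: L1_eq_def elim: eventually_elim2)
qed

quotient_type l1 = "real \<Rightarrow> real" / partial: L1_eq
  by (rule part_equivp_L1_eq)

lemma L1_eq_rep_l1: "L1_eq (rep_l1 f) (rep_l1 f)"
  by (rule Quotient3_rep_reflp[OF Quotient3_l1])

lemma integrable_rep_l1: "integrable lebesgue (rep_l1 f)"
  using L1_eq_rep_l1 by (simp add: L1_eq_def)

lemma rep_abs_l1:
  assumes "integrable lebesgue f"
  shows "AE x in lebesgue. rep_l1 (abs_l1 f) x = f x"
proof -
  have "L1_eq f f" using assms by (simp add: L1_eq_def)
  then have "L1_eq (rep_l1 (abs_l1 f)) f"
    by (rule rep_abs_rsp_left[OF Quotient3_l1])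
  then show ?thesis by (simp add: L1_eq_def)
qed

instantiation l1 :: real_vector
begin

lift_definition zero_l1 :: l1 is "\<lambda>_. 0"
  by (simp add: L1_eq_def)

lift_definition plus_l1 :: "l1 \<Rightarrow> l1 \<Rightarrow> l1" is "\<lambda>f g x. f x + g x"
  by (auto simp: L1_eq_def elim: eventually_elim2)

lift_definition minus_l1 :: "l1 \<Rightarrow> l1 \<Rightarrow> l1" is "\<lambda>f g x. f x - g x"
  by (auto simp: L1_eq_def elim: eventually_elim2)

lift_definition uminus_l1 :: "l1 \<Rightarrow> l1" is "\<lambda>f x. - f x"
  by (auto simp: L1_eq_def elim: eventually_mono)

lift_definition scaleR_l1 :: "real \<Rightarrow> l1 \<Rightarrow> l1" is "\<lambda>c f x. c * f x"
  by (auto simp: L1_eq_def elim: eventually_mono)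

instance
  by standard (transfer; auto simp: L1_eq_def algebra_simps)+

end

instantiation l1 :: real_normed_vector
begin

lift_definition norm_l1 :: "l1 \<Rightarrow> real" is "\<lambda>f. \<integral>x. \<bar>f x\<bar> \<partial>lebesgue"
  unfolding L1_eq_def by (intro integral_cong_AE) (auto elim: eventually_mono)

definition dist_l1 :: "l1 \<Rightarrow> l1 \<Rightarrow> real" where
  "dist_l1 f g = norm (f - g)"

definition sgn_l1 :: "l1 \<Rightarrow> l1" where
  "sgn_l1 f = f /\<^sub>R norm f"

definition uniformity_l1 :: "(l1 \<times> l1) filter" where
  "uniformity_l1 = (INF e\<in>{0<..}. principal {(f, g). dist f g < e})"

definition open_l1 :: "l1 set \<Rightarrow> bool" where
  "open_l1 U \<longleftrightarrow> (\<forall>f\<in>U. \<forall>\<^sub>F (f', g) in uniformity. f' = f \<longrightarrow> g \<in> U)"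

instance
proof
  fix f g :: l1 and c :: real and U :: "l1 set"
  show "dist f g = norm (f - g)" by (rule dist_l1_def)
  show "sgn f = f /\<^sub>R norm f" by (rule sgn_l1_def)
  show "uniformity = (INF e\<in>{0<..}. principal {(f::l1, g). dist f g < e})"
    by (rule uniformity_l1_def)
  show "open U \<longleftrightarrow> (\<forall>f\<in>U. \<forall>\<^sub>F (f', g) in uniformity. f' = f \<longrightarrow> g \<in> U)"
    by (rule open_l1_def)
  show "norm f = 0 \<longleftrightarrow> f = 0"
  proof transfer
    fix f :: "real \<Rightarrow> real" assume "L1_eq f f"
    then have f: "integrable lebesgue f" by (simp add: L1_eq_def)
    then have "(\<integral>x. \<bar>f x\<bar> \<partial>lebesgue) = 0 \<longleftrightarrow> (AE x in lebesgue. \<bar>f x\<bar> = 0)"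
      by (intro integral_nonneg_eq_0_iff_AE) auto
    then show "(\<integral>x. \<bar>f x\<bar> \<partial>lebesgue) = 0 \<longleftrightarrow> L1_eq f (\<lambda>_. 0)"
      using f by (simp add: L1_eq_def)
  qed
  show "norm (f + g) \<le> norm f + norm g"
  proof transfer
    fix f g :: "real \<Rightarrow> real" assume "L1_eq f f" "L1_eq g g"
    then have fg: "integrable lebesgue f" "integrable lebesgue g" by (simp_all add: L1_eq_def)
    then have "(\<integral>x. \<bar>f x + g x\<bar> \<partial>lebesgue) \<le> (\<integral>x. \<bar>f x\<bar> + \<bar>g x\<bar> \<partial>lebesgue)"
      by (intro integral_mono) auto
    also have "\<dots> = (\<integral>x. \<bar>f x\<bar> \<partial>lebesgue) + (\<integral>x. \<bar>g x\<bar> \<partial>lebesgue)"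
      using fg by (intro Bochner_Integration.integral_add) auto
    finally show "(\<integral>x. \<bar>f x + g x\<bar> \<partial>lebesgue)
      \<le> (\<integral>x. \<bar>f x\<bar> \<partial>lebesgue) + (\<integral>x. \<bar>g x\<bar> \<partial>lebesgue)" .
  qed
  show "norm (c *\<^sub>R f) = \<bar>c\<bar> * norm f"
    by transfer (simp add: abs_mult)
qed

end

instantiation l1 :: order
begin

lift_definition less_eq_l1 :: "l1 \<Rightarrow> l1 \<Rightarrow> bool" is "\<lambda>f g. AE x in lebesgue. f x \<le> g x"
proof -
  fix f f' g g' assume "L1_eq f f'" "L1_eq g g'"
  then have "AE x in lebesgue. f x = f' x" "AE x in lebesgue. g x = g' x"
    by (simp_all add: L1_eq_def)
  then have "AE x in lebesgue. f x \<le> g x \<longleftrightarrow> f' x \<le> g' x"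
    by eventually_elim simp
  then show "(AE x in lebesgue. f x \<le> g x) = (AE x in lebesgue. f' x \<le> g' x)"
    by (rule eventually_subst)
qed

definition less_l1 :: "l1 \<Rightarrow> l1 \<Rightarrow> bool" where
  "less_l1 f g \<longleftrightarrow> f \<le> g \<and> \<not> g \<le> f"

instance
proof
  fix f g h :: l1
  show "f < g \<longleftrightarrow> f \<le> g \<and> \<not> g \<le> f" by (rule less_l1_def)
  show "f \<le> f" by transfer simp
  show "f \<le> g \<Longrightarrow> g \<le> h \<Longrightarrow> f \<le> h" by transfer (auto elim: eventually_elim2)
  show "f \<le> g \<Longrightarrow> g \<le> f \<Longrightarrow> f = g" by transfer (auto simp: L1_eq_def elim: eventually_elim2)
qed

end


section \<open>The spaces \<open>L\<^sup>1(0,L)\<close> and \<open>W\<^sup>1\<^sup>,\<^sup>1(0,L)\<close>\<close>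

definition L1_on :: "real \<Rightarrow> l1 set" where
  "L1_on L = {f. AE x in lebesgue. x \<notin> {0<..<L} \<longrightarrow> rep_l1 f x = 0}"

text \<open>Only meaningful if \<open>f\<close> is integrable over \<open>(0,L)\<close>; otherwise the value is unspecified.\<close>

definition class_on :: "real \<Rightarrow> (real \<Rightarrow> real) \<Rightarrow> l1" where
  "class_on L f = abs_l1 (\<lambda>x. indicator {0<..<L} x * f x)"

text \<open>
  \<open>\<phi>\<close> is a test function in \<open>C\<^sub>c\<^sup>1(0,L)\<close> with derivative \<open>\<phi>'\<close>. This is the class of test functions
  in Brezis' definition of the Sobolev spaces on an interval.
\<close>

definition test_function :: "real \<Rightarrow> (real \<Rightarrow> real) \<Rightarrow> (real \<Rightarrow> real) \<Rightarrow> bool" where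
  "test_function L \<phi> \<phi>' \<longleftrightarrow>
     (\<forall>x. (\<phi> has_real_derivative \<phi>' x) (at x)) \<and> continuous_on UNIV \<phi>' \<and>
     (\<exists>a b. 0 < a \<and> a < b \<and> b < L \<and> (\<forall>x. x \<notin> {a..b} \<longrightarrow> \<phi> x = 0))"

definition has_weak_deriv :: "real \<Rightarrow> l1 \<Rightarrow> l1 \<Rightarrow> bool" where
  "has_weak_deriv L p g \<longleftrightarrow> p \<in> L1_on L \<and> g \<in> L1_on L \<and>
     (\<forall>\<phi> \<phi>'. test_function L \<phi> \<phi>' \<longrightarrow>
        (LINT x:{0<..<L}|lebesgue. rep_l1 p x * \<phi>' x) =
        - (LINT x:{0<..<L}|lebesgue. rep_l1 g x * \<phi> x))"

definition W11 :: "real \<Rightarrow> l1 set" where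
  "W11 L = {p. \<exists>g. has_weak_deriv L p g}"

definition weak_deriv :: "real \<Rightarrow> l1 \<Rightarrow> l1" where
  "weak_deriv L p = (THE g. has_weak_deriv L p g)"

text \<open>
  The point value \<open>p(0)\<close> of \<open>p \<in> W\<^sup>1\<^sup>,\<^sup>1(0,L)\<close>: the value at 0 of its continuous representative on
  \<open>[0,L]\<close>.
\<close>

definition value_at_0 :: "real \<Rightarrow> l1 \<Rightarrow> real" where
  "value_at_0 L p = (THE c. \<exists>f. continuous_on {0..L} f \<and>
     (AE x in lebesgue. x \<in> {0<..<L} \<longrightarrow> f x = rep_l1 p x) \<and> f 0 = c)"


section \<open>Strongly continuous semigroups\<close>

text \<open>
  The notions are relative to a linear subspace \<open>V\<close> of the ambient type and to a norm \<open>N\<close> on it;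
  the norm is a parameter since the library norm on products is the Euclidean one. The values
  \<open>T t x\<close> matter only for \<open>t \<ge> 0\<close> and \<open>x \<in> V\<close>.
\<close>

definition bounded_operator_on ::
    "'a::real_vector set \<Rightarrow> ('a \<Rightarrow> real) \<Rightarrow> ('a \<Rightarrow> 'a) \<Rightarrow> bool" where
  "bounded_operator_on V N S \<longleftrightarrow>
     (\<forall>x\<in>V. S x \<in> V) \<and>
     (\<forall>x\<in>V. \<forall>y\<in>V. S (x + y) = S x + S y) \<and>
     (\<forall>c. \<forall>x\<in>V. S (c *\<^sub>R x) = c *\<^sub>R S x) \<and>
     (\<exists>C. \<forall>x\<in>V. N (S x) \<le> C * N x)"

definition C0_semigroup_on ::
    "'a::real_vector set \<Rightarrow> ('a \<Rightarrow> real) \<Rightarrow> (real \<Rightarrow> 'a \<Rightarrow> 'a) \<Rightarrow> bool" where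
  "C0_semigroup_on V N T \<longleftrightarrow>
     (\<forall>t\<ge>0. bounded_operator_on V N (T t)) \<and>
     (\<forall>x\<in>V. T 0 x = x) \<and>
     (\<forall>s\<ge>0. \<forall>t\<ge>0. \<forall>x\<in>V. T (s + t) x = T s (T t x)) \<and>
     (\<forall>x\<in>V. ((\<lambda>t. N (T t x - x)) \<longlongrightarrow> 0) (at_right 0))"

definition contractive_on ::
    "'a set \<Rightarrow> ('a \<Rightarrow> real) \<Rightarrow> (real \<Rightarrow> 'a \<Rightarrow> 'a) \<Rightarrow> bool" where
  "contractive_on V N T \<longleftrightarrow> (\<forall>t\<ge>0. \<forall>x\<in>V. N (T t x) \<le> N x)"

definition positive_on :: "'a::{zero,ord} set \<Rightarrow> (real \<Rightarrow> 'a \<Rightarrow> 'a) \<Rightarrow> bool" where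
  "positive_on V T \<longleftrightarrow> (\<forall>t\<ge>0. \<forall>x\<in>V. 0 \<le> x \<longrightarrow> 0 \<le> T t x)"

definition right_deriv_at_0 ::
    "('a::real_vector \<Rightarrow> real) \<Rightarrow> (real \<Rightarrow> 'a \<Rightarrow> 'a) \<Rightarrow> 'a \<Rightarrow> 'a \<Rightarrow> bool" where
  "right_deriv_at_0 N T x y \<longleftrightarrow>
     ((\<lambda>h. N ((1 / h) *\<^sub>R (T h x - x) - y)) \<longlongrightarrow> 0) (at_right 0)"

text \<open>The operator \<open>A\<close> with domain exactly \<open>D\<close> is the generator of \<open>T\<close>.\<close>

definition generator_on ::
    "'a::real_vector set \<Rightarrow> ('a \<Rightarrow> real) \<Rightarrow> (real \<Rightarrow> 'a \<Rightarrow> 'a) \<Rightarrow> 'a set \<Rightarrow> ('a \<Rightarrow> 'a) \<Rightarrow> bool" where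
  "generator_on V N T D A \<longleftrightarrow>
     D = {x\<in>V. \<exists>y\<in>V. right_deriv_at_0 N T x y} \<and>
     (\<forall>x\<in>D. A x \<in> V \<and> right_deriv_at_0 N T x (A x))"


section \<open>The repairable system\<close>

type_synonym state = "real \<times> l1 \<times> l1"

definition state_space :: "real \<Rightarrow> state set" where
  "state_space L = UNIV \<times> L1_on L \<times> L1_on L"

definition state_norm :: "state \<Rightarrow> real" where
  "state_norm = (\<lambda>(p0, p1, p2). \<bar>p0\<bar> + norm p1 + norm p2)"

definition sys_domain ::
    "real \<Rightarrow> real \<Rightarrow> real \<Rightarrow> (real \<Rightarrow> real) \<Rightarrow> (real \<Rightarrow> real) \<Rightarrow> state set" where
  "sys_domain L lam1 lam2 mu1 mu2 =
     {(p0, p1, p2). (p0, p1, p2) \<in> state_space L \<and>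
        p1 \<in> W11 L \<and> p2 \<in> W11 L \<and>
        set_integrable lebesgue {0<..<L} (\<lambda>x. mu1 x * rep_l1 p1 x) \<and>
        set_integrable lebesgue {0<..<L} (\<lambda>x. mu2 x * rep_l1 p2 x) \<and>
        value_at_0 L p1 = lam1 * p0 \<and>
        value_at_0 L p2 = lam2 * p0 + lam2 * (LINT x:{0<..<L}|lebesgue. rep_l1 p1 x)}"

definition sys_operator ::
    "real \<Rightarrow> real \<Rightarrow> real \<Rightarrow> (real \<Rightarrow> real) \<Rightarrow> (real \<Rightarrow> real) \<Rightarrow> state \<Rightarrow> state" where
  "sys_operator L lam1 lam2 mu1 mu2 = (\<lambda>(p0, p1, p2).
     (- (lam1 + lam2) * p0
        + (LINT x:{0<..<L}|lebesgue. mu1 x * rep_l1 p1 x)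
        + (LINT x:{0<..<L}|lebesgue. mu2 x * rep_l1 p2 x),
      - weak_deriv L p1 - class_on L (\<lambda>x. (mu1 x + lam2) * rep_l1 p1 x),
      - weak_deriv L p2 - class_on L (\<lambda>x. mu2 x * rep_l1 p2 x)))"

definition repair_rate :: "real \<Rightarrow> (real \<Rightarrow> real) \<Rightarrow> bool" where
  "repair_rate L mu \<longleftrightarrow>
     (\<forall>x\<in>{0..L}. 0 \<le> mu x) \<and>
     (\<forall>l. 0 < l \<and> l < L \<longrightarrow> set_integrable lebesgue {0..l} mu) \<and>
     (\<integral>\<^sup>+x\<in>{0..L}. ennreal (mu x) \<partial>lebesgue) = \<infinity>"

end

(* The proof goes through the Lumer-Phillips theorem, with the semigroup obtained by backward Euler:
   with J h = (I - h A)^-1 and h = 2^-n, the products (J h)^floor(t/h) x converge because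
   J (2h) x - (J h)^2 x = O(h^2) for x in the domain of A^2. Positivity and contractivity pass from
   J h to the limit.

   For the resolvent equation, each transport equation p' = f - a p is solved by variation of
   constants, and the solution vanishes at L because a is not integrable there. Therefore A preserves
   the total mass p_0 + int p_1 + int p_2, which reduces the resolvent equation to one scalar equation
   for p_0 with positive coefficients. Its solution is positive for positive data, and then the
   conservation of mass makes J h isometric on the positive cone, hence contractive. *)
theory Submission
  imports Defs
begin

section \<open>The Lumer--Phillips theorem via backward Euler\<close>

text \<open>Two norms are in play. Completeness and limits belong to the ambient norm, which on
  triples is Euclidean, while contractivity holds for the sum norm \<open>N\<close>; their
  equivalence moves every estimate from one to the other. The rates are only locally integrable, so
  solutions are absolutely continuous and need not be differentiable everywhere. Calculus is
  therefore done on identities u = c + \<open>prim g\<close>: Fubini's theorem gives the product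
  rule, and an estimate of increments by squares gives the exponential. To meet the domain exactly
  as defined, these primitives are then identified with the elements of \<open>W11\<close>; this is
  the lemma of du Bois-Reymond. The boundary conditions are the obstacle to density. Primitives
  vanishing at 0 are dense in \<open>L1_on L\<close>, but the values p_1(0) and p_2(0) are
  prescribed by the other components. A boundary layer, the solution of a transport equation with a
  large absorption constant, carries any prescribed value at 0 with arbitrarily small norm.\<close>

locale m_dissipative =
  fixes V D :: "'a::banach set" and N :: "'a \<Rightarrow> real" and A :: "'a \<Rightarrow> 'a" and C :: real
  assumes subspace_V: "subspace V" and closed_V: "closed V"
    and N_add: "N (x + y) \<le> N x + N y"
    and N_scaleR: "N (c *\<^sub>R x) = \<bar>c\<bar> * N x"
    and norm_le_N: "norm x \<le> N x"
    and N_le_norm: "N x \<le> C * norm x"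
    and subspace_D: "subspace D" and D_subset: "D \<subseteq> V"
    and A_in_V: "x \<in> D \<Longrightarrow> A x \<in> V"
    and A_add: "x \<in> D \<Longrightarrow> y \<in> D \<Longrightarrow> A (x + y) = A x + A y"
    and A_scaleR: "x \<in> D \<Longrightarrow> A (c *\<^sub>R x) = c *\<^sub>R A x"
    and range: "h > 0 \<Longrightarrow> f \<in> V \<Longrightarrow> \<exists>x\<in>D. x - h *\<^sub>R A x = f"
    and dissipative: "h > 0 \<Longrightarrow> x \<in> D \<Longrightarrow> N x \<le> N (x - h *\<^sub>R A x)"
    and dense: "f \<in> V \<Longrightarrow> e > 0 \<Longrightarrow> \<exists>z\<in>D. N (f - z) < e"
begin

section \<open>The norm \<open>N\<close> and the resolvent\<close>

lemma N_nonneg: "0 \<le> N x"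
  using norm_le_N[of x] norm_ge_zero[of x] by linarith

lemma N_zero [simp]: "N 0 = 0"
  using N_scaleR[of 0 0] by simp

lemma N_minus: "N (- x) = N x"
  using N_scaleR[of "-1" x] by simp

lemma N_eqI: "N (x - y) \<le> 0 \<Longrightarrow> x = y"
proof -
  assume "N (x - y) \<le> 0"
  then have "norm (x - y) \<le> 0" using norm_le_N[of "x - y"] by linarith
  then show "x = y" by (simp only: norm_le_zero_iff right_minus_eq)
qed

lemma N_diff_commute: "N (x - y) = N (y - x)"
  using N_minus[of "x - y"] by simp

lemma N_triangle: "N (x - z) \<le> N (x - y) + N (y - z)"
  using N_add[of "x - y" "y - z"] by simp

lemma N_tendsto_zero: "((\<lambda>i. N (f i - x)) \<longlongrightarrow> 0) F" if "(f \<longlongrightarrow> x) F"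
proof (rule tendsto_sandwich)
  show "\<forall>\<^sub>F i in F. 0 \<le> N (f i - x)" by (simp add: N_nonneg)
  show "\<forall>\<^sub>F i in F. N (f i - x) \<le> C * norm (f i - x)" by (simp add: N_le_norm)
  show "((\<lambda>i. C * norm (f i - x)) \<longlongrightarrow> 0) F"
    using tendsto_mult_right_zero[OF tendsto_norm_zero[OF LIM_zero[OF that]]] by simp
qed simp

lemma tendsto_N: "((\<lambda>i. N (f i)) \<longlongrightarrow> N x) F" if "(f \<longlongrightarrow> x) F"
proof (rule LIM_zero_cancel, rule tendsto_rabs_zero_cancel)
  show "((\<lambda>i. \<bar>N (f i) - N x\<bar>) \<longlongrightarrow> 0) F"
  proof (rule tendsto_sandwich[OF _ _ tendsto_const N_tendsto_zero[OF that]])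
    have "\<bar>N y - N x\<bar> \<le> N (y - x)" for y
      using N_add[of "y - x" x] N_add[of "x - y" y] N_diff_commute[of x y] by simp
    then show "\<forall>\<^sub>F i in F. \<bar>N (f i) - N x\<bar> \<le> N (f i - x)" by simp
  qed simp
qed

lemma A_diff: "x \<in> D \<Longrightarrow> y \<in> D \<Longrightarrow> A (x - y) = A x - A y"
  using A_add[of x "- 1 *\<^sub>R y"] A_scaleR[of y "-1"] subspace_scale[OF subspace_D, of y "-1"] by simp

text \<open>One backward Euler step. The choice is harmless for h > 0 and f in \<open>V\<close>:
  \<open>range\<close> gives a solution and dissipativity makes it unique.\<close>

definition J :: "real \<Rightarrow> 'a \<Rightarrow> 'a" where
  "J h f = (SOME x. x \<in> D \<and> x - h *\<^sub>R A x = f)"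

lemma J_in_D: "h > 0 \<Longrightarrow> f \<in> V \<Longrightarrow> J h f \<in> D"
  and J_eq: "h > 0 \<Longrightarrow> f \<in> V \<Longrightarrow> J h f - h *\<^sub>R A (J h f) = f"
  using someI_ex[of "\<lambda>x. x \<in> D \<and> x - h *\<^sub>R A x = f"] range[of h f]
  unfolding J_def by blast+

lemma J_in_V: "h > 0 \<Longrightarrow> f \<in> V \<Longrightarrow> J h f \<in> V"
  using J_in_D D_subset by blast

lemma resolvent_unique:
  assumes "h > 0" "x \<in> D" "y \<in> D" "x - h *\<^sub>R A x = y - h *\<^sub>R A y"
  shows "x = y"
proof -
  have "(x - y) - h *\<^sub>R A (x - y) = 0"
    using assms by (simp add: A_diff algebra_simps)
  moreover have "x - y \<in> D" using assms subspace_diff[OF subspace_D] by blast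
  ultimately have "N (x - y) \<le> 0" using dissipative[OF \<open>h > 0\<close>, of "x - y"] by simp
  then show ?thesis by (rule N_eqI)
qed

lemma J_unique: "h > 0 \<Longrightarrow> x \<in> D \<Longrightarrow> J h (x - h *\<^sub>R A x) = x"
proof -
  assume h: "h > 0" and x: "x \<in> D"
  then have "x - h *\<^sub>R A x \<in> V"
    using subspace_V D_subset A_in_V by (meson subsetD subspace_diff subspace_scale)
  then show ?thesis using resolvent_unique[OF h J_in_D[OF h] x J_eq[OF h]] by blast
qed

lemma J_contract: "h > 0 \<Longrightarrow> f \<in> V \<Longrightarrow> N (J h f) \<le> N f"
  using dissipative[OF _ J_in_D] J_eq by metis

lemma J_add:
  assumes "h > 0" "f \<in> V" "g \<in> V" shows "J h (f + g) = J h f + J h g"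
proof -
  have D: "J h f + J h g \<in> D"
    using J_in_D assms subspace_add[OF subspace_D] by blast
  have "f + g = (J h f - h *\<^sub>R A (J h f)) + (J h g - h *\<^sub>R A (J h g))"
    using assms by (simp add: J_eq)
  also have "\<dots> = (J h f + J h g) - h *\<^sub>R A (J h f + J h g)"
    using assms by (simp add: A_add J_in_D algebra_simps)
  finally have "J h (f + g) = J h ((J h f + J h g) - h *\<^sub>R A (J h f + J h g))" by simp
  then show ?thesis using J_unique[OF \<open>h > 0\<close> D] by simp
qed

lemma J_scaleR:
  assumes "h > 0" "f \<in> V" shows "J h (c *\<^sub>R f) = c *\<^sub>R J h f"
proof -
  have D: "c *\<^sub>R J h f \<in> D"
    using J_in_D assms subspace_scale[OF subspace_D] by blast
  have "c *\<^sub>R f = c *\<^sub>R (J h f - h *\<^sub>R A (J h f))"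
    using assms by (simp add: J_eq)
  also have "\<dots> = (c *\<^sub>R J h f) - h *\<^sub>R A (c *\<^sub>R J h f)"
    using assms by (simp add: A_scaleR J_in_D algebra_simps)
  finally show ?thesis using J_unique[OF \<open>h > 0\<close> D] by simp
qed

text \<open>Expanding x = J h (x - h A x) by linearity gives h J h (A x) = J h x - x, and the
  resolvent equation says that the right side is h A (J h x).\<close>

lemma AJ_commute:
  assumes "h > 0" "x \<in> D" shows "A (J h x) = J h (A x)"
proof -
  have xV: "x \<in> V" "A x \<in> V" using assms D_subset A_in_V by auto
  have "x = J h (x + (- h) *\<^sub>R A x)" using J_unique[OF assms] by simp
  also have "\<dots> = J h x + J h ((- h) *\<^sub>R A x)"
    by (rule J_add[OF assms(1) xV(1) subspace_scale[OF subspace_V xV(2)]])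
  also have "J h ((- h) *\<^sub>R A x) = (- h) *\<^sub>R J h (A x)" using assms xV by (intro J_scaleR) auto
  finally have "h *\<^sub>R J h (A x) = J h x - x" by (simp add: algebra_simps)
  also have "\<dots> = h *\<^sub>R A (J h x)" using J_eq[OF assms(1) xV(1)] by (simp add: algebra_simps)
  finally show ?thesis using assms by simp
qed

section \<open>Powers of the resolvent\<close>

lemma Jn_in_V: "h > 0 \<Longrightarrow> x \<in> V \<Longrightarrow> (J h ^^ k) x \<in> V"
  by (induction k) (auto simp: J_in_V)

lemma Jn_in_D: "h > 0 \<Longrightarrow> x \<in> D \<Longrightarrow> (J h ^^ k) x \<in> D"
  using D_subset by (induction k) (auto simp: J_in_D)

lemma Jn_contract: "h > 0 \<Longrightarrow> x \<in> V \<Longrightarrow> N ((J h ^^ k) x) \<le> N x"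
  by (induction k) (auto intro: order_trans[OF J_contract] simp: Jn_in_V)

lemma Jn_add: "h > 0 \<Longrightarrow> x \<in> V \<Longrightarrow> y \<in> V \<Longrightarrow> (J h ^^ k) (x + y) = (J h ^^ k) x + (J h ^^ k) y"
  by (induction k) (auto simp: J_add Jn_in_V)

lemma Jn_scaleR: "h > 0 \<Longrightarrow> x \<in> V \<Longrightarrow> (J h ^^ k) (c *\<^sub>R x) = c *\<^sub>R (J h ^^ k) x"
  by (induction k) (auto simp: J_scaleR Jn_in_V)

lemma Jn_diff: "h > 0 \<Longrightarrow> x \<in> V \<Longrightarrow> y \<in> V \<Longrightarrow> (J h ^^ k) (x - y) = (J h ^^ k) x - (J h ^^ k) y"
  using Jn_add[of h x "-1 *\<^sub>R y" k] Jn_scaleR[of h y k "-1"] subspace_scale[OF subspace_V, of y "-1"]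
  by simp

lemma AJn_commute: "h > 0 \<Longrightarrow> x \<in> D \<Longrightarrow> A ((J h ^^ k) x) = (J h ^^ k) (A x)"
  by (induction k) (auto simp: AJ_commute Jn_in_D)

lemma J_diff_eq: "h > 0 \<Longrightarrow> x \<in> V \<Longrightarrow> J h x - x = h *\<^sub>R A (J h x)"
  using J_eq[of h x] by (simp add: algebra_simps)

lemma J_step: "h > 0 \<Longrightarrow> x \<in> D \<Longrightarrow> N (J h x - x) \<le> h * N (A x)"
  using J_diff_eq[of h x] AJ_commute[of h x] J_contract[of h "A x"] A_in_V D_subset
  by (auto simp: N_scaleR)

text \<open>The k-th increment is \<open>(J h ^^ k) (J h x - x)\<close>. By contractivity it is no
  larger than the first one, which is h J h (A x).\<close>

lemma Jn_step: "h > 0 \<Longrightarrow> x \<in> D \<Longrightarrow> N ((J h ^^ k) x - x) \<le> k * h * N (A x)"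
proof (induction k)
  case (Suc k)
  have x: "x \<in> V" using Suc D_subset by auto
  have "(J h ^^ Suc k) x - (J h ^^ k) x = (J h ^^ k) (J h x - x)"
    using Suc x by (simp add: Jn_diff J_in_V flip: funpow_swap1)
  then have "N ((J h ^^ Suc k) x - (J h ^^ k) x) \<le> h * N (A x)"
    using Jn_contract[of h "J h x - x" k] J_step[of h x] Suc x J_in_V subspace_diff[OF subspace_V]
    by (smt (verit, best))
  then show ?case
    using Suc N_triangle[of "(J h ^^ Suc k) x" x "(J h ^^ k) x"] by (simp add: algebra_simps)
qed simp

text \<open>A version of \<open>Jn_step\<close> for points outside the domain. It is applied to y =
  A x, where x is only in \<open>D\<close>.\<close>

lemma Jn_step_dense:
  assumes "h > 0" "y \<in> V" "z \<in> D"
  shows "N ((J h ^^ k) y - y) \<le> 2 * N (y - z) + k * h * N (A z)"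
proof -
  have z: "z \<in> V" using assms D_subset by auto
  have "N ((J h ^^ k) y - (J h ^^ k) z) \<le> N (y - z)"
    using Jn_contract[of h "y - z" k] Jn_diff[of h y z k] assms z subspace_diff[OF subspace_V] by simp
  then show ?thesis
    using Jn_step[OF assms(1,3), of k] N_triangle[of "(J h ^^ k) y" y "(J h ^^ k) z"]
      N_triangle[of "(J h ^^ k) z" y z] N_diff_commute[of y z] by linarith
qed

text \<open>The increments of the Euler orbit are h J^j (A x) with j from 1 to k. Each is compared
  with h A x by \<open>Jn_step_dense\<close>. The bound depends on k and h only through the elapsed
  time k h, so it survives the limit and yields the right derivative of the semigroup.\<close>

lemma Jn_deriv:
  assumes "h > 0" "x \<in> D" "z \<in> D"
  shows "N ((J h ^^ k) x - x - (k * h) *\<^sub>R A x) \<le> k * h * (2 * N (A x - z) + k * h * N (A z))"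
    (is "_ \<le> k * h * ?b k")
proof (induction k)
  case (Suc k)
  let ?y = "(J h ^^ k) x"
  have V: "x \<in> V" "A x \<in> V" using assms D_subset A_in_V by auto
  have "(J h ^^ Suc k) x - ?y = h *\<^sub>R (J h ^^ Suc k) (A x)"
    using J_diff_eq[of h ?y] assms V AJ_commute[of h ?y] by (simp add: Jn_in_V Jn_in_D AJn_commute)
  then have "N ((J h ^^ Suc k) x - ?y - h *\<^sub>R A x) = h * N ((J h ^^ Suc k) (A x) - A x)"
    using assms N_scaleR[of h] by (simp flip: scaleR_diff_right)
  also have "\<dots> \<le> h * ?b (Suc k)"
    using Jn_step_dense[of h "A x" z "Suc k"] assms V by (intro mult_left_mono) auto
  finally have 1: "N ((J h ^^ Suc k) x - ?y - h *\<^sub>R A x) \<le> h * ?b (Suc k)" .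
  have "k * h * ?b k \<le> k * h * ?b (Suc k)"
    using assms N_nonneg by (intro mult_left_mono add_left_mono mult_right_mono) auto
  with 1 Suc show ?case
    using N_add[of "(J h ^^ Suc k) x - ?y - h *\<^sub>R A x" "?y - x - (k * h) *\<^sub>R A x"]
    by (simp add: algebra_simps)
qed simp

text \<open>The local error comes from (I - hA)^2 = (I - 2hA) + h^2 A^2. Applied to y = J (2h) x
  this gives (I - hA)^2 y = x + h^2 A^2 y, so y differs from J h (J h x) exactly by h^2 J h (J h
  (A^2 y)).\<close>

lemma J_halve:
  assumes "h > 0" "x \<in> D" "A x \<in> D"
  shows "N (J (2 * h) x - J h (J h x)) \<le> h\<^sup>2 * N (A (A x))"
proof -
  let ?y = "J (2 * h) x"
  have h: "2 * h > 0" using assms by simp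
  have V: "x \<in> V" "A x \<in> V" "A (A x) \<in> V" using assms D_subset A_in_V by auto
  have y: "?y \<in> D" using J_in_D[OF h V(1)] .
  have Ay: "A ?y = J (2 * h) (A x)" using AJ_commute[OF h assms(2)] .
  then have AyD: "A ?y \<in> D" using J_in_D[OF h V(2)] by simp
  have AAy: "A (A ?y) = J (2 * h) (A (A x))" using AJ_commute[OF h assms(3)] Ay by simp
  then have AAyV: "A (A ?y) \<in> V" using J_in_V[OF h V(3)] by simp
  define w where "w = ?y - h *\<^sub>R A ?y"
  have w: "w \<in> D" unfolding w_def
    using y AyD subspace_D subspace_diff subspace_scale by blast
  have "w - h *\<^sub>R A w = ?y - (2 * h) *\<^sub>R A ?y + h\<^sup>2 *\<^sub>R A (A ?y)"
    unfolding w_def using y AyD subspace_scale[OF subspace_D, of "A ?y" h]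
    by (simp add: A_diff A_scaleR algebra_simps power2_eq_square flip: scaleR_2)
  also have "\<dots> = x + h\<^sup>2 *\<^sub>R A (A ?y)" using J_eq[OF h V(1)] by simp
  finally have "J h (x + h\<^sup>2 *\<^sub>R A (A ?y)) = w" using J_unique[OF assms(1) w] by simp
  then have "?y = J h (J h (x + h\<^sup>2 *\<^sub>R A (A ?y)))" using J_unique[OF assms(1) y] w_def by simp
  also have "\<dots> = J h (J h x) + h\<^sup>2 *\<^sub>R J h (J h (A (A ?y)))"
    using assms V AAyV by (simp add: J_add J_scaleR J_in_V subspace_scale[OF subspace_V])
  finally have "N (?y - J h (J h x)) = h\<^sup>2 * N (J h (J h (A (A ?y))))"
    by (metis N_scaleR abs_power2 add_diff_cancel_left')
  also have "\<dots> \<le> h\<^sup>2 * N (A (A x))"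
    using J_contract[OF h V(3)] J_contract[OF assms(1) AAyV] J_contract[OF assms(1) J_in_V[OF assms(1) AAyV]]
    by (intro mult_left_mono) (auto simp: AAy)
  finally show ?thesis .
qed

text \<open>Contractivity propagates earlier errors without growth, so k local errors of size h^2
  simply add up.\<close>

lemma Jn_halve:
  assumes "h > 0" "x \<in> D" "A x \<in> D"
  shows "N ((J (2 * h) ^^ k) x - (J h ^^ (2 * k)) x) \<le> k * h\<^sup>2 * N (A (A x))"
proof (induction k)
  case (Suc k)
  have h: "2 * h > 0" using assms by simp
  have V: "x \<in> V" "A x \<in> V" "A (A x) \<in> V" using assms D_subset A_in_V by auto
  let ?p = "(J (2 * h) ^^ k) x" and ?q = "(J h ^^ (2 * k)) x"
  have pq: "?p \<in> V" "?q \<in> V" "?q \<in> D" using assms V h by (auto simp: Jn_in_V Jn_in_D)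
  have Aq: "A ?q \<in> D" "A (A ?q) = (J h ^^ (2 * k)) (A (A x))"
    using assms by (auto simp: AJn_commute Jn_in_D)
  have "N (J (2 * h) ?q - J h (J h ?q)) \<le> h\<^sup>2 * N (A (A x))"
    using J_halve[OF assms(1) pq(3) Aq(1)] Aq(2) Jn_contract[OF assms(1) V(3), of "2 * k"]
    by (smt (verit, best) mult_left_mono zero_le_power2)
  moreover have "J (2 * h) ?p - J (2 * h) ?q = J (2 * h) (?p - ?q)"
    using Jn_diff[OF h pq(1,2), of 1] by simp
  then have "N (J (2 * h) ?p - J (2 * h) ?q) \<le> N (?p - ?q)"
    using J_contract[OF h, of "?p - ?q"] pq subspace_diff[OF subspace_V] by simp
  ultimately show ?case
    using Suc N_triangle[of "J (2 * h) ?p" "J h (J h ?q)" "J (2 * h) ?q"]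
    by (simp add: algebra_simps)
qed simp

text \<open>With dyadic steps, level n + 1 halves the step of level n, so \<open>Jn_halve\<close>
  compares consecutive levels and the differences are summable.\<close>

definition euler :: "nat \<Rightarrow> real \<Rightarrow> 'a \<Rightarrow> 'a" where
  "euler n t = J (1 / 2 ^ n) ^^ nat \<lfloor>t * 2 ^ n\<rfloor>"

definition T :: "real \<Rightarrow> 'a \<Rightarrow> 'a" where
  "T t x = lim (\<lambda>n. euler n t x)"

section \<open>Convergence of the dyadic Euler scheme\<close>

lemma euler_in_V: "x \<in> V \<Longrightarrow> euler n t x \<in> V"
  by (simp add: euler_def Jn_in_V)

lemma euler_contract: "x \<in> V \<Longrightarrow> N (euler n t x) \<le> N x"
  by (simp add: euler_def Jn_contract)

lemma euler_diff: "x \<in> V \<Longrightarrow> y \<in> V \<Longrightarrow> euler n t (x - y) = euler n t x - euler n t y"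
  by (simp add: euler_def Jn_diff)

lemma euler_Suc_diff:
  assumes "t \<ge> 0" "x \<in> D" "A x \<in> D"
  shows "N (euler (Suc n) t x - euler n t x) \<le> (t * N (A (A x)) + N (A x)) * (1 / 2) ^ n"
proof -
  define h :: real where "h = 1 / 2 ^ Suc n"
  have h: "h > 0" "1 / 2 ^ n = 2 * h" by (auto simp: h_def)
  define k where "k = nat \<lfloor>t * 2 ^ n\<rfloor>"
  have ki: "int k = \<lfloor>t * 2 ^ n\<rfloor>" using assms by (simp add: k_def)
  \<comment> \<open>Since floor (2 y) - 2 floor y is 0 or 1, the finer grid makes at most one step
    beyond the 2 k halved ones. That step costs h N(A x); the halvings cost k h^2 N(A (A x)), where
    k \<le> t 2^n and h = 2^-(n+1).\<close>
  define d where "d = nat \<lfloor>t * 2 ^ Suc n\<rfloor> - 2 * k"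
  have double: "t * 2 ^ Suc n = 2 * (t * 2 ^ n)" by simp
  have "2 * \<lfloor>t * 2 ^ n\<rfloor> \<le> \<lfloor>t * 2 ^ Suc n\<rfloor>" "\<lfloor>t * 2 ^ Suc n\<rfloor> \<le> 2 * \<lfloor>t * 2 ^ n\<rfloor> + 1"
    unfolding double by linarith+
  then have d: "nat \<lfloor>t * 2 ^ Suc n\<rfloor> = 2 * k + d" "d \<le> 1"
    unfolding d_def ki[symmetric] by linarith+
  let ?q = "(J h ^^ (2 * k)) x"
  have V: "x \<in> V" "A x \<in> V" using assms D_subset A_in_V by auto
  have "N (euler (Suc n) t x - ?q) \<le> h * N (A x)"
  proof -
    have "N ((J h ^^ d) ?q - ?q) \<le> d * h * N (A ?q)"
      using Jn_step[OF h(1), of ?q d] assms h by (simp add: Jn_in_D)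
    also have "A ?q = (J h ^^ (2 * k)) (A x)" using AJn_commute assms h by simp
    also have "d * h * N \<dots> \<le> 1 * h * N (A x)"
      using d h Jn_contract[OF h(1) V(2)] N_nonneg by (intro mult_mono) auto
    finally show ?thesis unfolding euler_def d(1) h_def[symmetric]
      by (simp add: funpow_add add.commute)
  qed
  moreover have "N (?q - euler n t x) \<le> k * h\<^sup>2 * N (A (A x))"
    using Jn_halve[OF h(1) assms(2,3), of k] unfolding euler_def h(2) k_def
    by (simp add: N_diff_commute)
  moreover have "k * h\<^sup>2 * N (A (A x)) \<le> t * (1 / 2) ^ n * N (A (A x))"
  proof (intro mult_right_mono N_nonneg)
    have "real k \<le> t * 2 ^ n" using ki by (metis of_int_floor_le of_int_of_nat_eq)
    then have "k * h\<^sup>2 \<le> t * 2 ^ n * h\<^sup>2" by (intro mult_right_mono) auto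
    also have "\<dots> = t * (1 / 2) ^ n / 4" by (simp add: h_def power2_eq_square field_simps)
    also have "\<dots> \<le> t * (1 / 2) ^ n" using assms by simp
    finally show "k * h\<^sup>2 \<le> t * (1 / 2) ^ n" .
  qed
  moreover have "h * N (A x) \<le> (1 / 2) ^ n * N (A x)"
    by (intro mult_right_mono N_nonneg) (auto simp: h_def power_divide field_simps)
  ultimately show ?thesis
    using N_triangle[of "euler (Suc n) t x" "euler n t x" ?q] by (simp add: algebra_simps)
qed

lemma convergent_euler_smooth:
  assumes "t \<ge> 0" "x \<in> D" "A x \<in> D"
  shows "convergent (\<lambda>n. euler n t x)"
proof -
  have "summable (\<lambda>n. (t * N (A (A x)) + N (A x)) * (1 / 2) ^ n)"
    by (intro summable_mult summable_geometric) auto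
  then have "summable (\<lambda>n. euler (Suc n) t x - euler n t x)"
    by (rule summable_comparison_test'[where N = 0])
       (meson norm_le_N euler_Suc_diff[OF assms] order_trans)
  then have "convergent (\<lambda>n. \<Sum>i<n. euler (Suc i) t x - euler i t x)"
    by (simp add: summable_iff_convergent)
  then have "convergent (\<lambda>n. (euler n t x - euler 0 t x))"
    by (simp only: sum_lessThan_telescope[where f = "\<lambda>n. euler n t x"])
  then have "convergent (\<lambda>n. (euler n t x - euler 0 t x) + euler 0 t x)"
    by (intro convergent_add convergent_const)
  then show ?thesis by simp
qed

text \<open>The domain of A^2 is reached by smoothing: for z in \<open>D\<close>, A (J h z) = J h (A
  z) lies in \<open>D\<close> again, and J h z tends to z as h tends to 0.\<close>

lemma dense_smooth:
  assumes "f \<in> V" "e > 0"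
  obtains x where "x \<in> D" "A x \<in> D" "N (f - x) < e"
proof -
  obtain z where z: "z \<in> D" "N (f - z) < e / 2" using dense[of f "e / 2"] assms by auto
  \<comment> \<open>Chosen so that h N(A z) \<le> e / 2; adding 1 covers the case A z = 0.\<close>
  define h where "h = e / 2 / (N (A z) + 1)"
  have pos: "N (A z) + 1 > 0" using N_nonneg[of "A z"] by linarith
  have h: "h > 0" using assms pos by (simp add: h_def)
  have V: "z \<in> V" "A z \<in> V" using z D_subset A_in_V by auto
  have "h * N (A z) \<le> e / 2"
    using pos assms by (simp add: h_def pos_divide_le_eq)
  then have "N (J h z - z) \<le> e / 2" using J_step[OF h z(1)] by linarith
  then have "N (f - J h z) < e"
    using z(2) N_triangle[of f "J h z" z] N_diff_commute[of z] by (smt (verit) field_sum_of_halves)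
  moreover have "A (J h z) \<in> D" using AJ_commute[OF h z(1)] J_in_D[OF h V(2)] by simp
  ultimately show ?thesis using that J_in_D[OF h V(1)] by blast
qed

text \<open>The approximations are contractions uniformly in n, so the Cauchy property extends from
  the dense domain of A^2 by an e / 3 argument.\<close>

lemma convergent_euler:
  assumes "t \<ge> 0" "x \<in> V" shows "convergent (\<lambda>n. euler n t x)"
proof -
  have "Cauchy (\<lambda>n. euler n t x)"
  proof (rule metric_CauchyI)
    fix e :: real assume e: "e > 0"
    obtain z where z: "z \<in> D" "A z \<in> D" "N (x - z) < e / 3" using dense_smooth[of x "e / 3"] assms e by auto
    have zV: "z \<in> V" using z D_subset by auto
    obtain M where M: "\<And>m n. m \<ge> M \<Longrightarrow> n \<ge> M \<Longrightarrow> dist (euler m t z) (euler n t z) < e / 3"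
      using convergent_Cauchy[OF convergent_euler_smooth[OF assms(1) z(1,2)]] e
      by (metis metric_CauchyD divide_pos_pos zero_less_numeral)
    have *: "dist (euler n t x) (euler n t z) < e / 3" for n
      using euler_contract[of "x - z" n t] euler_diff[OF assms(2) zV, of n t] z(3) assms zV
        norm_le_N[of "euler n t (x - z)"] subspace_diff[OF subspace_V] by (simp add: dist_norm)
    have "dist (euler m t x) (euler n t x) < e" if "m \<ge> M" "n \<ge> M" for m n
      using M[OF that] *[of m] *[of n] dist_triangle[of "euler m t x" "euler n t x" "euler m t z"]
        dist_triangle2[of "euler m t z" "euler n t x" "euler n t z"] 
      by (simp add: dist_commute)
    then show "\<exists>M. \<forall>m\<ge>M. \<forall>n\<ge>M. dist (euler m t x) (euler n t x) < e" by blast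
  qed
  then show ?thesis by (rule Cauchy_convergent)
qed

section \<open>The limit semigroup\<close>

lemma euler_LIMSEQ: "t \<ge> 0 \<Longrightarrow> x \<in> V \<Longrightarrow> (\<lambda>n. euler n t x) \<longlonglongrightarrow> T t x"
  unfolding T_def using convergent_euler convergent_LIMSEQ_iff by blast

text \<open>One principle for all invariance statements: it is applied to the subspace
  \<open>V\<close> itself and later to the positive cone.\<close>

lemma T_in_closed:
  assumes "closed K" "\<And>h f. h > 0 \<Longrightarrow> f \<in> V \<Longrightarrow> f \<in> K \<Longrightarrow> J h f \<in> K" "t \<ge> 0" "x \<in> V" "x \<in> K"
  shows "T t x \<in> K"
proof (rule closed_sequentially[OF assms(1) _ euler_LIMSEQ[OF assms(3,4)]])
  have "(J h ^^ k) x \<in> K" if "h > 0" for h k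
    using assms(2,4,5) that by (induction k) (auto simp: Jn_in_V)
  then show "\<And>n. euler n t x \<in> K" by (simp add: euler_def)
qed

lemma T_in_V: "t \<ge> 0 \<Longrightarrow> x \<in> V \<Longrightarrow> T t x \<in> V"
  using T_in_closed[OF closed_V J_in_V] by blast

lemma T_contract: "t \<ge> 0 \<Longrightarrow> x \<in> V \<Longrightarrow> N (T t x) \<le> N x"
  by (rule LIMSEQ_le_const2[OF tendsto_N[OF euler_LIMSEQ]]) (auto intro: euler_contract)

lemma T_add: "t \<ge> 0 \<Longrightarrow> x \<in> V \<Longrightarrow> y \<in> V \<Longrightarrow> T t (x + y) = T t x + T t y"
  using tendsto_add[OF euler_LIMSEQ euler_LIMSEQ, of t x t y] euler_LIMSEQ[of t "x + y"]
    subspace_add[OF subspace_V]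
  by (auto simp: euler_def Jn_add intro: LIMSEQ_unique)

lemma T_scaleR: "t \<ge> 0 \<Longrightarrow> x \<in> V \<Longrightarrow> T t (c *\<^sub>R x) = c *\<^sub>R T t x"
  using tendsto_scaleR[OF tendsto_const euler_LIMSEQ, of t x c] euler_LIMSEQ[of t "c *\<^sub>R x"]
    subspace_scale[OF subspace_V]
  by (auto simp: euler_def Jn_scaleR intro: LIMSEQ_unique)

lemma T_diff: "t \<ge> 0 \<Longrightarrow> x \<in> V \<Longrightarrow> y \<in> V \<Longrightarrow> T t (x - y) = T t x - T t y"
  using T_add[of t x "-1 *\<^sub>R y"] T_scaleR[of t y "-1"] subspace_scale[OF subspace_V, of y "-1"] by simp

lemma floor_step_LIMSEQ: "(\<lambda>n. nat \<lfloor>t * 2 ^ n\<rfloor> * (1 / 2 ^ n)) \<longlonglongrightarrow> t" if "t \<ge> 0" for t :: real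
proof (rule tendsto_sandwich)
  show "\<forall>\<^sub>F n in sequentially. t - (1 / 2) ^ n \<le> nat \<lfloor>t * 2 ^ n\<rfloor> * (1 / 2 ^ n)"
  proof (intro always_eventually allI)
    fix n
    have "t * 2 ^ n - 1 \<le> nat \<lfloor>t * 2 ^ n\<rfloor>" by linarith
    then have "(t * 2 ^ n - 1) * (1 / 2 ^ n) \<le> nat \<lfloor>t * 2 ^ n\<rfloor> * (1 / 2 ^ n)"
      by (intro mult_right_mono) auto
    then show "t - (1 / 2) ^ n \<le> nat \<lfloor>t * 2 ^ n\<rfloor> * (1 / 2 ^ n)"
      by (simp add: algebra_simps power_divide)
  qed
  show "\<forall>\<^sub>F n in sequentially. nat \<lfloor>t * 2 ^ n\<rfloor> * (1 / 2 ^ n) \<le> t"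
  proof (intro always_eventually allI)
    fix n
    have "real (nat \<lfloor>t * 2 ^ n\<rfloor>) \<le> t * 2 ^ n" using that by simp
    then show "nat \<lfloor>t * 2 ^ n\<rfloor> * (1 / 2 ^ n) \<le> t" by (simp add: field_simps)
  qed
  show "(\<lambda>n. t - (1 / 2) ^ n) \<longlonglongrightarrow> t"
    using tendsto_diff[OF tendsto_const LIMSEQ_power_zero[of "1 / 2 :: real"], of t] by simp
qed simp

lemma T_step:
  assumes "t \<ge> 0" "x \<in> D" shows "N (T t x - x) \<le> t * N (A x)"
proof (rule LIMSEQ_le)
  have x: "x \<in> V" using assms D_subset by auto
  show "(\<lambda>n. N (euler n t x - x)) \<longlonglongrightarrow> N (T t x - x)"
    by (intro tendsto_N tendsto_diff euler_LIMSEQ assms x tendsto_const)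
  show "(\<lambda>n. nat \<lfloor>t * 2 ^ n\<rfloor> * (1 / 2 ^ n) * N (A x)) \<longlonglongrightarrow> t * N (A x)"
    by (intro tendsto_mult_right floor_step_LIMSEQ assms)
  show "\<exists>M. \<forall>n\<ge>M. N (euler n t x - x) \<le> nat \<lfloor>t * 2 ^ n\<rfloor> * (1 / 2 ^ n) * N (A x)"
    unfolding euler_def by (intro exI[of _ 0] allI impI Jn_step assms) simp
qed

lemma T_deriv:
  assumes "t \<ge> 0" "x \<in> D" "z \<in> D"
  shows "N (T t x - x - t *\<^sub>R A x) \<le> t * (2 * N (A x - z) + t * N (A z))"
proof (rule LIMSEQ_le)
  have x: "x \<in> V" using assms D_subset by auto
  let ?t = "\<lambda>n. real (nat \<lfloor>t * 2 ^ n\<rfloor>) * (1 / 2 ^ n)"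
  show "(\<lambda>n. N (euler n t x - x - ?t n *\<^sub>R A x)) \<longlonglongrightarrow> N (T t x - x - t *\<^sub>R A x)"
    by (intro tendsto_N tendsto_diff euler_LIMSEQ assms x tendsto_const tendsto_scaleR floor_step_LIMSEQ)
  show "(\<lambda>n. ?t n * (2 * N (A x - z) + ?t n * N (A z))) \<longlonglongrightarrow> t * (2 * N (A x - z) + t * N (A z))"
    by (intro tendsto_intros floor_step_LIMSEQ assms)
  show "\<exists>M. \<forall>n\<ge>M. N (euler n t x - x - ?t n *\<^sub>R A x) \<le> ?t n * (2 * N (A x - z) + ?t n * N (A z))"
    unfolding euler_def by (intro exI[of _ 0] allI impI Jn_deriv assms) simp
qed

text \<open>The grids satisfy the semigroup law up to one step, which tends to 0 with n. Domain
  elements are used because the cost of that step is measured by A x.\<close>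

lemma T_semigroup_D:
  assumes "s \<ge> 0" "t \<ge> 0" "x \<in> D" shows "T (s + t) x = T s (T t x)"
proof -
  have x: "x \<in> V" "A x \<in> V" using assms D_subset A_in_V by auto
  have bound: "N (euler n (s + t) x - euler n s (T t x)) \<le> (1 / 2) ^ n * N (A x) + N (euler n t x - T t x)" for n
  proof -
    define h :: real where "h = 1 / 2 ^ n"
    have h: "h > 0" by (simp add: h_def)
    define k l where "k = nat \<lfloor>s * 2 ^ n\<rfloor>" and "l = nat \<lfloor>t * 2 ^ n\<rfloor>"
    \<comment> \<open>floor is additive up to 1, so d is 0 or 1: the number of steps for s + t
      exceeds k + l by at most one.\<close>
    define d where "d = nat \<lfloor>(s + t) * 2 ^ n\<rfloor> - (k + l)"
    have kl: "int k = \<lfloor>s * 2 ^ n\<rfloor>" "int l = \<lfloor>t * 2 ^ n\<rfloor>" using assms by (auto simp: k_def l_def)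
    have "\<lfloor>s * 2 ^ n\<rfloor> + \<lfloor>t * 2 ^ n\<rfloor> \<le> \<lfloor>(s + t) * 2 ^ n\<rfloor>" "\<lfloor>(s + t) * 2 ^ n\<rfloor> \<le> \<lfloor>s * 2 ^ n\<rfloor> + \<lfloor>t * 2 ^ n\<rfloor> + 1"
      unfolding distrib_right by linarith+
    then have d: "nat \<lfloor>(s + t) * 2 ^ n\<rfloor> = d + (k + l)" "d \<le> 1"
      unfolding d_def kl[symmetric] by linarith+
    let ?q = "(J h ^^ (k + l)) x"
    have "N ((J h ^^ d) ?q - ?q) \<le> d * h * N (A ?q)"
      using Jn_step[OF h, of ?q d] assms h by (simp add: Jn_in_D)
    also have "A ?q = (J h ^^ (k + l)) (A x)" using AJn_commute assms h by simp
    also have "d * h * N \<dots> \<le> 1 * h * N (A x)"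
      using d h Jn_contract[OF h x(2)] N_nonneg by (intro mult_mono) auto
    finally have "N (euler n (s + t) x - euler n s (euler n t x)) \<le> (1 / 2) ^ n * N (A x)"
      unfolding euler_def d(1) h_def[symmetric] k_def[symmetric] l_def[symmetric]
      by (simp add: funpow_add h_def power_divide)
    moreover have "N (euler n s (euler n t x) - euler n s (T t x)) \<le> N (euler n t x - T t x)"
      using euler_contract[of "euler n t x - T t x" n s] euler_diff[of "euler n t x" "T t x" n s]
        euler_in_V x T_in_V assms subspace_diff[OF subspace_V] by simp
    ultimately show ?thesis
      using N_triangle[of "euler n (s + t) x" "euler n s (T t x)" "euler n s (euler n t x)"] by linarith
  qed
  have "N (T (s + t) x - T s (T t x)) \<le> 0 * N (A x) + 0"
  proof (rule LIMSEQ_le)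
    show "(\<lambda>n. N (euler n (s + t) x - euler n s (T t x))) \<longlonglongrightarrow> N (T (s + t) x - T s (T t x))"
      using assms x by (intro tendsto_N tendsto_diff euler_LIMSEQ T_in_V) auto
    show "(\<lambda>n. (1 / 2) ^ n * N (A x) + N (euler n t x - T t x)) \<longlonglongrightarrow> 0 * N (A x) + 0"
      using assms x by (intro tendsto_intros N_tendsto_zero euler_LIMSEQ LIMSEQ_power_zero) auto
  qed (use bound in blast)
  then show ?thesis by (intro N_eqI) simp
qed

lemma T_semigroup:
  assumes "s \<ge> 0" "t \<ge> 0" "x \<in> V" shows "T (s + t) x = T s (T t x)"
proof -
  have "N (T (s + t) x - T s (T t x)) \<le> e" if e: "e > 0" for e
  proof -
    obtain z where z: "z \<in> D" "N (x - z) < e / 2" using dense[of x "e / 2"] assms e by auto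
    have zV: "z \<in> V" "x - z \<in> V" using z D_subset assms subspace_diff[OF subspace_V] by auto
    have "T (s + t) x - T s (T t x) = T (s + t) (x - z) - T s (T t (x - z))"
      using T_semigroup_D[OF assms(1,2) z(1)] assms zV by (simp add: T_diff T_in_V)
    also have "N \<dots> \<le> N (T (s + t) (x - z)) + N (T s (T t (x - z)))"
      using N_add[of "T (s + t) (x - z)" "- T s (T t (x - z))"] by (simp add: N_minus)
    also have "\<dots> \<le> N (x - z) + N (x - z)"
      using T_contract[of "s + t" "x - z"] T_contract[of t "x - z"] T_contract[of s "T t (x - z)"] T_in_V[of t "x - z"]
        assms zV by linarith
    finally show ?thesis using z by simp
  qed
  then have "N (T (s + t) x - T s (T t x)) \<le> 0" by (rule dense_ge)
  then show ?thesis by (intro N_eqI) simp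
qed

lemma T_zero: "x \<in> V \<Longrightarrow> T 0 x = x"
  by (simp add: T_def euler_def lim_const)

lemma T_strongly_continuous:
  assumes "x \<in> V" shows "((\<lambda>t. N (T t x - x)) \<longlongrightarrow> 0) (at_right 0)"
proof (rule tendstoI)
  fix e :: real assume e: "e > 0"
  obtain z where z: "z \<in> D" "N (x - z) < e / 4" using dense[of x "e / 4"] assms e by auto
  have zV: "z \<in> V" "x - z \<in> V" using z D_subset assms subspace_diff[OF subspace_V] by auto
  have "((\<lambda>t. t * N (A z)) \<longlongrightarrow> 0 * N (A z)) (at_right 0)" by (intro tendsto_intros)
  then have "\<forall>\<^sub>F t in at_right 0. t * N (A z) < e / 2"
    using e by (intro order_tendstoD(2)[of _ "0 * N (A z)"]) auto
  then show "\<forall>\<^sub>F t in at_right 0. dist (N (T t x - x)) 0 < e"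
    using eventually_at_right_less[of 0]
  proof eventually_elim
    case (elim t)
    have "T t x - x = T t (x - z) + ((T t z - z) - (x - z))"
      using elim assms zV by (simp add: T_diff)
    then have "N (T t x - x) \<le> N (T t (x - z)) + (N (T t z - z) + N (x - z))"
      using N_add[of "T t (x - z)" "(T t z - z) - (x - z)"] N_add[of "T t z - z" "- (x - z)"] N_minus[of "x - z"]
      by (simp only: diff_conv_add_uminus)
    also have "\<dots> < e"
      using T_contract[of t "x - z"] T_step[of t z] z elim zV by linarith
    finally show ?case using N_nonneg by simp
  qed
qed

section \<open>The generator\<close>

lemma T_right_deriv:
  assumes "x \<in> D" shows "right_deriv_at_0 N T x (A x)"
  unfolding right_deriv_at_0_def
proof (rule tendstoI)
  fix e :: real assume e: "e > 0"
  obtain z where z: "z \<in> D" "N (A x - z) < e / 4" using dense[of "A x" "e / 4"] A_in_V assms e by auto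
  have "((\<lambda>t. t * N (A z)) \<longlongrightarrow> 0 * N (A z)) (at_right 0)" by (intro tendsto_intros)
  then have "\<forall>\<^sub>F t in at_right 0. t * N (A z) < e / 2"
    using e by (intro order_tendstoD(2)[of _ "0 * N (A z)"]) auto
  then show "\<forall>\<^sub>F t in at_right 0. dist (N ((1 / t) *\<^sub>R (T t x - x) - A x)) 0 < e"
    using eventually_at_right_less[of 0]
  proof eventually_elim
    case (elim t)
    have "(1 / t) *\<^sub>R (T t x - x) - A x = (1 / t) *\<^sub>R (T t x - x - t *\<^sub>R A x)"
      using elim by (simp add: scaleR_diff_right)
    then have "N ((1 / t) *\<^sub>R (T t x - x) - A x) = (1 / t) * N (T t x - x - t *\<^sub>R A x)"
      using elim by (simp add: N_scaleR)
    also have "\<dots> \<le> (1 / t) * (t * (2 * N (A x - z) + t * N (A z)))"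
      using T_deriv[OF _ assms z(1), of t] elim by (intro mult_left_mono) auto
    also have "\<dots> < e" using z elim by simp
    finally show ?case using N_nonneg by simp
  qed
qed

lemma right_deriv_diff:
  assumes "right_deriv_at_0 N T x y" "right_deriv_at_0 N T u v" "x \<in> V" "u \<in> V"
  shows "right_deriv_at_0 N T (x - u) (y - v)"
  unfolding right_deriv_at_0_def
proof (rule tendsto_sandwich[OF _ _ tendsto_const])
  let ?q = "\<lambda>x t. (1 / t) *\<^sub>R (T t x - x)"
  show "\<forall>\<^sub>F t in at_right 0. N (?q (x - u) t - (y - v)) \<le> N (?q x t - y) + N (?q u t - v)"
    using eventually_at_right_less[of 0]
  proof eventually_elim
    case (elim t)
    have "?q (x - u) t - (y - v) = (?q x t - y) + - (?q u t - v)"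
      using elim assms by (simp add: T_diff algebra_simps)
    then show ?case using N_add[of "?q x t - y" "- (?q u t - v)"] by (simp only: N_minus)
  qed
  show "((\<lambda>t. N (?q x t - y) + N (?q u t - v)) \<longlongrightarrow> 0) (at_right 0)"
    using tendsto_add[OF assms(1,2)[unfolded right_deriv_at_0_def]] by simp
qed (auto simp: N_nonneg)

text \<open>Write (1 + 1/t) x as (x - y) + T t x / t minus the error of the difference quotient.
  Contractivity bounds the middle term by N x / t, which cancels the same amount on the left; the
  error vanishes as t tends to 0.\<close>

lemma right_deriv_dissipative:
  assumes "right_deriv_at_0 N T x y" "x \<in> V" shows "N x \<le> N (x - y)"
proof -
  have "N x - N (x - y) \<le> 0"
  proof (rule tendsto_le[OF _ assms(1)[unfolded right_deriv_at_0_def] tendsto_const])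
    show "\<forall>\<^sub>F t in at_right 0. N x - N (x - y) \<le> N ((1 / t) *\<^sub>R (T t x - x) - y)"
      using eventually_at_right_less[of 0]
    proof eventually_elim
      case (elim t)
      have "(1 + 1 / t) * N x = N ((1 + 1 / t) *\<^sub>R x)" using elim by (simp add: N_scaleR)
      also have "(1 + 1 / t) *\<^sub>R x = (x - y) + ((1 / t) *\<^sub>R T t x - ((1 / t) *\<^sub>R (T t x - x) - y))"
        by (simp add: algebra_simps)
      also have "N \<dots> \<le> N (x - y) + (N ((1 / t) *\<^sub>R T t x) + N ((1 / t) *\<^sub>R (T t x - x) - y))"
        using N_add[of "x - y" "(1 / t) *\<^sub>R T t x - ((1 / t) *\<^sub>R (T t x - x) - y)"]
          N_add[of "(1 / t) *\<^sub>R T t x" "- ((1 / t) *\<^sub>R (T t x - x) - y)"]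
          N_minus[of "(1 / t) *\<^sub>R (T t x - x) - y"]
        by (simp only: diff_conv_add_uminus)
      also have "N ((1 / t) *\<^sub>R T t x) \<le> 1 / t * N x"
        using elim T_contract[of t x] assms by (simp add: N_scaleR divide_right_mono)
      finally show ?case by (simp add: algebra_simps)
    qed
  qed simp
  then show ?thesis by simp
qed

theorem C0_semigroup_T: "C0_semigroup_on V N T"
  unfolding C0_semigroup_on_def bounded_operator_on_def
proof (intro conjI allI impI ballI)
  show "\<exists>C. \<forall>x\<in>V. N (T t x) \<le> C * N x" if "t \<ge> 0" for t
    using T_contract[OF that] by (intro exI[of _ 1]) simp
qed (use T_in_V T_add T_scaleR T_zero T_semigroup T_strongly_continuous in auto)

theorem contractive_T: "contractive_on V N T"
  unfolding contractive_on_def using T_contract by blast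

text \<open>A right derivative at 0 cannot exist outside \<open>D\<close>: \<open>I - A\<close> is already onto, and the
  difference quotient of a contraction semigroup is dissipative.\<close>
theorem generator_T: "generator_on V N T D A"
  unfolding generator_on_def
proof (intro conjI ballI)
  show "D = {x \<in> V. \<exists>y\<in>V. right_deriv_at_0 N T x y}"
  proof (intro equalityI subsetI)
    fix x assume "x \<in> {x \<in> V. \<exists>y\<in>V. right_deriv_at_0 N T x y}"
    then obtain y where y: "x \<in> V" "y \<in> V" "right_deriv_at_0 N T x y" by blast
    then have "x - y \<in> V" using subspace_diff[OF subspace_V] by blast
    then obtain z where z: "z \<in> D" "z - A z = x - y" using range[of 1 "x - y"] by auto
    have "N (x - z) \<le> N ((x - z) - (y - A z))"
      using y z D_subset subspace_diff[OF subspace_V]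
      by (intro right_deriv_dissipative right_deriv_diff T_right_deriv) auto
    also have "(x - z) - (y - A z) = 0" using z(2) by (simp add: algebra_simps)
    finally have "x = z" by (intro N_eqI) simp
    then show "x \<in> D" using z by simp
  qed (use D_subset A_in_V T_right_deriv in auto)
qed (use A_in_V T_right_deriv in auto)

end

section \<open>The space \<open>L\<^sup>1\<close>\<close>

lemma rep_zero_l1: "AE x in lebesgue. rep_l1 0 x = 0"
  unfolding zero_l1_def by (rule rep_abs_l1) simp

lemma l1_eqI: "(AE x in lebesgue. rep_l1 f x = rep_l1 g x) \<Longrightarrow> f = g"
  using Quotient3_rel_rep[OF Quotient3_l1, of f g] integrable_rep_l1 by (simp add: L1_eq_def)

lemma rep_add_l1: "AE x in lebesgue. rep_l1 (f + g) x = rep_l1 f x + rep_l1 g x"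
proof -
  have "f + g = abs_l1 (\<lambda>x. rep_l1 f x + rep_l1 g x)"
    by (simp add: plus_l1_def)
  then show ?thesis using rep_abs_l1[of "\<lambda>x. rep_l1 f x + rep_l1 g x"] integrable_rep_l1 by simp
qed

lemma rep_scaleR_l1: "AE x in lebesgue. rep_l1 (c *\<^sub>R f) x = c * rep_l1 f x"
proof -
  have "c *\<^sub>R f = abs_l1 (\<lambda>x. c * rep_l1 f x)"
    by (simp add: scaleR_l1_def)
  then show ?thesis using rep_abs_l1[of "\<lambda>x. c * rep_l1 f x"] integrable_rep_l1 by simp
qed

lemma rep_uminus_l1: "AE x in lebesgue. rep_l1 (- f) x = - rep_l1 f x"
  using rep_scaleR_l1[of "-1" f] by simp

lemma rep_diff_l1: "AE x in lebesgue. rep_l1 (f - g) x = rep_l1 f x - rep_l1 g x"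
  using rep_add_l1[of f "- g"] rep_uminus_l1[of g] by auto

lemma norm_l1_rep: "norm f = (LINT x|lebesgue. \<bar>rep_l1 f x\<bar>)"
  by (simp add: norm_l1_def)

lemma le_l1_rep: "f \<le> g \<longleftrightarrow> (AE x in lebesgue. rep_l1 f x \<le> rep_l1 g x)"
  by (simp add: less_eq_l1_def)

lemma nonneg_l1_rep: "0 \<le> f \<longleftrightarrow> (AE x in lebesgue. 0 \<le> rep_l1 f x)"
  unfolding le_l1_rep using rep_zero_l1 by (intro eventually_subst) auto

lemma norm_abs_l1: "integrable lebesgue f \<Longrightarrow> norm (abs_l1 f) = (LINT x|lebesgue. \<bar>f x\<bar>)"
  unfolding norm_l1_rep using rep_abs_l1[of f] integrable_rep_l1[of "abs_l1 f"]
  by (intro integral_cong_AE) auto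

text \<open>Riesz-Fischer: a Cauchy sequence has a subsequence converging almost everywhere, and
  Fatou's lemma turns its pointwise limit into the limit in norm of the whole sequence.\<close>

instance l1 :: complete_space
proof
  fix X :: "nat \<Rightarrow> l1" assume X: "Cauchy X"
  define s where "s n = rep_l1 (X n)" for n
  have s [measurable]: "integrable lebesgue (s n)" for n by (simp add: s_def integrable_rep_l1)
  have dist: "dist (X m) (X n) = (LINT x|lebesgue. norm (s m x - s n x))" for m n
    unfolding dist_norm norm_l1_rep s_def using rep_diff_l1[of "X m" "X n"] integrable_rep_l1
    by (intro integral_cong_AE) auto
  have C: "\<exists>N. \<forall>i\<ge>N. \<forall>j\<ge>N. LINT x|lebesgue. norm (s i x - s j x) < e" if "e > 0" for e
    using metric_CauchyD[OF X that] dist by simp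
  obtain r where r: "strict_mono r" "AE x in lebesgue. Cauchy (\<lambda>i. s (r i) x)"
    using cauchy_L1_AE_cauchy_subseq[of lebesgue s, OF s C] by blast
  define f where "f x = lim (\<lambda>i. s (r i) x)" for x
  have meas: "s n \<in> borel_measurable lebesgue" for n using s by auto
  have f: "f \<in> borel_measurable lebesgue"
    unfolding f_def using meas by (intro borel_measurable_lim_metric) auto
  have lim: "AE x in lebesgue. (\<lambda>i. s (r i) x) \<longlonglongrightarrow> f x"
    using r(2) by eventually_elim (simp add: f_def Cauchy_convergent_iff convergent_LIMSEQ_iff)
  text \<open>Fatou's lemma along the a.e. convergent subsequence.\<close>
  have fatou: "(\<integral>\<^sup>+x. norm (s n x - f x) \<partial>lebesgue) \<le> ennreal e"
    if e: "e > 0" and N: "\<forall>i\<ge>N. \<forall>j\<ge>N. LINT x|lebesgue. norm (s i x - s j x) < e" and n: "n \<ge> N" for e N n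
  proof -
    have "(\<integral>\<^sup>+x. norm (s n x - f x) \<partial>lebesgue) = (\<integral>\<^sup>+x. liminf (\<lambda>i. ennreal (norm (s n x - s (r i) x))) \<partial>lebesgue)"
    proof (rule nn_integral_cong_AE, use lim in eventually_elim)
      case (elim x)
      then have "(\<lambda>i. ennreal (norm (s n x - s (r i) x))) \<longlonglongrightarrow> ennreal (norm (s n x - f x))"
        by (intro tendsto_ennrealI tendsto_intros)
      then show ?case by (intro lim_imp_Liminf[symmetric]) auto
    qed
    also have "\<dots> \<le> liminf (\<lambda>i. \<integral>\<^sup>+x. norm (s n x - s (r i) x) \<partial>lebesgue)"
      using meas by (intro nn_integral_liminf) auto
    also have "\<dots> \<le> limsup (\<lambda>i. \<integral>\<^sup>+x. norm (s n x - s (r i) x) \<partial>lebesgue)"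
      by (intro Liminf_le_Limsup) simp
    also have "\<dots> \<le> ennreal e"
    proof (intro Limsup_bounded, rule eventually_sequentiallyI[of N])
      fix i assume "i \<ge> N"
      then have "r i \<ge> N" using seq_suble[OF r(1), of i] by simp
      then show "(\<integral>\<^sup>+x. norm (s n x - s (r i) x) \<partial>lebesgue) \<le> ennreal e"
        using N n s by (subst nn_integral_eq_integral) (auto intro!: ennreal_leI intro: less_imp_le)
    qed
    finally show ?thesis .
  qed
  obtain N1 where N1: "\<forall>i\<ge>N1. \<forall>j\<ge>N1. LINT x|lebesgue. norm (s i x - s j x) < 1" using C[of 1] by auto
  \<comment> \<open>Fatou's bound concerns differences only, so integrability of f is recovered from
    one member of the sequence minus an integrable difference.\<close>
  have "integrable lebesgue (\<lambda>x. s N1 x - f x)"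
    using fatou[OF _ N1, of N1] f meas by (intro integrableI_bounded) (auto simp: top.not_eq_extremum le_less_trans)
  then have "integrable lebesgue (\<lambda>x. s N1 x - (s N1 x - f x))"
    by (rule Bochner_Integration.integrable_diff[OF s])
  then have fi: "integrable lebesgue f"
    by (simp only: diff_diff_eq2 add_diff_cancel_left')
  have "X \<longlonglongrightarrow> abs_l1 f"
  proof (rule metric_LIMSEQ_I)
    fix e :: real assume "e > 0"
    then obtain N where N: "\<forall>i\<ge>N. \<forall>j\<ge>N. LINT x|lebesgue. norm (s i x - s j x) < e / 2" using C[of "e / 2"] by auto
    have "dist (X n) (abs_l1 f) < e" if "n \<ge> N" for n
    proof -
      have "dist (X n) (abs_l1 f) = (LINT x|lebesgue. norm (s n x - f x))"
        unfolding dist_norm norm_l1_rep s_def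
        using rep_diff_l1[of "X n" "abs_l1 f"] rep_abs_l1[OF fi] integrable_rep_l1 fi
        by (intro integral_cong_AE) auto
      moreover have "ennreal (LINT x|lebesgue. norm (s n x - f x)) \<le> ennreal (e / 2)"
        using fatou[OF _ N that] \<open>e > 0\<close> s fi
          nn_integral_eq_integral[of lebesgue "\<lambda>x. norm (s n x - f x)"] by simp
      ultimately show ?thesis using \<open>e > 0\<close> by (simp add: ennreal_le_iff)
    qed
    then show "\<exists>N. \<forall>n\<ge>N. dist (X n) (abs_l1 f) < e" by blast
  qed
  then show "convergent X" by (rule convergentI)
qed

instance l1 :: banach ..

section \<open>The integral functional and the positive cone\<close>

definition lint :: "l1 \<Rightarrow> real" where
  "lint f = (LINT x|lebesgue. rep_l1 f x)"

lemma lint_add: "lint (f + g) = lint f + lint g"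
proof -
  have "lint (f + g) = (LINT x|lebesgue. rep_l1 f x + rep_l1 g x)"
    unfolding lint_def using rep_add_l1 integrable_rep_l1 by (intro integral_cong_AE) auto
  then show ?thesis by (simp add: lint_def integrable_rep_l1)
qed

lemma lint_scaleR: "lint (c *\<^sub>R f) = c * lint f"
proof -
  have "lint (c *\<^sub>R f) = (LINT x|lebesgue. c * rep_l1 f x)"
    unfolding lint_def using rep_scaleR_l1 integrable_rep_l1 by (intro integral_cong_AE) auto
  then show ?thesis by (simp add: lint_def)
qed

lemma bounded_linear_lint: "bounded_linear lint"
proof (rule bounded_linear_intro)
  show "norm (lint f) \<le> norm f * 1" for f
    using integral_norm_bound[of lebesgue "rep_l1 f"] by (simp add: lint_def norm_l1_rep)
qed (simp_all add: lint_add lint_scaleR)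

lemmas lint_diff = linear_diff[OF bounded_linear.linear[OF bounded_linear_lint]]
lemmas lint_minus = linear_neg[OF bounded_linear.linear[OF bounded_linear_lint]]
lemmas lint_zero = linear_0[OF bounded_linear.linear[OF bounded_linear_lint]]

lemma lint_nonneg: "0 \<le> f \<Longrightarrow> 0 \<le> lint f"
  by (auto simp: nonneg_l1_rep lint_def intro: integral_nonneg_AE)

text \<open>|f| - f is nonnegative, so its integral vanishes exactly when it is 0 almost everywhere.
  In this form the cone is the set where two continuous functions agree, hence closed, and the norm
  is additive on it.\<close>

lemma nonneg_l1_iff: "0 \<le> f \<longleftrightarrow> norm f = lint f"
proof -
  have "norm f - lint f = (LINT x|lebesgue. \<bar>rep_l1 f x\<bar> - rep_l1 f x)"
    by (simp add: norm_l1_rep lint_def integrable_rep_l1)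
  then have "norm f = lint f \<longleftrightarrow> (LINT x|lebesgue. \<bar>rep_l1 f x\<bar> - rep_l1 f x) = 0" by auto
  also have "\<dots> \<longleftrightarrow> (AE x in lebesgue. \<bar>rep_l1 f x\<bar> - rep_l1 f x = 0)"
    by (intro integral_nonneg_eq_0_iff_AE) (auto simp: integrable_rep_l1)
  also have "\<dots> \<longleftrightarrow> 0 \<le> f"
    unfolding nonneg_l1_rep by (intro eventually_subst) (auto simp: abs_if)
  finally show ?thesis ..
qed

lemma closed_nonneg_l1: "closed {f :: l1. 0 \<le> f}"
  unfolding nonneg_l1_iff
  by (intro closed_Collect_eq continuous_on_norm_id linear_continuous_on bounded_linear_lint)

section \<open>Functions supported in the interval\<close>

lemma subspace_L1_on: "subspace (L1_on L)"
proof (rule subspaceI)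
  show "0 \<in> L1_on L" using rep_zero_l1 by (auto simp: L1_on_def)
next
  fix f g assume "f \<in> L1_on L" "g \<in> L1_on L"
  then have "AE x in lebesgue. x \<notin> {0<..<L} \<longrightarrow> rep_l1 f x = 0"
    "AE x in lebesgue. x \<notin> {0<..<L} \<longrightarrow> rep_l1 g x = 0" by (auto simp: L1_on_def)
  with rep_add_l1[of f g] have "AE x in lebesgue. x \<notin> {0<..<L} \<longrightarrow> rep_l1 (f + g) x = 0"
    by eventually_elim simp
  then show "f + g \<in> L1_on L" by (simp add: L1_on_def)
next
  fix c and f assume "f \<in> L1_on L"
  then have "AE x in lebesgue. x \<notin> {0<..<L} \<longrightarrow> rep_l1 f x = 0" by (auto simp: L1_on_def)
  with rep_scaleR_l1[of c f] have "AE x in lebesgue. x \<notin> {0<..<L} \<longrightarrow> rep_l1 (c *\<^sub>R f) x = 0"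
    by eventually_elim simp
  then show "c *\<^sub>R f \<in> L1_on L" by (simp add: L1_on_def)
qed

lemma rep_class_on:
  assumes "set_integrable lebesgue {0<..<L} f"
  shows "AE x in lebesgue. rep_l1 (class_on L f) x = indicator {0<..<L} x * f x"
  using assms unfolding class_on_def set_integrable_def by (intro rep_abs_l1) simp

lemma class_on_in_L1_on:
  assumes "set_integrable lebesgue {0<..<L} f" shows "class_on L f \<in> L1_on L"
  using rep_class_on[OF assms] by (auto simp: L1_on_def)

lemma set_integrable_rep: "A \<in> sets lebesgue \<Longrightarrow> set_integrable lebesgue A (rep_l1 f)"
  unfolding set_integrable_def using integrable_mult_indicator[OF _ integrable_rep_l1] by simp

lemma lint_L1_on:
  assumes "f \<in> L1_on L" shows "(LINT x:{0<..<L}|lebesgue. rep_l1 f x) = lint f"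
  unfolding lint_def set_lebesgue_integral_def
proof (rule integral_cong_AE)
  show "AE x in lebesgue. indicator {0<..<L} x *\<^sub>R rep_l1 f x = rep_l1 f x"
    using assms by (auto simp: L1_on_def indicator_def elim: eventually_mono)
  show "(\<lambda>x. indicator {0<..<L} x *\<^sub>R rep_l1 f x) \<in> borel_measurable lebesgue"
    using set_integrable_rep[of "{0<..<L}" f] unfolding set_integrable_def by auto
qed (use integrable_rep_l1[of f] in auto)

lemma lint_class_on:
  assumes "set_integrable lebesgue {0<..<L} f"
  shows "lint (class_on L f) = (LINT x:{0<..<L}|lebesgue. f x)"
  unfolding lint_def set_lebesgue_integral_def using rep_class_on[OF assms] assms
  by (intro integral_cong_AE) (auto simp: set_integrable_def integrable_rep_l1 borel_measurable_integrable)

lemma norm_class_on: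
  assumes "set_integrable lebesgue {0<..<L} f"
  shows "norm (class_on L f) = (LINT x:{0<..<L}|lebesgue. \<bar>f x\<bar>)"
  using assms unfolding class_on_def set_integrable_def set_lebesgue_integral_def
  by (subst norm_abs_l1) (simp_all add: abs_mult)

lemma L1_on_eqI:
  assumes "f \<in> L1_on L" "g \<in> L1_on L"
    "AE x in lebesgue. x \<in> {0<..<L} \<longrightarrow> rep_l1 f x = rep_l1 g x"
  shows "f = g"
proof (rule l1_eqI)
  have "AE x in lebesgue. x \<notin> {0<..<L} \<longrightarrow> rep_l1 f x = 0"
    "AE x in lebesgue. x \<notin> {0<..<L} \<longrightarrow> rep_l1 g x = 0" using assms by (auto simp: L1_on_def)
  with assms(3) show "AE x in lebesgue. rep_l1 f x = rep_l1 g x" by eventually_elim auto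
qed

lemma nonneg_L1_onI:
  assumes "f \<in> L1_on L" "AE x in lebesgue. x \<in> {0<..<L} \<longrightarrow> 0 \<le> rep_l1 f x"
  shows "0 \<le> f"
  using assms unfolding nonneg_l1_rep L1_on_def by (auto elim!: eventually_elim2)

lemma norm_L1_on_AE:
  assumes "f \<in> L1_on L" "set_integrable lebesgue {0<..<L} g"
    "AE x in lebesgue. x \<in> {0<..<L} \<longrightarrow> rep_l1 f x = g x"
  shows "norm f = (LINT x:{0<..<L}|lebesgue. \<bar>g x\<bar>)"
proof -
  have "AE x in lebesgue. x \<in> {0<..<L} \<longrightarrow> rep_l1 f x = rep_l1 (class_on L g) x"
    using assms(3) rep_class_on[OF assms(2)] by eventually_elim (auto simp: indicator_def)
  then have "f = class_on L g" by (rule L1_on_eqI[OF assms(1) class_on_in_L1_on[OF assms(2)]])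
  then show ?thesis using norm_class_on assms by blast
qed

text \<open>The subspace is the fixed-point set of the bounded projection that multiplies by the
  indicator of the interval.\<close>

lemma closed_L1_on: "closed (L1_on L)"
proof -
  have res: "integrable lebesgue (\<lambda>x. indicator {0<..<L} x * rep_l1 f x)" for f
    using integrable_mult_indicator[OF _ integrable_rep_l1, of "{0<..<L}" f] by simp
  define P where "P f = class_on L (rep_l1 f)" for f
  have P_rep: "AE x in lebesgue. rep_l1 (P f) x = indicator {0<..<L} x * rep_l1 f x" for f
    unfolding P_def by (rule rep_class_on) (simp add: set_integrable_rep)
  have "bounded_linear P"
  proof (rule bounded_linear_intro)
    fix f g
    show "P (f + g) = P f + P g"
      using P_rep[of "f + g"] P_rep[of f] P_rep[of g] rep_add_l1[of f g] rep_add_l1[of "P f" "P g"]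
      by (intro l1_eqI, eventually_elim) (simp add: algebra_simps)
    fix c
    show "P (c *\<^sub>R f) = c *\<^sub>R P f"
      using P_rep[of "c *\<^sub>R f"] P_rep[of f] rep_scaleR_l1[of c f] rep_scaleR_l1[of c "P f"]
      by (intro l1_eqI, eventually_elim) simp
    have "norm (P f) = (LINT x|lebesgue. indicator {0<..<L} x * \<bar>rep_l1 f x\<bar>)"
      unfolding P_def using norm_class_on[of L "rep_l1 f"]
      by (simp add: set_integrable_rep set_lebesgue_integral_def)
    also have "\<dots> \<le> norm f" unfolding norm_l1_rep
      using integrable_mult_indicator[OF _ integrable_abs[OF integrable_rep_l1], of "{0<..<L}" f]
      by (intro integral_mono) (auto simp: integrable_rep_l1 indicator_def)
    finally show "norm (P f) \<le> norm f * 1" by simp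
  qed
  then have "closed {f. P f = f}"
    by (intro closed_Collect_eq linear_continuous_on continuous_on_id)
  also have "{f. P f = f} = L1_on L"
  proof (intro equalityI subsetI)
    fix f assume "f \<in> L1_on L"
    then have "AE x in lebesgue. x \<notin> {0<..<L} \<longrightarrow> rep_l1 f x = 0" by (simp add: L1_on_def)
    with P_rep[of f] have "AE x in lebesgue. rep_l1 (P f) x = rep_l1 f x"
      by eventually_elim (auto simp: indicator_def)
    then show "f \<in> {f. P f = f}" using l1_eqI by blast
  next
    fix f assume "f \<in> {f. P f = f}"
    then show "f \<in> L1_on L" using class_on_in_L1_on[of L "rep_l1 f"] set_integrable_rep by (auto simp: P_def)
  qed
  finally show ?thesis .
qed

section \<open>Primitives and the transport equation\<close>

abbreviation integrable_upto :: "real \<Rightarrow> (real \<Rightarrow> real) \<Rightarrow> bool" where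
  "integrable_upto x f \<equiv> set_integrable lebesgue {0<..<x} f"

text \<open>Absolutely continuous functions are handled throughout as c + \<open>prim f\<close>. For
  x \<le> 0 the interval is empty and the value is 0.\<close>

definition prim :: "(real \<Rightarrow> real) \<Rightarrow> real \<Rightarrow> real" where
  "prim f x = (LINT s:{0<..<x}|lebesgue. f s)"

lemma integrable_upto_mono: "integrable_upto b f \<Longrightarrow> x \<le> b \<Longrightarrow> integrable_upto x f"
  by (rule set_integrable_subset) auto

lemma prim_nonpos [simp]: "x \<le> 0 \<Longrightarrow> prim f x = 0"
  by (simp add: prim_def set_lebesgue_integral_def)

lemma prim_cong: "(\<And>s. 0 < s \<Longrightarrow> s < x \<Longrightarrow> f s = g s) \<Longrightarrow> prim f x = prim g x"
  unfolding prim_def by (intro set_lebesgue_integral_cong) auto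

lemma integrable_upto_cong:
  "(\<And>s. 0 < s \<Longrightarrow> s < x \<Longrightarrow> f s = g s) \<Longrightarrow> integrable_upto x f \<longleftrightarrow> integrable_upto x g"
  by (intro set_integrable_cong) auto

lemma prim_eq_integral:
  assumes "integrable_upto b f" "x \<le> b" shows "prim f x = integral {0..x} f"
  unfolding prim_def
  using set_lebesgue_integral_eq_integral(2)[OF integrable_upto_mono[OF assms]]
  by (simp add: integral_open_interval_real)

lemma prim_diff_eq:
  assumes "integrable_upto b f" "0 \<le> x" "x \<le> y" "y \<le> b"
  shows "prim f y - prim f x = (LINT s:{x<..<y}|lebesgue. f s)"
proof -
  have f: "f integrable_on {0..y}"
    using set_lebesgue_integral_eq_integral(1)[OF integrable_upto_mono[OF assms(1,4)]]
    by (simp add: integrable_on_open_interval_real)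
  have "integral {0..x} f + integral {x..y} f = integral {0..y} f"
    using assms f by (intro Henstock_Kurzweil_Integration.integral_combine) auto
  moreover have "(LINT s:{x<..<y}|lebesgue. f s) = integral {x..y} f"
    using set_lebesgue_integral_eq_integral(2)[OF set_integrable_subset[OF assms(1), of "{x<..<y}"]] assms
    by (simp add: integral_open_interval_real subset_iff)
  ultimately show ?thesis using assms by (simp add: prim_eq_integral)
qed

lemma continuous_on_prim:
  assumes "integrable_upto b f" shows "continuous_on {0..b} (prim f)"
proof -
  have "f integrable_on {0..b}"
    using set_lebesgue_integral_eq_integral(1)[OF assms] by (simp add: integrable_on_open_interval_real)
  from indefinite_integral_continuous_1[OF this] show ?thesis
    using assms by (subst continuous_on_cong[OF refl prim_eq_integral[OF assms]]) auto
qed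

lemma prim_mono_on:
  assumes "integrable_upto b f" "\<And>s. 0 < s \<Longrightarrow> s < b \<Longrightarrow> 0 \<le> f s" "0 \<le> x" "x \<le> y" "y \<le> b"
  shows "prim f x \<le> prim f y"
proof -
  have "0 \<le> prim f y - prim f x"
    unfolding prim_diff_eq[OF assms(1,3-5)] set_lebesgue_integral_def
    using assms by (intro Bochner_Integration.integral_nonneg) (auto simp: indicator_def)
  then show ?thesis by simp
qed

lemma integrable_upto_continuous:
  assumes "continuous_on {0..b} F" shows "integrable_upto b F"
proof -
  have "set_integrable lebesgue {0..b} F"
    using absolutely_integrable_continuous_real[OF assms] by (simp add: absolutely_integrable_on_def)
  then show ?thesis by (rule set_integrable_subset) auto
qed

lemma integrable_upto_mult_continuous:
  assumes "integrable_upto b f" "continuous_on {0..b} F"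
  shows "integrable_upto b (\<lambda>s. F s * f s)"
proof -
  obtain C where C: "\<And>s. s \<in> {0..b} \<Longrightarrow> \<bar>F s\<bar> \<le> C"
    using compact_imp_bounded[OF compact_continuous_image[OF assms(2) compact_Icc]]
    unfolding bounded_iff real_norm_def by blast
  show ?thesis
  proof (rule set_integrable_bound[where f = "\<lambda>s. C * f s"])
    have "(\<lambda>s. (indicator {0<..<b} s * F s) * (indicator {0<..<b} s * f s)) \<in> borel_measurable lebesgue"
      using borel_measurable_integrable[OF assms(1)[unfolded set_integrable_def]]
        borel_measurable_integrable[OF integrable_upto_continuous[OF assms(2), unfolded set_integrable_def]]
      unfolding real_scaleR_def by (rule borel_measurable_times[rotated])
    also have "(\<lambda>s. (indicator {0<..<b} s * F s) * (indicator {0<..<b} s * f s)) =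
        (\<lambda>s. indicator {0<..<b} s *\<^sub>R (F s * f s))"
      by (auto simp: indicator_def)
    finally show "set_borel_measurable lebesgue {0<..<b} (\<lambda>s. F s * f s)"
      unfolding set_borel_measurable_def .
    show "AE x in lebesgue. x \<in> {0<..<b} \<longrightarrow> norm (F x * f x) \<le> norm (C * f x)"
    proof (intro AE_I2 impI)
      fix x assume "x \<in> {0<..<b}"
      then have "\<bar>F x\<bar> \<le> \<bar>C\<bar>" using C[of x] by auto
      then show "norm (F x * f x) \<le> norm (C * f x)" by (simp add: abs_mult mult_right_mono)
    qed
  qed (use assms in auto)
qed

text \<open>Fubini's theorem below is applied to the product of two completed measures; their
  countable covers are inherited from \<open>lborel\<close>.\<close>

lemma sigma_finite_lebesgue: "sigma_finite_measure (lebesgue :: real measure)"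
proof
  obtain A :: "real set set" where A: "countable A" "A \<subseteq> sets lborel" "\<Union>A = space lborel"
    "\<forall>a\<in>A. emeasure lborel a \<noteq> \<infinity>"
    using lborel.sigma_finite_countable by blast
  then show "\<exists>A. countable A \<and> A \<subseteq> sets (lebesgue :: real measure) \<and> \<Union>A = space lebesgue \<and>
      (\<forall>a\<in>A. emeasure lebesgue a \<noteq> \<infinity>)"
    by (intro exI[of _ A]) (auto simp: emeasure_completion subset_iff)
qed

text \<open>Fubini's theorem on the two triangles of the square \<open>(0,x)\<^sup>2\<close>.\<close>
lemma prim_mult_prim:
  assumes f: "integrable_upto x f" and g: "integrable_upto x g"
  shows "prim f x * prim g x = prim (\<lambda>s. f s * prim g s + prim f s * g s) x"
proof -
  interpret sigma_finite_measure "lebesgue :: real measure" by (rule sigma_finite_lebesgue)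
  interpret pair_sigma_finite "lebesgue :: real measure" "lebesgue :: real measure" ..
  define f' g' where "f' s = indicator {0<..<x} s * f s" and "g' s = indicator {0<..<x} s * g s" for s
  have fi: "integrable lebesgue f'" and gi: "integrable lebesgue g'"
    using f g by (simp_all add: set_integrable_def f'_def[abs_def] g'_def[abs_def])
  then have [measurable]: "f' \<in> borel_measurable lebesgue" "g' \<in> borel_measurable lebesgue" by auto
  have id [measurable]: "(\<lambda>x. x) \<in> borel_measurable (lebesgue :: real measure)"
    by (simp add: measurable_completion)
  let ?M = "(lebesgue :: real measure) \<Otimes>\<^sub>M (lebesgue :: real measure)"
  have K: "integrable ?M (\<lambda>(s, t). f' s * g' t)"
  proof (rule Fubini_integrable)
    show "(\<lambda>(s, t). f' s * g' t) \<in> borel_measurable ?M" by measurable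
    show "integrable lebesgue (\<lambda>s. \<integral>t. norm (case (s, t) of (s, t) \<Rightarrow> f' s * g' t) \<partial>lebesgue)"
      using fi by (simp add: abs_mult)
    show "AE s in lebesgue. integrable lebesgue (\<lambda>t. case (s, t) of (s, t) \<Rightarrow> f' s * g' t)"
      using gi by simp
  qed
  \<comment> \<open>The square splits into the open triangle t < s and the closed one s \<le> t.
    Integrating the first over t and the second over s leaves a primitive inside in both
    cases.\<close>
  define h where "h s t = f' s * g' t * indicator {t. t < s} t" for s t
  define h' where "h' s t = f' s * g' t * indicator {t. s \<le> t} t" for s t
  have hm: "case_prod h \<in> borel_measurable ?M" "case_prod h' \<in> borel_measurable ?M"
    unfolding h_def h'_def indicator_def mem_Collect_eq by measurable
  have h: "integrable ?M (case_prod h)" "integrable ?M (case_prod h')"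
    by (rule Bochner_Integration.integrable_bound[OF K]; use hm in \<open>auto simp: h_def h'_def indicator_def\<close>)+
  have "prim f x * prim g x = (\<integral>s. (\<integral>t. f' s * g' t \<partial>lebesgue) \<partial>lebesgue)"
    by (simp add: prim_def set_lebesgue_integral_def f'_def g'_def mult.commute)
  also have "\<dots> = integral\<^sup>L ?M (\<lambda>(s, t). f' s * g' t)"
    using integral_fst[of "\<lambda>s t. f' s * g' t", OF K] by simp
  also have "(\<lambda>(s, t). f' s * g' t) = (\<lambda>p. case_prod h p + case_prod h' p)"
    by (auto simp: h_def h'_def indicator_def fun_eq_iff)
  also have "integral\<^sup>L ?M \<dots> = integral\<^sup>L ?M (case_prod h) + integral\<^sup>L ?M (case_prod h')"
    using h by (intro Bochner_Integration.integral_add)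
  also have "integral\<^sup>L ?M (case_prod h) = (\<integral>s. (\<integral>t. h s t \<partial>lebesgue) \<partial>lebesgue)"
    using integral_fst[OF h(1)] by simp
  also have "\<dots> = prim (\<lambda>s. f s * prim g s) x"
    unfolding prim_def[of _ x] set_lebesgue_integral_def
  proof (intro Bochner_Integration.integral_cong refl)
    fix s
    have "(\<integral>t. h s t \<partial>lebesgue) = f' s * (\<integral>t. g' t * indicator {t. t < s} t \<partial>lebesgue)"
      by (simp add: h_def mult.assoc)
    also have "\<dots> = f' s * prim g s"
    proof (cases "s \<in> {0<..<x}")
      case True
      then have "(\<lambda>t. g' t * indicator {t. t < s} t) = (\<lambda>t. indicator {0<..<s} t *\<^sub>R g t)"
        by (auto simp: g'_def indicator_def)
      then show ?thesis by (simp add: prim_def set_lebesgue_integral_def)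
    qed (simp add: f'_def)
    finally show "(\<integral>t. h s t \<partial>lebesgue) = indicat_real {0<..<x} s *\<^sub>R (f s * prim g s)"
      by (simp add: f'_def)
  qed
  also have "integral\<^sup>L ?M (case_prod h') = (\<integral>t. (\<integral>s. h' s t \<partial>lebesgue) \<partial>lebesgue)"
    using integral_snd[OF h(2)] by simp
  also have "\<dots> = prim (\<lambda>s. prim f s * g s) x"
    unfolding prim_def[of _ x] set_lebesgue_integral_def
  proof (intro Bochner_Integration.integral_cong refl)
    fix t
    have "(\<integral>s. h' s t \<partial>lebesgue) = (\<integral>s. g' t * (f' s * indicator {s. s \<le> t} s) \<partial>lebesgue)"
      by (intro Bochner_Integration.integral_cong refl) (simp add: h'_def indicator_def)
    also have "\<dots> = g' t * (\<integral>s. f' s * indicator {s. s \<le> t} s \<partial>lebesgue)" by simp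
    also have "\<dots> = g' t * prim f t"
    proof (cases "t \<in> {0<..<x}")
      case True
      have "(\<integral>s. f' s * indicator {s. s \<le> t} s \<partial>lebesgue) = (\<integral>s. indicator {0<..<t} s *\<^sub>R f s \<partial>lebesgue)"
      proof (rule integral_cong_AE)
        \<comment> \<open>The closed triangle keeps the diagonal point s = t, which the open
          interval in \<open>prim\<close> omits.\<close>
        have "AE s in lebesgue. s \<noteq> t"
          by (rule AE_I'[of "{t}"]) (auto intro!: AE_not_in null_sets_completionI)
        then show "AE s in lebesgue. f' s * indicator {s. s \<le> t} s = indicator {0<..<t} s *\<^sub>R f s"
          by eventually_elim (use True in \<open>auto simp: f'_def indicator_def\<close>)
        show "(\<lambda>s. indicator {0<..<t} s *\<^sub>R f s) \<in> borel_measurable lebesgue"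
          using integrable_upto_mono[OF f, of t] True unfolding set_integrable_def by auto
        show "(\<lambda>s. f' s * indicator {s. s \<le> t} s) \<in> borel_measurable lebesgue"
          unfolding indicator_def by measurable
      qed
      then show ?thesis by (simp add: prim_def set_lebesgue_integral_def)
    qed (simp add: g'_def)
    finally show "(\<integral>s. h' s t \<partial>lebesgue) = indicat_real {0<..<x} t *\<^sub>R (prim f t * g t)"
      by (simp add: g'_def)
  qed
  also have "prim (\<lambda>s. f s * prim g s) x + prim (\<lambda>s. prim f s * g s) x = prim (\<lambda>s. f s * prim g s + prim f s * g s) x"
    unfolding prim_def[of _ x]
    using integrable_upto_mult_continuous[OF f continuous_on_prim[OF g]]
      integrable_upto_mult_continuous[OF g continuous_on_prim[OF f]]
    by (intro set_integral_add(2)[symmetric]) (simp_all add: mult.commute)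
  finally show ?thesis .
qed

lemma prim_add:
  assumes "integrable_upto x f" "integrable_upto x g"
  shows "prim (\<lambda>s. f s + g s) x = prim f x + prim g x"
  unfolding prim_def using assms by (rule set_integral_add(2))

lemma prim_diff:
  assumes "integrable_upto x f" "integrable_upto x g"
  shows "prim (\<lambda>s. f s - g s) x = prim f x - prim g x"
  unfolding prim_def using assms by (rule set_integral_diff(2))

lemma prim_cmult: "prim (\<lambda>s. c * f s) x = c * prim f x"
  unfolding prim_def by simp

lemma prim_minus: "prim (\<lambda>s. - f s) x = - prim f x"
  using prim_cmult[of "-1"] by simp

lemma prim_cong_AE:
  assumes "integrable_upto x f" "integrable_upto x g" "AE s in lebesgue. s \<in> {0<..<x} \<longrightarrow> f s = g s"
  shows "prim f x = prim g x"
  unfolding prim_def set_lebesgue_integral_def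
  using assms by (intro integral_cong_AE) (auto simp: set_integrable_def indicator_def elim!: eventually_mono)

lemma prim_nonneg:
  assumes "AE s in lebesgue. s \<in> {0<..<x} \<longrightarrow> 0 \<le> f s" shows "0 \<le> prim f x"
  unfolding prim_def set_lebesgue_integral_def
  using assms by (intro integral_nonneg_AE) (auto simp: indicator_def elim!: eventually_mono)

lemma abs_prim_le:
  assumes "integrable_upto x f" shows "\<bar>prim f x\<bar> \<le> prim (\<lambda>s. \<bar>f s\<bar>) x"
  unfolding prim_def set_lebesgue_integral_def
  using integral_norm_bound[of lebesgue "\<lambda>s. indicator {0<..<x} s *\<^sub>R f s"] by (simp add: abs_mult)

text \<open>The product rule for absolutely continuous functions with initial values c and d; the
  constants are distributed over \<open>prim_mult_prim\<close>.\<close>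

lemma mult_prim:
  assumes f: "integrable_upto x f" and g: "integrable_upto x g"
    and F: "\<And>s. 0 \<le> s \<Longrightarrow> s \<le> x \<Longrightarrow> F s = c + prim f s"
    and G: "\<And>s. 0 \<le> s \<Longrightarrow> s \<le> x \<Longrightarrow> G s = d + prim g s" and x: "0 \<le> x"
  shows "integrable_upto x (\<lambda>s. f s * G s + F s * g s)"
    and "F x * G x = c * d + prim (\<lambda>s. f s * G s + F s * g s) x"
proof -
  have int: "integrable_upto x (\<lambda>s. prim g s * f s)" "integrable_upto x (\<lambda>s. prim f s * g s)"
    using integrable_upto_mult_continuous[OF f continuous_on_prim[OF g]]
      integrable_upto_mult_continuous[OF g continuous_on_prim[OF f]] by auto
  let ?k = "\<lambda>s. (f s * prim g s + prim f s * g s) + (d * f s + c * g s)"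
  have i1: "integrable_upto x (\<lambda>s. f s * prim g s + prim f s * g s)" "integrable_upto x (\<lambda>s. d * f s + c * g s)"
    using int f g by (auto intro!: set_integral_add(1) simp: mult.commute)
  have eq: "f s * G s + F s * g s = ?k s" if "0 < s" "s < x" for s
    using F[of s] G[of s] that by (simp add: algebra_simps)
  show "integrable_upto x (\<lambda>s. f s * G s + F s * g s)"
    using set_integral_add(1)[OF i1] eq by (subst integrable_upto_cong) auto
  have "prim (\<lambda>s. f s * G s + F s * g s) x = prim ?k x"
    using eq by (intro prim_cong) auto
  also have "\<dots> = prim f x * prim g x + (d * prim f x + c * prim g x)"
    using i1 f g by (simp add: prim_add prim_cmult prim_mult_prim set_integral_add(1))
  finally show "F x * G x = c * d + prim (\<lambda>s. f s * G s + F s * g s) x"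
    using F[of x] G[of x] x by (simp add: algebra_simps)
qed

text \<open>On a fine partition the sum of squared increments of A is at most the largest increment
  times A b - A 0. Uniform continuity makes the largest increment arbitrarily small, so the total
  change of G is 0.\<close>

lemma eq_of_quadratic_modulus:
  fixes G A :: "real \<Rightarrow> real"
  assumes b: "0 \<le> b" and A: "continuous_on {0..b} A"
    and mono: "\<And>x y. 0 \<le> x \<Longrightarrow> x \<le> y \<Longrightarrow> y \<le> b \<Longrightarrow> A x \<le> A y"
    and G: "\<And>x y. 0 \<le> x \<Longrightarrow> x \<le> y \<Longrightarrow> y \<le> b \<Longrightarrow> \<bar>G y - G x\<bar> \<le> (A y - A x)\<^sup>2"
  shows "G b = G 0"
proof -
  have "\<bar>G b - G 0\<bar> \<le> e" if "e > 0" for e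
  proof -
    \<comment> \<open>Bound for a single increment of A that keeps e' (A b - A 0) \<le> e, also when
      A is constant.\<close>
    define e' where "e' = e / (A b - A 0 + 1)"
    have pos: "A b - A 0 + 1 > 0" using mono[of 0 b] b by simp
    have e': "e' > 0" using that pos by (simp add: e'_def)
    have "uniformly_continuous_on {0..b} A" using compact_uniformly_continuous[OF A] by simp
    then obtain d where d: "d > 0" "\<And>x y. x \<in> {0..b} \<Longrightarrow> y \<in> {0..b} \<Longrightarrow> \<bar>y - x\<bar> < d \<Longrightarrow> \<bar>A y - A x\<bar> < e'"
      using e' unfolding uniformly_continuous_on_def dist_real_def by metis
    obtain n :: nat where n: "b / d < n" using reals_Archimedean2 by blast
    then have n0: "n > 0" using b d by (cases n) (auto simp: field_simps)
    define p where "p i = b * i / n" for i :: nat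
    have p: "p i \<in> {0..b}" if "i \<le> n" for i
      using that b n0 by (auto simp: p_def field_simps intro: mult_left_mono)
    have p_step: "p i \<le> p (Suc i)" "p (Suc i) - p i < d" for i
    proof -
      have eq: "p (Suc i) - p i = b / n" by (simp add: p_def distrib_left add_divide_distrib)
      then show "p i \<le> p (Suc i)" using b by (smt (verit) divide_nonneg_nonneg of_nat_0_le_iff)
      show "p (Suc i) - p i < d" unfolding eq using n n0 d by (simp add: field_simps)
    qed
    have step: "\<bar>G (p (Suc i)) - G (p i)\<bar> \<le> e' * (A (p (Suc i)) - A (p i))" if "i < n" for i
    proof -
      have "\<bar>G (p (Suc i)) - G (p i)\<bar> \<le> (A (p (Suc i)) - A (p i))\<^sup>2"
        using p[of i] p[of "Suc i"] that p_step by (intro G) auto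
      also have "\<dots> \<le> e' * (A (p (Suc i)) - A (p i))"
        using d(2)[of "p i" "p (Suc i)"] p[of i] p[of "Suc i"] that p_step[of i] mono[of "p i" "p (Suc i)"]
        unfolding power2_eq_square by (intro mult_right_mono) auto
      finally show ?thesis .
    qed
    have "\<bar>G b - G 0\<bar> = \<bar>\<Sum>i<n. G (p (Suc i)) - G (p i)\<bar>"
      unfolding sum_lessThan_telescope[where f = "\<lambda>i. G (p i)"] using n0 by (simp add: p_def)
    also have "\<dots> \<le> (\<Sum>i<n. e' * (A (p (Suc i)) - A (p i)))"
      using step by (intro order_trans[OF sum_abs] sum_mono) auto
    also have "\<dots> = e' * (A b - A 0)"
      unfolding sum_distrib_left[symmetric] sum_lessThan_telescope[where f = "\<lambda>i. A (p i)"]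
      using n0 by (simp add: p_def)
    also have "\<dots> \<le> e" using pos that mono[of 0 b] b by (simp add: e'_def field_simps)
    finally show ?thesis .
  qed
  then have "\<bar>G b - G 0\<bar> \<le> 0" by (rule dense_ge)
  then show ?thesis by simp
qed

text \<open>The chain rule for an integrand that is merely integrable. Let d be the increment of
  \<open>prim a\<close> over [x, y]. As E decreases, both E x - E y and the integral of E a lie
  between E y d and E x d. They differ by at most (E x - E y) d \<le> d^2, so
  \<open>eq_of_quadratic_modulus\<close> applies to E + \<open>prim\<close> (E a).\<close>

lemma exp_minus_prim:
  assumes a: "integrable_upto b a" and nonneg: "\<And>s. 0 < s \<Longrightarrow> s < b \<Longrightarrow> 0 \<le> a s" and b: "0 \<le> b"
  shows "exp (- prim a b) = 1 + prim (\<lambda>s. - (exp (- prim a s) * a s)) b"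
proof -
  define E where "E s = exp (- prim a s)" for s
  have contE: "continuous_on {0..b} E"
    unfolding E_def by (intro continuous_intros continuous_on_prim a)
  have aE: "integrable_upto b (\<lambda>s. E s * a s)" by (rule integrable_upto_mult_continuous[OF a contE])
  have mono: "prim a x \<le> prim a y" if "0 \<le> x" "x \<le> y" "y \<le> b" for x y
    using prim_mono_on[OF a nonneg] that by auto
  define G where "G x = E x + prim (\<lambda>s. E s * a s) x" for x
  have "G b = G 0"
  proof (rule eq_of_quadratic_modulus[OF b continuous_on_prim[OF a] mono])
    fix x y assume xy: "0 \<le> x" "x \<le> y" "y \<le> b"
    define d where "d = prim a y - prim a x"
    have d: "d \<ge> 0" "d = (LINT s:{x<..<y}|lebesgue. a s)"
      using mono[OF xy] prim_diff_eq[OF a xy] by (auto simp: d_def)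
    define I where "I = (LINT s:{x<..<y}|lebesgue. E s * a s)"
    have ai: "set_integrable lebesgue {x<..<y} a" "set_integrable lebesgue {x<..<y} (\<lambda>s. E s * a s)"
      using a aE xy by (auto intro: set_integrable_subset)
    have E: "E y \<le> E s" "E s \<le> E x" if "x < s" "s < y" for s
      using mono[of s y] mono[of x s] that xy by (auto simp: E_def)
    have "E y * d \<le> I" "I \<le> E x * d"
      unfolding d(2) I_def set_integral_mult_right[symmetric]
      using E nonneg xy by (intro set_integral_mono set_integrable_mult_right ai mult_right_mono; simp)+
    moreover have "E y * d \<le> E x - E y" "E x - E y \<le> E x * d"
    proof -
      have Ex: "E x = E y * exp d" "E y = E x * exp (- d)"
        by (simp_all add: E_def d_def flip: exp_add)
      have "E y * (1 + d) \<le> E y * exp d" by (intro mult_left_mono) (auto simp: E_def)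
      then show "E y * d \<le> E x - E y" unfolding Ex(1)[symmetric] by (simp add: algebra_simps)
      have "E x * (1 - d) \<le> E x * exp (- d)"
        using exp_ge_add_one_self[of "- d"] by (intro mult_left_mono) (auto simp: E_def)
      then show "E x - E y \<le> E x * d" unfolding Ex(2)[symmetric] by (simp add: algebra_simps)
    qed
    moreover have "G y - G x = I - (E x - E y)"
      using prim_diff_eq[OF aE xy] by (simp add: G_def I_def)
    ultimately have "\<bar>G y - G x\<bar> \<le> (E x - E y) * d" by (auto simp: algebra_simps)
    also have "\<dots> \<le> d * d"
    proof (intro mult_right_mono)
      have "prim a x \<ge> 0" using mono[of 0 x] xy by simp
      then have "E x * d \<le> 1 * d" using d by (intro mult_right_mono) (auto simp: E_def)
      then show "E x - E y \<le> d" using \<open>E x - E y \<le> E x * d\<close> by simp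
    qed (use d in auto)
    finally show "\<bar>G y - G x\<bar> \<le> (prim a y - prim a x)\<^sup>2" by (simp add: d_def power2_eq_square)
  qed
  then show ?thesis unfolding prim_minus by (simp add: G_def E_def)
qed

section \<open>Passage to the limit at the right endpoint\<close>

lemma exhaust_interval:
  fixes L :: real
  assumes "0 < L"
  obtains b :: "nat \<Rightarrow> real" where "\<forall>n. 0 < b n \<and> b n < L" "incseq b" "b \<longlonglongrightarrow> L"
proof
  let ?b = "\<lambda>n. L - L / 2 * inverse (real (Suc n))"
  have inv: "inverse (real (Suc n)) \<le> 1" "0 < inverse (real (Suc n))" for n
    by (auto simp: inverse_le_1_iff)
  have "0 < ?b n \<and> ?b n < L" for n
    using mult_left_mono[OF inv(1), of "L / 2" n] mult_pos_pos[OF _ inv(2), of "L / 2" n] assms by auto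
  then show "\<forall>n. 0 < ?b n \<and> ?b n < L" by blast
  show "incseq ?b"
    using assms by (intro incseq_SucI) (auto intro!: mult_left_mono le_imp_inverse_le)
  show "?b \<longlonglongrightarrow> L"
    using tendsto_diff[OF tendsto_const tendsto_mult[OF tendsto_const LIMSEQ_inverse_real_of_nat], of L "L / 2"] by simp
qed

lemma indicator_exhaust_LIMSEQ:
  fixes g :: "real \<Rightarrow> real"
  assumes "\<And>n. b n < L" "b \<longlonglongrightarrow> L"
  shows "(\<lambda>n. indicator {0<..<b n} s *\<^sub>R g s) \<longlonglongrightarrow> indicator {0<..<L} s *\<^sub>R g s"
proof (cases "s < L")
  case True
  then have "\<forall>\<^sub>F n in sequentially. s < b n" by (rule order_tendstoD[OF assms(2)])
  then show ?thesis
    by (intro tendsto_eventually, eventually_elim) (use True in \<open>auto simp: indicator_def\<close>)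
next
  case False
  then have "s \<notin> {0<..<b n}" for n using assms(1)[of n] by auto
  then show ?thesis using False by simp
qed

text \<open>Functions known to be integrable only away from L are pointwise limits of their
  restrictions to shorter intervals.\<close>

lemma set_borel_measurable_limit:
  assumes "\<And>x. x < L \<Longrightarrow> integrable_upto x g" "0 < L"
  shows "set_borel_measurable lebesgue {0<..<L} g"
proof -
  obtain b where b': "\<forall>n. 0 < b n \<and> b n < L" "b \<longlonglongrightarrow> L" using exhaust_interval[OF assms(2)] by blast
  then have b: "b n < L" for n by blast
  show ?thesis
    unfolding set_borel_measurable_def
  proof (rule borel_measurable_LIMSEQ_real[OF indicator_exhaust_LIMSEQ[OF b b'(2)]])
    show "(\<lambda>s. indicator {0<..<b n} s *\<^sub>R g s) \<in> borel_measurable lebesgue" for n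
      using assms(1)[OF b] unfolding set_integrable_def by auto
  qed
qed

text \<open>Monotone convergence along intervals exhausting (0, L).\<close>

lemma integrable_upto_limit:
  assumes int: "\<And>x. x < L \<Longrightarrow> integrable_upto x g" and nonneg: "\<And>s. 0 < s \<Longrightarrow> s < L \<Longrightarrow> 0 \<le> g s"
    and bound: "\<And>x. 0 < x \<Longrightarrow> x < L \<Longrightarrow> prim g x \<le> B" and L: "0 < L"
  shows "integrable_upto L g"
proof -
  obtain b where b': "\<forall>n. 0 < b n \<and> b n < L" "incseq b" "b \<longlonglongrightarrow> L" using exhaust_interval[OF L] by blast
  then have b: "0 < b n" "b n < L" for n by auto
  let ?f = "\<lambda>n s. indicator {0<..<b n} s *\<^sub>R g s" and ?g = "\<lambda>s. indicator {0<..<L} s *\<^sub>R g s"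
  have fi: "integrable lebesgue (?f n)" for n using int[OF b(2), of n] by (simp add: set_integrable_def)
  have fm: "mono (\<lambda>n. ?f n s)" for s
  proof (rule monoI)
    fix m n :: nat assume "m \<le> n"
    then have "b m \<le> b n" by (rule incseqD[OF b'(2)])
    then show "?f m s \<le> ?f n s" using nonneg[of s] b(2)[of n] by (auto simp: indicator_def)
  qed
  have lim: "(\<lambda>n. ?f n s) \<longlonglongrightarrow> ?g s" for s by (rule indicator_exhaust_LIMSEQ[OF b(2) b'(3)])
  have inc: "incseq (\<lambda>n. integral\<^sup>L lebesgue (?f n))"
    using fm fi by (auto simp: incseq_def mono_def intro!: integral_mono)
  have "integral\<^sup>L lebesgue (?f n) \<le> B" for n
    using bound[OF b(1,2), of n] by (simp add: prim_def set_lebesgue_integral_def)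
  then obtain l where "(\<lambda>n. integral\<^sup>L lebesgue (?f n)) \<longlonglongrightarrow> l"
    by (rule incseq_convergent[OF inc, OF allI])
  then have "integrable lebesgue ?g"
  proof (rule integrable_monotone_convergence[where f = ?f, OF fi AE_I2[OF fm] AE_I2[OF lim]])
    show "?g \<in> borel_measurable lebesgue"
      by (rule borel_measurable_LIMSEQ_real[OF lim]) (rule borel_measurable_integrable[OF fi])
  qed
  then show ?thesis by (simp add: set_integrable_def)
qed

text \<open>Abstracts the absorption rates mu_i and mu_i + k with k \<ge> 0. The failure of
  integrability at L is what later forces solutions to vanish there.\<close>

locale rate =
  fixes L :: real and a :: "real \<Rightarrow> real"
  assumes L_pos: "0 < L" and a_nonneg: "0 < s \<Longrightarrow> s < L \<Longrightarrow> 0 \<le> a s"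
    and a_loc: "x < L \<Longrightarrow> integrable_upto x a" and a_not_integrable: "\<not> integrable_upto L a"
begin

definition E :: "real \<Rightarrow> real" where
  "E x = exp (- prim a x)"

text \<open>The variation of constants formula for u' = f - a u, u(0) = c, written as a product of
  two absolutely continuous functions so that \<open>mult_prim\<close> applies. It is meant for x <
  L only.\<close>

definition sol :: "real \<Rightarrow> (real \<Rightarrow> real) \<Rightarrow> real \<Rightarrow> real" where
  "sol c f x = E x * (c + prim (\<lambda>s. f s / E s) x)"

lemma continuous_on_E: "b < L \<Longrightarrow> continuous_on {0..b} E"
  unfolding E_def by (intro continuous_intros continuous_on_prim a_loc)

lemma E_pos: "0 < E x" by (simp add: E_def)

lemma E_nonzero [simp]: "E x \<noteq> 0" by (simp add: E_def)

lemma integrable_div_E: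
  assumes "integrable_upto L f" "b < L" shows "integrable_upto b (\<lambda>s. f s / E s)"
  using integrable_upto_mult_continuous[OF integrable_upto_mono[OF assms(1)], of b "\<lambda>s. 1 / E s"] assms
    continuous_on_divide[OF continuous_on_const continuous_on_E] by simp

lemma continuous_on_sol:
  assumes "integrable_upto L f" "b < L" shows "continuous_on {0..b} (sol c f)"
  unfolding sol_def by (intro continuous_intros continuous_on_E continuous_on_prim integrable_div_E assms)

lemma integrable_a_sol:
  assumes "integrable_upto L f" "b < L" shows "integrable_upto b (\<lambda>s. a s * sol c f s)"
  using integrable_upto_mult_continuous[OF a_loc continuous_on_sol[OF assms]] assms by (simp add: mult.commute)

text \<open>The product rule for \<open>E\<close>, a primitive of - E a, and the bracket, a
  primitive of f / E: the factor E cancels in one term and rebuilds \<open>sol\<close> in the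
  other.\<close>

lemma sol_eq:
  assumes f: "integrable_upto L f" and x: "0 \<le> x" "x < L"
  shows "sol c f x = c + prim (\<lambda>s. f s - a s * sol c f s) x"
proof -
  have aE: "integrable_upto x (\<lambda>s. - (E s * a s))"
    using set_integrable_mult_right[of "-1", OF integrable_upto_mult_continuous[OF a_loc continuous_on_E]] x by simp
  have E: "E s = 1 + prim (\<lambda>s. - (E s * a s)) s" if "0 \<le> s" "s \<le> x" for s
    unfolding E_def using that x a_nonneg by (intro exp_minus_prim a_loc) auto
  have "sol c f x = 1 * c + prim (\<lambda>s. - (E s * a s) * (c + prim (\<lambda>s. f s / E s) s) + E s * (f s / E s)) x"
    unfolding sol_def using mult_prim(2)[OF aE integrable_div_E[OF f x(2)] E refl x(1)] .
  also have "prim (\<lambda>s. - (E s * a s) * (c + prim (\<lambda>s. f s / E s) s) + E s * (f s / E s)) x =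
      prim (\<lambda>s. f s - a s * sol c f s) x"
    by (intro prim_cong) (simp add: sol_def algebra_simps)
  finally show ?thesis by simp
qed

lemma sol_nonneg:
  assumes "0 \<le> c" "AE s in lebesgue. s \<in> {0<..<L} \<longrightarrow> 0 \<le> f s" "x < L"
  shows "0 \<le> sol c f x"
proof -
  have "0 \<le> prim (\<lambda>s. f s / E s) x"
    using assms(2) by (intro prim_nonneg, eventually_elim) (use assms(3) E_pos in \<open>auto simp: less_imp_le\<close>)
  then show ?thesis unfolding sol_def using assms E_pos by (simp add: less_imp_le)
qed

lemma abs_sol_le:
  assumes f: "integrable_upto L f" and x: "0 \<le> x" "x < L"
  shows "\<bar>sol c f x\<bar> \<le> sol \<bar>c\<bar> (\<lambda>s. \<bar>f s\<bar>) x"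
proof -
  have "\<bar>c + prim (\<lambda>s. f s / E s) x\<bar> \<le> \<bar>c\<bar> + prim (\<lambda>s. \<bar>f s / E s\<bar>) x"
    using abs_prim_le[OF integrable_div_E[OF f x(2)]] by linarith
  also have "prim (\<lambda>s. \<bar>f s / E s\<bar>) x = prim (\<lambda>s. \<bar>f s\<bar> / E s) x"
    using E_pos by (simp add: abs_divide abs_of_pos)
  finally show ?thesis
    unfolding sol_def abs_mult using E_pos by (simp add: mult_left_mono less_imp_le abs_of_pos)
qed

text \<open>For the data |c| and |f| the solution v is nonnegative, so its own equation bounds the
  integral of a v over (0, x) by |c| plus the integral of |f|, uniformly in x < L. Monotone
  convergence reaches L, and general data are dominated by \<open>abs_sol_le\<close>.\<close>

lemma integrable_a_sol_L:
  assumes f: "integrable_upto L f" shows "integrable_upto L (\<lambda>s. a s * sol c f s)"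
proof -
  define v where "v = sol \<bar>c\<bar> (\<lambda>s. \<bar>f s\<bar>)"
  have fa: "integrable_upto L (\<lambda>s. \<bar>f s\<bar>)" using set_integrable_abs[OF f] .
  have v: "integrable_upto L (\<lambda>s. a s * v s)"
  proof (rule integrable_upto_limit[where B = "\<bar>c\<bar> + prim (\<lambda>s. \<bar>f s\<bar>) L"])
    fix x assume x: "0 < x" "x < L"
    have "v x = \<bar>c\<bar> + (prim (\<lambda>s. \<bar>f s\<bar>) x - prim (\<lambda>s. a s * v s) x)"
      unfolding v_def using sol_eq[OF fa, of x "\<bar>c\<bar>"] x integrable_a_sol[OF fa, of x "\<bar>c\<bar>"] integrable_upto_mono[OF fa, of x]
      by (simp add: prim_diff)
    moreover have "0 \<le> v x" unfolding v_def using x by (intro sol_nonneg) auto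
    moreover have "prim (\<lambda>s. \<bar>f s\<bar>) x \<le> prim (\<lambda>s. \<bar>f s\<bar>) L"
      using x by (intro prim_mono_on[OF fa]) auto
    ultimately show "prim (\<lambda>s. a s * v s) x \<le> \<bar>c\<bar> + prim (\<lambda>s. \<bar>f s\<bar>) L" by linarith
  qed (use L_pos a_nonneg in \<open>auto simp: v_def intro!: integrable_a_sol fa mult_nonneg_nonneg sol_nonneg\<close>)
  have meas: "set_borel_measurable lebesgue {0<..<L} (\<lambda>s. a s * sol c f s)"
    by (intro set_borel_measurable_limit integrable_a_sol f L_pos)
  show ?thesis
  proof (rule set_integrable_bound[OF v meas], intro AE_I2 impI)
    fix x assume "x \<in> {0<..<L}"
    then show "norm (a x * sol c f x) \<le> norm (a x * v x)"
      using abs_sol_le[OF f, of x c] a_nonneg[of x] unfolding v_def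
      by (auto simp: abs_mult intro!: mult_left_mono)
  qed
qed

theorem ode_exists:
  assumes f: "integrable_upto L f"
  shows "\<exists>u. continuous_on {0..L} u \<and> integrable_upto L (\<lambda>s. a s * u s) \<and>
    (\<forall>x\<in>{0..L}. u x = c + prim (\<lambda>s. f s - a s * u s) x) \<and>
    (0 \<le> c \<longrightarrow> (AE s in lebesgue. s \<in> {0<..<L} \<longrightarrow> 0 \<le> f s) \<longrightarrow> (\<forall>x\<in>{0<..<L}. 0 \<le> u x))"
proof -
  define u where "u x = c + prim (\<lambda>s. f s - a s * sol c f s) x" for x
  have u: "u x = sol c f x" if "0 \<le> x" "x < L" for x
    using sol_eq[OF f that] by (simp add: u_def)
  have int: "integrable_upto L (\<lambda>s. f s - a s * sol c f s)"
    by (intro set_integral_diff f integrable_a_sol_L)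
  show ?thesis
  proof (intro exI[of _ u] conjI ballI impI)
    show "continuous_on {0..L} u"
      unfolding u_def by (intro continuous_intros continuous_on_prim int)
    show "integrable_upto L (\<lambda>s. a s * u s)"
      using integrable_a_sol_L[OF f, of c] by (subst integrable_upto_cong[where g = "\<lambda>s. a s * sol c f s"]) (auto simp: u)
    show "u x = c + prim (\<lambda>s. f s - a s * u s) x" if "x \<in> {0..L}" for x
      unfolding u_def[of x] using that by (intro arg_cong2[of _ _ _ _ "(+)"] prim_cong) (auto simp: u)
    show "0 \<le> u x" if "0 \<le> c" "AE s in lebesgue. s \<in> {0<..<L} \<longrightarrow> 0 \<le> f s" "x \<in> {0<..<L}" for x
      using sol_nonneg[OF that(1,2)] that(3) by (auto simp: u)
  qed
qed

text \<open>\<open>u\<^sup>2\<close> is the primitive of \<open>-2au\<^sup>2\<close>.\<close>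
theorem ode_unique:
  assumes au: "integrable_upto L (\<lambda>s. a s * u s)"
    and u: "\<And>x. 0 \<le> x \<Longrightarrow> x \<le> L \<Longrightarrow> u x = prim (\<lambda>s. - (a s * u s)) x"
    and x: "0 \<le> x" "x \<le> L"
  shows "u x = 0"
proof -
  let ?g = "\<lambda>s. - (a s * u s)"
  have g: "integrable_upto x ?g"
    using set_integrable_mult_right[of "-1", OF integrable_upto_mono[OF au x(2)]] by simp
  have "u x * u x = 0 * 0 + prim (\<lambda>s. ?g s * u s + u s * ?g s) x"
    using u x by (intro mult_prim(2)[OF g g]) auto
  also have "\<dots> = - prim (\<lambda>s. 2 * (a s * u s * u s)) x"
    unfolding prim_minus[symmetric] by (simp add: algebra_simps)
  also have "\<dots> \<le> 0"
  proof -
    have "0 \<le> a s * u s * u s" if "0 < s" "s < x" for s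
      using a_nonneg[of s] that x by (simp add: mult.assoc)
    then have "0 \<le> prim (\<lambda>s. 2 * (a s * u s * u s)) x"
      by (intro prim_nonneg AE_I2) auto
    then show ?thesis by simp
  qed
  finally show ?thesis by (auto simp: mult_le_0_iff)
qed

text \<open>If u(L) were nonzero, |u| would exceed some e > 0 near L. There a \<le> |a u| / e, and
  below that neighbourhood a is integrable, so a would be integrable up to L.\<close>

theorem ode_end:
  assumes cont: "continuous_on {0..L} u" and au: "integrable_upto L (\<lambda>s. a s * u s)"
  shows "u L = 0"
proof (rule ccontr)
  assume nz: "u L \<noteq> 0"
  define e where "e = \<bar>u L\<bar> / 2"
  have e: "e > 0" using nz by (simp add: e_def)
  have "((\<lambda>x. \<bar>u x\<bar>) \<longlongrightarrow> \<bar>u L\<bar>) (at L within {0..L})"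
    using cont L_pos by (intro tendsto_intros) (auto simp: continuous_on)
  then have "\<forall>\<^sub>F x in at L within {0..L}. e < \<bar>u x\<bar>"
    using nz by (intro order_tendstoD) (auto simp: e_def)
  then obtain d where d: "d > 0" "\<And>x. x \<in> {0..L} \<Longrightarrow> x \<noteq> L \<Longrightarrow> \<bar>x - L\<bar> < d \<Longrightarrow> e < \<bar>u x\<bar>"
    unfolding eventually_at dist_real_def by auto
  \<comment> \<open>Lies strictly inside (0, L) and within distance d of L.\<close>
  define l where "l = max (L / 2) (L - d / 2)"
  have l: "0 < l" "l < L" "L - l < d" using L_pos d by (auto simp: l_def)
  have meas: "set_borel_measurable lebesgue {0<..<L} a"
    by (intro set_borel_measurable_limit a_loc L_pos)
  have "integrable_upto L (\<lambda>s. indicator {0<..<l} s * a s + \<bar>a s * u s\<bar> / e)"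
  proof (intro set_integral_add set_integrable_divide set_integrable_abs au)
    have "set_integrable lebesgue {0<..<l} a" using a_loc l by simp
    then show "integrable_upto L (\<lambda>s. indicator {0<..<l} s * a s)"
      unfolding set_integrable_def using l
      by (subst Bochner_Integration.integrable_cong[OF refl, of _ _ "\<lambda>s. indicator {0<..<l} s *\<^sub>R a s"])
         (auto simp: indicator_def)
  qed
  then have "integrable_upto L a"
  proof (rule set_integrable_bound[OF _ meas], intro AE_I2 impI)
    fix x assume x: "x \<in> {0<..<L}"
    have "a x \<le> indicator {0<..<l} x * a x + \<bar>a x * u x\<bar> / e"
    proof (cases "x < l")
      case False
      then have "e < \<bar>u x\<bar>" using x l by (intro d) auto
      then have "a x * e \<le> \<bar>a x * u x\<bar>" using a_nonneg[of x] x by (auto simp: abs_mult intro!: mult_left_mono)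
      then show ?thesis using False e by (simp add: field_simps)
    qed (use x e in auto)
    then show "norm (a x) \<le> norm (indicator {0<..<l} x * a x + \<bar>a x * u x\<bar> / e)"
      using a_nonneg[of x] x by simp
  qed
  then show False using a_not_integrable by simp
qed

end

section \<open>Weak derivatives as primitives\<close>

text \<open>Lebesgue differentiation: at almost every x the averages over [x, x + h] converge to g
  x, and all of them vanish here.\<close>

lemma AE_eq_0_of_prim_eq_0:
  assumes g: "integrable_upto L g" and zero: "\<And>x. 0 \<le> x \<Longrightarrow> x \<le> L \<Longrightarrow> prim g x = 0"
  shows "AE x in lebesgue. x \<in> {0<..<L} \<longrightarrow> g x = 0"
proof -
  define f where "f x = (if x \<in> {0<..<L} then g x else 0)" for x
  have gi: "g integrable_on {0<..<L}" using set_lebesgue_integral_eq_integral(1)[OF g] .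
  then have "f integrable_on UNIV" unfolding f_def by (simp only: integrable_restrict_UNIV)
  then have "f integrable_on cbox a b" for a b by (rule integrable_on_subcbox) simp
  then obtain N where N: "negligible N" "\<And>x e. \<lbrakk>x \<notin> N; 0 < e\<rbrakk> \<Longrightarrow>
      \<exists>d>0. \<forall>h. 0 < h \<and> h < d \<longrightarrow> norm (integral (cbox x (x + h *\<^sub>R One)) f /\<^sub>R h ^ DIM(real) - f x) < e"
    using integrable_ccontinuous_explicit[of f] by metis
  have "g x = 0" if x: "x \<in> {0<..<L}" "x \<notin> N" for x
  proof (rule ccontr)
    assume "g x \<noteq> 0"
    then have "\<bar>f x\<bar> > 0" using x by (simp add: f_def)
    then obtain d where d: "d > 0"
      "\<And>h. 0 < h \<Longrightarrow> h < d \<Longrightarrow> norm (integral (cbox x (x + h *\<^sub>R One)) f /\<^sub>R h ^ DIM(real) - f x) < \<bar>f x\<bar>"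
      using N(2)[OF x(2), of "\<bar>f x\<bar>"] by metis
    define h where "h = min (d / 2) ((L - x) / 2)"
    have h: "0 < h" "h < d" "x + h < L" using d x by (auto simp: h_def min_def field_simps)
    have "integral {x..x + h} f = integral {x<..<x + h} g"
      unfolding integral_open_interval_real using x h
      by (intro Henstock_Kurzweil_Integration.integral_cong) (auto simp: f_def)
    also have "\<dots> = prim g (x + h) - prim g x"
      using prim_diff_eq[OF g, of x "x + h"] x h
        set_lebesgue_integral_eq_integral(2)[OF set_integrable_subset[OF g, of "{x<..<x + h}"]]
      by (simp add: subset_iff)
    also have "\<dots> = 0" using zero[of x] zero[of "x + h"] x h by simp
    finally show False using d(2)[OF h(1,2)] by simp
  qed
  then show ?thesis
    using AE_not_in[OF N(1)[unfolded negligible_iff_null_sets]] by (auto elim: eventually_mono)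
qed

text \<open>The set of interior points where k is nonzero is open and null, hence empty; continuity
  reaches the endpoints.\<close>

lemma continuous_eq_0_of_AE:
  assumes "continuous_on {0..L} (k :: real \<Rightarrow> real)" "AE x in lebesgue. x \<in> {0<..<L} \<longrightarrow> k x = 0" "0 < L"
    and "0 \<le> x" "x \<le> L"
  shows "k x = 0"
proof -
  let ?S = "{x \<in> {0<..<L}. k x \<noteq> 0}"
  have "open ({0<..<L} \<inter> k -` (- {0}))"
    using assms(1) by (intro continuous_open_preimage) (auto elim: continuous_on_subset)
  also have "{0<..<L} \<inter> k -` (- {0}) = ?S" by auto
  finally have "open ?S" .
  moreover have "negligible ?S"
  proof -
    have "?S \<in> sets lebesgue" using \<open>open ?S\<close> by (simp add: borel_open)
    moreover have "AE x in lebesgue. x \<notin> ?S" using assms(2) by eventually_elim auto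
    ultimately show ?thesis by (simp only: negligible_iff_null_sets AE_iff_null_sets)
  qed
  ultimately have "?S = {}" using open_not_negligible by blast
  then have "k y = 0" if "y \<in> {0<..<L}" for y using that by blast
  moreover have "closure {0<..<L} = {0..L}" using assms by simp
  ultimately show ?thesis
    using continuous_constant_on_closure[of "{0<..<L}" k 0 x] assms by auto
qed

text \<open>The mean-zero condition is what makes the primitive vanish again to the right of b, so
  that it has compact support in (0, L).\<close>

lemma test_function_integral:
  assumes "continuous_on UNIV \<psi>" "0 < a" "a < b" "b < L" and zero: "\<And>x. x \<notin> {a..b} \<Longrightarrow> \<psi> x = 0"
    and int: "integral {0..L} \<psi> = 0"
  shows "test_function L (\<lambda>x. integral {0..x} \<psi>) \<psi>"
  unfolding test_function_def
proof (intro conjI allI)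
  have ci: "\<psi> integrable_on {c..d}" for c d
    by (rule integrable_continuous_interval) (rule continuous_on_subset[OF assms(1)], simp)
  have left: "integral {0..x} \<psi> = 0" if "x < a" for x
    using that Henstock_Kurzweil_Integration.integral_cong[of "{0..x}" \<psi> "\<lambda>_. 0"] zero by simp
  show "((\<lambda>x. integral {0..x} \<psi>) has_real_derivative \<psi> x) (at x)" for x
  \<comment> \<open>To the left of a, including negative x where the interval of integration is
    empty, the primitive is locally 0. The fundamental theorem of calculus is applied from a
    onwards.\<close>
  proof (cases "x < a")
    case True
    have "((\<lambda>x. 0) has_real_derivative \<psi> x) (at x)"
      using True zero[of x] by simp
    then show ?thesis
      by (rule has_field_derivative_transform_within_open[where S = "{..<a}"]) (use True left in auto)
  next
    case False
    have "((\<lambda>x. integral {0..x} \<psi>) has_real_derivative \<psi> x) (at x within {0..x + 1})"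
      using False assms(2) by (intro integral_has_real_derivative continuous_on_subset[OF assms(1)]) auto
    moreover have "at x within {0..x + 1} = at x"
      by (rule at_within_interior) (use False assms(2) in simp)
    ultimately show ?thesis by simp
  qed
  have "integral {0..x} \<psi> = 0" if "x \<notin> {a..b}" for x
  proof (cases "x < a")
    case False
    then have x: "b < x" using that by auto
    have right: "integral {c..d} \<psi> = 0" if "b < c" for c d
      using that Henstock_Kurzweil_Integration.integral_cong[of "{c..d}" \<psi> "\<lambda>_. 0"] zero by simp
    show ?thesis
    proof (cases "x \<le> L")
      case True
      then have "integral {0..x} \<psi> + integral {x..L} \<psi> = integral {0..L} \<psi>"
        using x assms ci by (intro Henstock_Kurzweil_Integration.integral_combine) auto
      then show ?thesis using right[OF x] int by simp
    next
      case False
      then have "integral {0..L} \<psi> + integral {L..x} \<psi> = integral {0..x} \<psi>"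
        using x assms ci by (intro Henstock_Kurzweil_Integration.integral_combine) auto
      then show ?thesis using right[OF assms(4)] int by simp
    qed
  qed (rule left)
  then show "\<exists>a b. 0 < a \<and> a < b \<and> b < L \<and> (\<forall>x. x \<notin> {a..b} \<longrightarrow> integral {0..x} \<psi> = 0)"
    using assms(2-4) by blast
qed (rule assms(1))

text \<open>Continuous approximations of the indicator of (x, y): the parabola (s - x)(y - s) is
  positive exactly there, and scaling by n and clipping to [0, 1] makes it tend to 1 inside.\<close>

definition plateau :: "real \<Rightarrow> real \<Rightarrow> nat \<Rightarrow> real \<Rightarrow> real" where
  "plateau x y n s = max 0 (min 1 (n * ((s - x) * (y - s))))"

lemma continuous_plateau: "continuous_on S (plateau x y n)"
  unfolding plateau_def by (intro continuous_intros)

lemma plateau_outside: "s \<notin> {x..y} \<Longrightarrow> x < y \<Longrightarrow> plateau x y n s = 0"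
proof -
  assume "s \<notin> {x..y}" "x < y"
  then have "(s - x) * (y - s) \<le> 0" by (auto simp: mult_le_0_iff)
  then have "n * ((s - x) * (y - s)) \<le> 0" by (rule mult_nonneg_nonpos[rotated]) simp
  then show "plateau x y n s = 0"
    unfolding plateau_def by (intro max_absorb1 min.coboundedI2)
qed

lemma plateau_LIMSEQ: "(\<lambda>n. plateau x y n s) \<longlonglongrightarrow> indicator {x<..<y} s" if "x < y"
proof (cases "s \<in> {x<..<y}")
  case True
  then have pos: "(s - x) * (y - s) > 0" by auto
  then obtain m :: nat where m: "1 / ((s - x) * (y - s)) < m" using reals_Archimedean2 by blast
  have "plateau x y n s = 1" if "n \<ge> m" for n
  proof -
    have "1 / ((s - x) * (y - s)) \<le> n" using m that by (meson less_imp_le of_nat_le_iff order_trans)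
    then have "1 \<le> n * ((s - x) * (y - s))" using pos by (simp add: pos_divide_le_eq)
    then show ?thesis by (simp add: plateau_def)
  qed
  then have "\<forall>\<^sub>F n in sequentially. plateau x y n s = 1" by (rule eventually_sequentiallyI)
  then show ?thesis using True by (simp add: tendsto_eventually)
next
  case False
  have "plateau x y n s = 0" for n
  proof (cases "s \<in> {x..y}")
    case True
    then have "s = x \<or> s = y" using False by auto
    then show ?thesis by (auto simp: plateau_def)
  qed (use that in \<open>simp add: plateau_outside\<close>)
  then show ?thesis using False by simp
qed

lemma prim_plateau_LIMSEQ:
  assumes h: "integrable_upto L h" and xy: "0 < x" "x < y" "y < L"
  shows "(\<lambda>n. prim (\<lambda>s. plateau x y n s * h s) L) \<longlonglongrightarrow> prim h y - prim h x"
proof -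
  have "prim h y - prim h x = (\<integral>s. indicator {x<..<y} s * (indicator {0<..<L} s * h s) \<partial>lebesgue)"
    using prim_diff_eq[OF h, of x y] xy unfolding set_lebesgue_integral_def
    by (auto intro!: Bochner_Integration.integral_cong simp: indicator_def)
  moreover have "(\<lambda>n. \<integral>s. plateau x y n s * (indicator {0<..<L} s * h s) \<partial>lebesgue) \<longlonglongrightarrow>
      (\<integral>s. indicator {x<..<y} s * (indicator {0<..<L} s * h s) \<partial>lebesgue)"
  proof (rule integral_dominated_convergence[where w = "\<lambda>s. \<bar>indicator {0<..<L} s * h s\<bar>"])
    have hi: "integrable lebesgue (\<lambda>s. indicator {0<..<L} s * h s)" using h by (simp add: set_integrable_def)
    then show "integrable lebesgue (\<lambda>s. \<bar>indicator {0<..<L} s * h s\<bar>)" by (rule integrable_abs)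
    have m: "plateau x y n \<in> borel_measurable lebesgue" for n
      using continuous_plateau[of UNIV x y n] by (simp add: borel_measurable_continuous_onI measurable_completion)
    show "(\<lambda>s. plateau x y n s * (indicator {0<..<L} s * h s)) \<in> borel_measurable lebesgue" for n
      by (rule borel_measurable_times[OF m borel_measurable_integrable[OF hi]])
    have "(indicator {x<..<y} :: real \<Rightarrow> real) \<in> borel_measurable lebesgue"
      by (rule borel_measurable_indicator) simp
    then show "(\<lambda>s. indicator {x<..<y} s * (indicator {0<..<L} s * h s)) \<in> borel_measurable lebesgue"
      by (rule borel_measurable_times[OF _ borel_measurable_integrable[OF hi]])
    show "AE s in lebesgue. (\<lambda>n. plateau x y n s * (indicator {0<..<L} s * h s)) \<longlonglongrightarrow>
        indicator {x<..<y} s * (indicator {0<..<L} s * h s)"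
      by (intro AE_I2 tendsto_mult plateau_LIMSEQ xy tendsto_const)
    have "\<bar>plateau x y n s\<bar> \<le> 1" for n s by (auto simp: plateau_def)
    then show "AE s in lebesgue. norm (plateau x y n s * (indicator {0<..<L} s * h s)) \<le> \<bar>indicator {0<..<L} s * h s\<bar>" for n
      by (intro AE_I2) (simp add: abs_mult mult_left_le_one_le)
  qed
  moreover have "(\<integral>s. plateau x y n s * (indicator {0<..<L} s * h s) \<partial>lebesgue) = prim (\<lambda>s. plateau x y n s * h s) L" for n
    unfolding prim_def set_lebesgue_integral_def
    by (intro Bochner_Integration.integral_cong) auto
  ultimately show ?thesis by simp
qed

text \<open>Any plateau minus a multiple of one reference plateau has mean zero, hence is the
  derivative of a test function. So w integrates against each plateau to the same constant c times
  the plateau's integral. Letting plateaus tend to indicators gives c (y - x) for the integral of w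
  over (x, y), and differentiation gives w = c.\<close>

lemma du_Bois_Reymond:
  assumes L: "0 < L" and w: "integrable_upto L w"
    and test: "\<And>\<phi> \<phi>'. test_function L \<phi> \<phi>' \<Longrightarrow> prim (\<lambda>s. \<phi>' s * w s) L = 0"
  shows "\<exists>c. AE x in lebesgue. x \<in> {0<..<L} \<longrightarrow> w x = c"
proof -
  have int: "integrable_upto L (\<lambda>s. plateau x y n s)" "integrable_upto L (\<lambda>s. plateau x y n s * w s)" for x y n
    by (intro integrable_upto_continuous integrable_upto_mult_continuous continuous_plateau w)+
  have one: "(\<lambda>n. prim (plateau x y n) L) \<longlonglongrightarrow> y - x" if "0 < x" "x < y" "y < L" for x y
  proof -
    have "integrable_upto L (\<lambda>s. 1)" by (intro integrable_upto_continuous continuous_intros)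
    moreover have "prim (\<lambda>s. 1) z = z" if "0 \<le> z" for z
      using that by (simp add: prim_def set_integral_const)
    ultimately show ?thesis using prim_plateau_LIMSEQ[of L "\<lambda>s. 1" x y] that by simp
  qed
  define x0 y0 where "x0 = L / 3" and "y0 = L / 2"
  have xy0: "0 < x0" "x0 < y0" "y0 < L" using L by (auto simp: x0_def y0_def)
  have "\<forall>\<^sub>F n in sequentially. 0 < prim (plateau x0 y0 n) L"
    using xy0 by (intro order_tendstoD(1)[OF one[OF xy0]]) auto
  then obtain m where m: "0 < prim (plateau x0 y0 m) L" by (metis eventually_sequentially order_refl)
  \<comment> \<open>The average of w weighted by the reference plateau, the only possible value of
    the constant.\<close>
  define c where "c = prim (\<lambda>s. plateau x0 y0 m s * w s) L / prim (plateau x0 y0 m) L"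
  have key: "prim (\<lambda>s. plateau x y n s * w s) L = c * prim (plateau x y n) L"
    if xy: "0 < x" "x < y" "y < L" for x y n
  proof -
    define k where "k = prim (plateau x y n) L / prim (plateau x0 y0 m) L"
    define \<psi> where "\<psi> s = plateau x y n s - k * plateau x0 y0 m s" for s
    have cont: "continuous_on S \<psi>" for S
      unfolding \<psi>_def by (intro continuous_intros continuous_plateau)
    have "test_function L (\<lambda>x. integral {0..x} \<psi>) \<psi>"
    proof (rule test_function_integral[of _ "min x x0" "max y y0"])
      show "\<psi> s = 0" if "s \<notin> {min x x0..max y y0}" for s
      proof -
        have "s \<notin> {x..y}" "s \<notin> {x0..y0}" using that by (auto simp: min_def max_def split: if_splits)
        then show ?thesis using xy xy0 by (simp add: \<psi>_def plateau_outside)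
      qed
      have "integral {0..L} \<psi> = prim \<psi> L"
        using prim_eq_integral[OF integrable_upto_continuous[OF cont], of L L] by simp
      also have "\<dots> = prim (plateau x y n) L - k * prim (plateau x0 y0 m) L"
        unfolding \<psi>_def using int by (subst prim_diff) (simp_all add: prim_cmult)
      also have "\<dots> = 0" using m by (simp add: k_def)
      finally show "integral {0..L} \<psi> = 0" .
    qed (use xy xy0 cont in auto)
    then have "0 = prim (\<lambda>s. \<psi> s * w s) L" by (simp add: test)
    also have "\<dots> = prim (\<lambda>s. plateau x y n s * w s - k * (plateau x0 y0 m s * w s)) L"
      by (simp add: \<psi>_def algebra_simps)
    also have "\<dots> = prim (\<lambda>s. plateau x y n s * w s) L - k * prim (\<lambda>s. plateau x0 y0 m s * w s) L"
      using int by (subst prim_diff) (simp_all add: prim_cmult)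
    finally show ?thesis using m by (simp add: k_def c_def field_simps)
  qed
  have incr: "prim w y - prim w x = c * (y - x)" if "0 < x" "x < y" "y < L" for x y
    using LIMSEQ_unique[OF prim_plateau_LIMSEQ[OF w that]] tendsto_mult[OF tendsto_const one[OF that], of c]
    by (simp add: key that)
  have wc: "integrable_upto L (\<lambda>s. w s - c)"
    by (intro set_integral_diff w integrable_upto_continuous continuous_intros)
  have prim_wc: "prim (\<lambda>s. w s - c) x = prim w x - c * x" if "0 \<le> x" "x \<le> L" for x
  proof -
    have "prim (\<lambda>s. w s - c) x = prim w x - prim (\<lambda>s. c) x"
      by (rule prim_diff[OF integrable_upto_mono[OF w that(2)] integrable_upto_continuous[OF continuous_on_const]])
    then show ?thesis using that by (simp add: prim_def set_integral_const)
  qed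
  have cont: "continuous_on {0..L} (prim (\<lambda>s. w s - c))" by (rule continuous_on_prim[OF wc])
  define k where "k = prim (\<lambda>s. w s - c) (L / 2)"
  have const: "prim (\<lambda>s. w s - c) x = k" if "x \<in> {0<..<L}" for x
    using incr[of x "L / 2"] incr[of "L / 2" x] that L unfolding k_def
    by (cases "x < L / 2"; cases "x = L / 2") (auto simp: prim_wc algebra_simps)
  have const': "prim (\<lambda>s. w s - c) x = k" if "0 \<le> x" "x \<le> L" for x
    using continuous_constant_on_closure[of "{0<..<L}" "prim (\<lambda>s. w s - c)" k x] cont const that L by auto
  \<comment> \<open>Continuity carries the constant value to the endpoint 0, where every primitive
    vanishes.\<close>
  have "k = 0" using const'[of 0] L by simp
  then have "AE x in lebesgue. x \<in> {0<..<L} \<longrightarrow> w x - c = 0"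
    using const' by (intro AE_eq_0_of_prim_eq_0 wc) auto
  then show ?thesis by (intro exI[of _ c]) (auto elim: eventually_mono)
qed

text \<open>One relation packaging membership in \<open>W11\<close>, the boundary value c and the
  weak derivative g. It is jointly linear in p, c and g, so the definite descriptions in
  \<open>value_at_0\<close> and \<open>weak_deriv\<close> have to be resolved only once.\<close>

definition is_primitive :: "real \<Rightarrow> l1 \<Rightarrow> real \<Rightarrow> l1 \<Rightarrow> bool" where
  "is_primitive L p c g \<longleftrightarrow> p \<in> L1_on L \<and> g \<in> L1_on L \<and>
     (AE x in lebesgue. x \<in> {0<..<L} \<longrightarrow> rep_l1 p x = c + prim (rep_l1 g) x)"

lemma integrable_upto_rep: "integrable_upto x (rep_l1 f)"
  by (rule set_integrable_rep) simp

lemma test_function_prim: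
  assumes "test_function L \<phi> \<phi>'"
  shows "continuous_on S \<phi>'" "continuous_on S \<phi>" "\<phi> L = 0" "0 \<le> x \<Longrightarrow> \<phi> x = 0 + prim \<phi>' x"
proof -
  have d: "\<And>x. (\<phi> has_real_derivative \<phi>' x) (at x)" and c: "continuous_on UNIV \<phi>'"
    using assms by (auto simp: test_function_def)
  obtain a b where ab: "0 < a" "a < b" "b < L" "\<And>x. x \<notin> {a..b} \<Longrightarrow> \<phi> x = 0"
    using assms unfolding test_function_def by blast
  then show "\<phi> L = 0" by auto
  have "\<phi> 0 = 0" using ab by auto
  show "continuous_on S \<phi>'" using c by (rule continuous_on_subset) simp
  show "continuous_on S \<phi>"
    using d by (meson DERIV_isCont continuous_at_imp_continuous_on)
  show "\<phi> x = 0 + prim \<phi>' x" if "0 \<le> x"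
  proof -
    have "(\<phi>' has_integral \<phi> x - \<phi> 0) {0..x}"
      using that d by (intro fundamental_theorem_of_calculus)
        (auto simp: has_real_derivative_iff_has_vector_derivative[symmetric] intro: has_field_derivative_at_within)
    moreover have "prim \<phi>' x = integral {0..x} \<phi>'"
      using c by (intro prim_eq_integral[of x] integrable_upto_continuous) (auto elim: continuous_on_subset)
    ultimately show ?thesis using \<open>\<phi> 0 = 0\<close> by (simp add: integral_unique)
  qed
qed

text \<open>The boundary term at L vanishes because \<phi> does; at 0 it disappears since \<phi> is
  a primitive with initial value 0.\<close>

lemma integral_by_parts_test:
  assumes "0 < L" "test_function L \<phi> \<phi>'" "integrable_upto L g"
  shows "prim (\<lambda>s. \<phi>' s * (c + prim g s)) L = - prim (\<lambda>s. g s * \<phi> s) L"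
proof -
  note t = test_function_prim[OF assms(2)]
  have i: "integrable_upto L \<phi>'" by (intro integrable_upto_continuous t)
  have "(c + prim g L) * \<phi> L = c * 0 + prim (\<lambda>s. g s * \<phi> s + (c + prim g s) * \<phi>' s) L"
    by (rule mult_prim(2)[OF assms(3) i]) (use t(4) assms(1) in auto)
  also have "prim (\<lambda>s. g s * \<phi> s + (c + prim g s) * \<phi>' s) L = prim (\<lambda>s. g s * \<phi> s) L + prim (\<lambda>s. (c + prim g s) * \<phi>' s) L"
    using integrable_upto_mult_continuous[OF assms(3) t(2)]
      integrable_upto_mult_continuous[OF i continuous_on_add[OF continuous_on_const continuous_on_prim[OF assms(3)]]]
    by (intro prim_add) (simp_all add: mult.commute)
  finally show ?thesis using t(3) by (simp add: mult.commute)
qed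

lemma is_primitive_weak_deriv:
  assumes "0 < L" "is_primitive L p c g" shows "has_weak_deriv L p g"
  unfolding has_weak_deriv_def
proof (intro conjI allI impI)
  fix \<phi> \<phi>' assume test: "test_function L \<phi> \<phi>'"
  note t = test_function_prim[OF test]
  have "prim (\<lambda>x. rep_l1 p x * \<phi>' x) L = prim (\<lambda>s. \<phi>' s * (c + prim (rep_l1 g) s)) L"
  proof (rule prim_cong_AE)
    show "integrable_upto L (\<lambda>x. rep_l1 p x * \<phi>' x)"
      using integrable_upto_mult_continuous[OF integrable_upto_rep t(1)] by (simp add: mult.commute)
    show "integrable_upto L (\<lambda>s. \<phi>' s * (c + prim (rep_l1 g) s))"
      by (intro integrable_upto_continuous continuous_intros t continuous_on_prim integrable_upto_rep)
    show "AE s in lebesgue. s \<in> {0<..<L} \<longrightarrow> rep_l1 p s * \<phi>' s = \<phi>' s * (c + prim (rep_l1 g) s)"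
      using assms(2) unfolding is_primitive_def by (auto elim!: eventually_mono)
  qed
  also have "\<dots> = - prim (\<lambda>s. rep_l1 g s * \<phi> s) L"
    by (intro integral_by_parts_test assms test integrable_upto_rep)
  finally show "(LINT x:{0<..<L}|lebesgue. rep_l1 p x * \<phi>' x) = - (LINT x:{0<..<L}|lebesgue. rep_l1 g x * \<phi> x)"
    by (simp add: prim_def)
qed (use assms in \<open>auto simp: is_primitive_def\<close>)

text \<open>Subtracting a primitive of the weak derivative leaves a function orthogonal to the
  derivatives of all test functions, hence a constant.\<close>

lemma has_weak_deriv_primitive:
  assumes L: "0 < L" and p: "has_weak_deriv L p g" shows "\<exists>c. is_primitive L p c g"
proof -
  let ?w = "\<lambda>s. rep_l1 p s - prim (rep_l1 g) s"
  have cont: "continuous_on {0..L} (prim (rep_l1 g))" by (intro continuous_on_prim integrable_upto_rep)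
  have "\<exists>c. AE x in lebesgue. x \<in> {0<..<L} \<longrightarrow> ?w x = c"
  proof (rule du_Bois_Reymond[OF L])
    show "integrable_upto L ?w"
      by (intro set_integral_diff integrable_upto_rep integrable_upto_continuous cont)
    fix \<phi> \<phi>' assume test: "test_function L \<phi> \<phi>'"
    note t = test_function_prim[OF test]
    have "prim (\<lambda>s. \<phi>' s * ?w s) L = prim (\<lambda>s. \<phi>' s * rep_l1 p s - \<phi>' s * (0 + prim (rep_l1 g) s)) L"
      by (simp add: algebra_simps)
    also have "\<dots> = prim (\<lambda>s. \<phi>' s * rep_l1 p s) L - prim (\<lambda>s. \<phi>' s * (0 + prim (rep_l1 g) s)) L"
      by (intro prim_diff integrable_upto_mult_continuous integrable_upto_rep t integrable_upto_continuous continuous_intros cont)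
    also have "prim (\<lambda>s. \<phi>' s * rep_l1 p s) L = - prim (\<lambda>s. rep_l1 g s * \<phi> s) L"
      using p test unfolding has_weak_deriv_def prim_def by (simp add: mult.commute)
    also have "prim (\<lambda>s. \<phi>' s * (0 + prim (rep_l1 g) s)) L = - prim (\<lambda>s. rep_l1 g s * \<phi> s) L"
      by (intro integral_by_parts_test L test integrable_upto_rep)
    finally show "prim (\<lambda>s. \<phi>' s * ?w s) L = 0" by simp
  qed
  then obtain c where "AE x in lebesgue. x \<in> {0<..<L} \<longrightarrow> ?w x = c" by blast
  then have "is_primitive L p c g"
    using p unfolding is_primitive_def has_weak_deriv_def by (auto elim!: eventually_mono)
  then show ?thesis ..
qed

text \<open>Two continuous representatives agree everywhere. Their values at 0 give the constants,
  and differentiating the primitives almost everywhere gives the derivatives.\<close>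

lemma is_primitive_unique:
  assumes L: "0 < L" and 1: "is_primitive L p c g" and 2: "is_primitive L p c' g'"
  shows "c = c'" "g = g'"
proof -
  let ?k = "\<lambda>x. (c + prim (rep_l1 g) x) - (c' + prim (rep_l1 g') x)"
  have "continuous_on {0..L} ?k"
    by (intro continuous_intros continuous_on_prim integrable_upto_rep)
  moreover have "AE x in lebesgue. x \<in> {0<..<L} \<longrightarrow> ?k x = 0"
    using 1 2 unfolding is_primitive_def by (auto elim!: eventually_elim2)
  ultimately have k: "?k x = 0" if "0 \<le> x" "x \<le> L" for x
    using continuous_eq_0_of_AE[of L ?k x] L that by simp
  show "c = c'" using k[of 0] L by simp
  then have "prim (\<lambda>s. rep_l1 g s - rep_l1 g' s) x = 0" if "0 \<le> x" "x \<le> L" for x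
    using k[OF that] by (simp add: prim_diff integrable_upto_rep)
  then have "AE x in lebesgue. x \<in> {0<..<L} \<longrightarrow> rep_l1 g x - rep_l1 g' x = 0"
    by (intro AE_eq_0_of_prim_eq_0 set_integral_diff integrable_upto_rep)
  then show "g = g'"
    using 1 2 unfolding is_primitive_def by (intro L1_on_eqI[of _ L]) auto
qed

lemma weak_deriv_eq:
  assumes "0 < L" "is_primitive L p c g" shows "weak_deriv L p = g"
  unfolding weak_deriv_def
proof (rule the_equality)
  show "has_weak_deriv L p g" using is_primitive_weak_deriv assms by blast
  show "g' = g" if "has_weak_deriv L p g'" for g'
    using has_weak_deriv_primitive[OF assms(1) that] is_primitive_unique[OF assms(1)] assms(2) by blast
qed

lemma value_at_0_eq:
  assumes L: "0 < L" and p: "is_primitive L p c g" shows "value_at_0 L p = c"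
  unfolding value_at_0_def
proof (rule the_equality)
  let ?F = "\<lambda>x. c + prim (rep_l1 g) x"
  have cont: "continuous_on {0..L} ?F"
    by (intro continuous_intros continuous_on_prim integrable_upto_rep)
  have ae: "AE x in lebesgue. x \<in> {0<..<L} \<longrightarrow> ?F x = rep_l1 p x"
    using p unfolding is_primitive_def by (auto elim!: eventually_mono)
  show "\<exists>f. continuous_on {0..L} f \<and> (AE x in lebesgue. x \<in> {0<..<L} \<longrightarrow> f x = rep_l1 p x) \<and> f 0 = c"
    using cont ae by (intro exI[of _ ?F]) simp
  fix c' assume "\<exists>f. continuous_on {0..L} f \<and> (AE x in lebesgue. x \<in> {0<..<L} \<longrightarrow> f x = rep_l1 p x) \<and> f 0 = c'"
  then obtain f where f: "continuous_on {0..L} f" "AE x in lebesgue. x \<in> {0<..<L} \<longrightarrow> f x = rep_l1 p x" "f 0 = c'"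
    by blast
  have "AE x in lebesgue. x \<in> {0<..<L} \<longrightarrow> f x - ?F x = 0"
    using f(2) ae by eventually_elim auto
  then have "f 0 - ?F 0 = 0"
    using continuous_eq_0_of_AE[OF continuous_on_diff[OF f(1) cont], of 0] L by simp
  then show "c' = c" using f(3) by simp
qed

lemma W11_iff: "0 < L \<Longrightarrow> p \<in> W11 L \<longleftrightarrow> (\<exists>c g. is_primitive L p c g)"
  unfolding W11_def using has_weak_deriv_primitive is_primitive_weak_deriv by blast

section \<open>Linearity of the primitive relation\<close>

lemma is_primitive_add:
  assumes "is_primitive L p c g" "is_primitive L p' c' g'" shows "is_primitive L (p + p') (c + c') (g + g')"
  unfolding is_primitive_def
proof (intro conjI)
  have "prim (rep_l1 (g + g')) x = prim (rep_l1 g) x + prim (rep_l1 g') x" for x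
  proof -
    have "prim (rep_l1 (g + g')) x = prim (\<lambda>s. rep_l1 g s + rep_l1 g' s) x"
      using rep_add_l1[of g g'] by (intro prim_cong_AE set_integral_add integrable_upto_rep) auto
    then show ?thesis by (simp add: prim_add integrable_upto_rep)
  qed
  note sum = this
  have "AE x in lebesgue. x \<in> {0<..<L} \<longrightarrow> rep_l1 p x = c + prim (rep_l1 g) x"
    "AE x in lebesgue. x \<in> {0<..<L} \<longrightarrow> rep_l1 p' x = c' + prim (rep_l1 g') x"
    using assms by (simp_all add: is_primitive_def)
  with rep_add_l1[of p p'] show "AE x in lebesgue. x \<in> {0<..<L} \<longrightarrow> rep_l1 (p + p') x = c + c' + prim (rep_l1 (g + g')) x"
    by eventually_elim (simp add: sum)
qed (use assms subspace_add[OF subspace_L1_on] in \<open>auto simp: is_primitive_def\<close>)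

lemma is_primitive_scaleR:
  assumes "is_primitive L p c g" shows "is_primitive L (k *\<^sub>R p) (k * c) (k *\<^sub>R g)"
  unfolding is_primitive_def
proof (intro conjI)
  have "prim (rep_l1 (k *\<^sub>R g)) x = k * prim (rep_l1 g) x" for x
  proof -
    have "prim (rep_l1 (k *\<^sub>R g)) x = prim (\<lambda>s. k * rep_l1 g s) x"
      using rep_scaleR_l1[of k g] by (intro prim_cong_AE set_integrable_mult_right integrable_upto_rep) auto
    then show ?thesis by (simp add: prim_cmult)
  qed
  note scale = this
  have "AE x in lebesgue. x \<in> {0<..<L} \<longrightarrow> rep_l1 p x = c + prim (rep_l1 g) x"
    using assms by (simp add: is_primitive_def)
  with rep_scaleR_l1[of k p] show "AE x in lebesgue. x \<in> {0<..<L} \<longrightarrow> rep_l1 (k *\<^sub>R p) x = k * c + prim (rep_l1 (k *\<^sub>R g)) x"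
    by eventually_elim (simp add: scale algebra_simps)
qed (use assms subspace_scale[OF subspace_L1_on] in \<open>auto simp: is_primitive_def\<close>)

section \<open>Transport equations for Lebesgue classes\<close>

definition mult_class :: "real \<Rightarrow> (real \<Rightarrow> real) \<Rightarrow> l1 \<Rightarrow> l1" where
  "mult_class L m p = class_on L (\<lambda>x. m x * rep_l1 p x)"

text \<open>The boundary value problem p' = f - a p, p(0) = c in weak form, including the domain
  condition that a p is integrable.\<close>

definition transport :: "real \<Rightarrow> (real \<Rightarrow> real) \<Rightarrow> real \<Rightarrow> l1 \<Rightarrow> l1 \<Rightarrow> bool" where
  "transport L a c f p \<longleftrightarrow> is_primitive L p c (f - mult_class L a p) \<and> integrable_upto L (\<lambda>x. a x * rep_l1 p x)"

lemma set_borel_measurable_times: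
  fixes f g :: "real \<Rightarrow> real"
  assumes "set_borel_measurable M A f" "set_borel_measurable M A g"
  shows "set_borel_measurable M A (\<lambda>x. f x * g x)"
proof -
  have "(\<lambda>x. (indicator A x *\<^sub>R f x) * (indicator A x *\<^sub>R g x)) \<in> borel_measurable M"
    using assms unfolding set_borel_measurable_def by (rule borel_measurable_times)
  also have "(\<lambda>x. (indicator A x *\<^sub>R f x) * (indicator A x *\<^sub>R g x)) = (\<lambda>x. indicator A x *\<^sub>R (f x * g x))"
    by (auto simp: indicator_def)
  finally show ?thesis unfolding set_borel_measurable_def .
qed

lemma set_borel_measurable_integrable: "set_integrable M A f \<Longrightarrow> set_borel_measurable M A f"
  unfolding set_borel_measurable_def set_integrable_def by (rule borel_measurable_integrable)

lemma set_integrable_AE_eq: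
  fixes f g :: "real \<Rightarrow> real"
  assumes "set_integrable M A f" "set_borel_measurable M A g" "AE x in M. x \<in> A \<longrightarrow> g x = f x"
  shows "set_integrable M A g"
  using assms by (intro set_integrable_bound[OF assms(1,2)]) (auto elim: eventually_mono)

lemma class_on_cong_AE:
  assumes "integrable_upto L f" "integrable_upto L g" "AE x in lebesgue. x \<in> {0<..<L} \<longrightarrow> f x = g x"
  shows "class_on L f = class_on L g"
  using rep_class_on[OF assms(1)] rep_class_on[OF assms(2)] assms(3)
  by (intro l1_eqI, eventually_elim) (auto simp: indicator_def)

lemma class_on_add:
  assumes "integrable_upto L f" "integrable_upto L g"
  shows "class_on L (\<lambda>x. f x + g x) = class_on L f + class_on L g"
  using rep_class_on[OF assms(1)] rep_class_on[OF assms(2)] rep_class_on[OF set_integral_add(1)[OF assms]]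
    rep_add_l1[of "class_on L f" "class_on L g"]
  by (intro l1_eqI, eventually_elim) (simp add: algebra_simps)

lemma class_on_cmult:
  assumes "integrable_upto L f" shows "class_on L (\<lambda>x. c * f x) = c *\<^sub>R class_on L f"
  using rep_class_on[OF assms] rep_class_on[OF set_integrable_mult_right[of c, OF assms]]
    rep_scaleR_l1[of c "class_on L f"]
  by (intro l1_eqI, eventually_elim) simp

lemma class_on_rep: "p \<in> L1_on L \<Longrightarrow> class_on L (rep_l1 p) = p"
  using rep_class_on[of L "rep_l1 p"] integrable_upto_rep
  by (intro L1_on_eqI[OF class_on_in_L1_on]) (auto elim: eventually_mono)

lemma lint_prim: "p \<in> L1_on L \<Longrightarrow> lint p = prim (rep_l1 p) L"
  using lint_L1_on by (simp add: prim_def)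

lemma lint_mult_class:
  "integrable_upto L (\<lambda>x. m x * rep_l1 p x) \<Longrightarrow> lint (mult_class L m p) = prim (\<lambda>x. m x * rep_l1 p x) L"
  unfolding mult_class_def prim_def by (rule lint_class_on)

lemma mult_class_in_L1_on:
  "integrable_upto L (\<lambda>x. m x * rep_l1 p x) \<Longrightarrow> mult_class L m p \<in> L1_on L"
  unfolding mult_class_def by (rule class_on_in_L1_on)

lemma set_borel_measurable_mult_rep:
  assumes "set_borel_measurable lebesgue {0<..<L} m"
  shows "set_borel_measurable lebesgue {0<..<L} (\<lambda>x. m x * rep_l1 p x)"
  by (intro set_borel_measurable_times assms set_borel_measurable_integrable integrable_upto_rep)

lemma mult_class_add:
  assumes m: "set_borel_measurable lebesgue {0<..<L} m"
    and p: "integrable_upto L (\<lambda>x. m x * rep_l1 p x)" and q: "integrable_upto L (\<lambda>x. m x * rep_l1 q x)"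
  shows "integrable_upto L (\<lambda>x. m x * rep_l1 (p + q) x)"
    and "mult_class L m (p + q) = mult_class L m p + mult_class L m q"
proof -
  have ae: "AE x in lebesgue. x \<in> {0<..<L} \<longrightarrow> m x * rep_l1 (p + q) x = m x * rep_l1 p x + m x * rep_l1 q x"
    using rep_add_l1[of p q] by eventually_elim (simp add: algebra_simps)
  show i: "integrable_upto L (\<lambda>x. m x * rep_l1 (p + q) x)"
    by (rule set_integrable_AE_eq[OF set_integral_add(1)[OF p q] set_borel_measurable_mult_rep[OF m] ae])
  show "mult_class L m (p + q) = mult_class L m p + mult_class L m q"
    unfolding mult_class_def using class_on_cong_AE[OF i set_integral_add(1)[OF p q] ae] class_on_add[OF p q] by simp
qed

lemma mult_class_scaleR:
  assumes m: "set_borel_measurable lebesgue {0<..<L} m" and p: "integrable_upto L (\<lambda>x. m x * rep_l1 p x)"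
  shows "integrable_upto L (\<lambda>x. m x * rep_l1 (k *\<^sub>R p) x)"
    and "mult_class L m (k *\<^sub>R p) = k *\<^sub>R mult_class L m p"
proof -
  have ae: "AE x in lebesgue. x \<in> {0<..<L} \<longrightarrow> m x * rep_l1 (k *\<^sub>R p) x = k * (m x * rep_l1 p x)"
    using rep_scaleR_l1[of k p] by eventually_elim simp
  have kp: "integrable_upto L (\<lambda>x. k * (m x * rep_l1 p x))" by (intro set_integrable_mult_right p)
  show i: "integrable_upto L (\<lambda>x. m x * rep_l1 (k *\<^sub>R p) x)"
    by (rule set_integrable_AE_eq[OF kp set_borel_measurable_mult_rep[OF m] ae])
  show "mult_class L m (k *\<^sub>R p) = k *\<^sub>R mult_class L m p"
    unfolding mult_class_def using class_on_cong_AE[OF i kp ae] class_on_cmult[OF p] by simp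
qed

text \<open>Lets the constants of the resolvent equation, 1/h and \<open>lam2\<close>, be absorbed
  into the rate.\<close>

lemma mult_class_shift:
  assumes "p \<in> L1_on L"
  shows "integrable_upto L (\<lambda>x. (k + m x) * rep_l1 p x) \<longleftrightarrow> integrable_upto L (\<lambda>x. m x * rep_l1 p x)"
    and "integrable_upto L (\<lambda>x. m x * rep_l1 p x) \<Longrightarrow> mult_class L (\<lambda>x. k + m x) p = k *\<^sub>R p + mult_class L m p"
proof -
  have k: "integrable_upto L (\<lambda>x. k * rep_l1 p x)" by (intro set_integrable_mult_right integrable_upto_rep)
  show "integrable_upto L (\<lambda>x. (k + m x) * rep_l1 p x) \<longleftrightarrow> integrable_upto L (\<lambda>x. m x * rep_l1 p x)"
    using set_integral_add(1)[OF k, of "\<lambda>x. m x * rep_l1 p x"] set_integral_diff(1)[OF _ k, of "\<lambda>x. (k + m x) * rep_l1 p x"]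
    by (auto simp: algebra_simps)
  show "mult_class L (\<lambda>x. k + m x) p = k *\<^sub>R p + mult_class L m p" if "integrable_upto L (\<lambda>x. m x * rep_l1 p x)"
    using class_on_add[OF k that] class_on_cmult[OF integrable_upto_rep, of L k p] class_on_rep[OF assms]
    by (simp add: mult_class_def algebra_simps)
qed

lemma nonneg_class_on:
  assumes "integrable_upto L f" "AE x in lebesgue. x \<in> {0<..<L} \<longrightarrow> 0 \<le> f x" shows "0 \<le> class_on L f"
  using rep_class_on[OF assms(1)] assms(2)
  by (intro nonneg_L1_onI[OF class_on_in_L1_on[OF assms(1)]], eventually_elim) auto

section \<open>Solvability, uniqueness and mass balance of the transport equation\<close>

context rate
begin

lemma measurable_a: "set_borel_measurable lebesgue {0<..<L} a"
  by (intro set_borel_measurable_limit a_loc L_pos)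

lemma transport_add:
  assumes "transport L a c f p" "transport L a c' f' p'" shows "transport L a (c + c') (f + f') (p + p')"
  using is_primitive_add[of L p c "f - mult_class L a p" p' c' "f' - mult_class L a p'"] assms
    mult_class_add[OF measurable_a, of p p']
  unfolding transport_def by (simp add: algebra_simps)

lemma transport_scaleR:
  assumes "transport L a c f p" shows "transport L a (k * c) (k *\<^sub>R f) (k *\<^sub>R p)"
  using is_primitive_scaleR[of L p c "f - mult_class L a p" k] assms mult_class_scaleR[OF measurable_a, of p k]
  unfolding transport_def by (simp add: algebra_simps)

lemma is_primitive_continuous:
  assumes p: "is_primitive L p c g" and int: "integrable_upto L (\<lambda>x. a x * rep_l1 p x)"
  defines "u \<equiv> \<lambda>x. c + prim (rep_l1 g) x"
  shows "continuous_on {0..L} u" "AE x in lebesgue. x \<in> {0<..<L} \<longrightarrow> a x * u x = a x * rep_l1 p x"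
    and "integrable_upto L (\<lambda>x. a x * u x)"
proof -
  show cont: "continuous_on {0..L} u"
    unfolding u_def by (intro continuous_intros continuous_on_prim integrable_upto_rep)
  show ae: "AE x in lebesgue. x \<in> {0<..<L} \<longrightarrow> a x * u x = a x * rep_l1 p x"
    using p unfolding is_primitive_def u_def by (auto elim!: eventually_mono)
  show "integrable_upto L (\<lambda>x. a x * u x)"
    by (rule set_integrable_AE_eq[OF int set_borel_measurable_times[OF measurable_a
        set_borel_measurable_integrable[OF integrable_upto_continuous[OF cont]]] ae])
qed

text \<open>The source of mass conservation: the continuous representative vanishes at L, so the
  derivative integrates to minus the value at 0.\<close>

lemma is_primitive_end:
  assumes "is_primitive L p c g" "integrable_upto L (\<lambda>x. a x * rep_l1 p x)"
  shows "lint g = - c"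
proof -
  have "c + prim (rep_l1 g) L = 0"
    using ode_end is_primitive_continuous(1,3)[OF assms] by blast
  then show ?thesis using assms(1) by (simp add: is_primitive_def lint_prim[of g L])
qed

lemma transport_mass:
  assumes "transport L a c f p" shows "lint (mult_class L a p) = c + lint f"
  using is_primitive_end[of p c "f - mult_class L a p"] assms by (simp add: transport_def lint_diff)

lemma transport_exists:
  assumes f: "f \<in> L1_on L"
  shows "\<exists>p. transport L a c f p \<and> (0 \<le> c \<longrightarrow> 0 \<le> f \<longrightarrow> 0 \<le> p)"
proof -
  obtain u where u: "continuous_on {0..L} u" "integrable_upto L (\<lambda>s. a s * u s)"
    "\<forall>x\<in>{0..L}. u x = c + prim (\<lambda>s. rep_l1 f s - a s * u s) x"
    "0 \<le> c \<longrightarrow> (AE s in lebesgue. s \<in> {0<..<L} \<longrightarrow> 0 \<le> rep_l1 f s) \<longrightarrow> (\<forall>x\<in>{0<..<L}. 0 \<le> u x)"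
    using ode_exists[OF integrable_upto_rep, of c f] by blast
  define p where "p = class_on L u"
  have ui: "integrable_upto L u" by (rule integrable_upto_continuous[OF u(1)])
  have p: "AE x in lebesgue. x \<in> {0<..<L} \<longrightarrow> rep_l1 p x = u x"
    unfolding p_def using rep_class_on[OF ui] by eventually_elim simp
  have ae: "AE x in lebesgue. x \<in> {0<..<L} \<longrightarrow> a x * rep_l1 p x = a x * u x"
    using p by eventually_elim simp
  have int: "integrable_upto L (\<lambda>x. a x * rep_l1 p x)"
    by (rule set_integrable_AE_eq[OF u(2) set_borel_measurable_mult_rep[OF measurable_a] ae])
  have mc: "AE x in lebesgue. x \<in> {0<..<L} \<longrightarrow> rep_l1 (mult_class L a p) x = a x * u x"
    unfolding mult_class_def using rep_class_on[OF int] ae by eventually_elim simp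
  have g: "AE x in lebesgue. x \<in> {0<..<L} \<longrightarrow> rep_l1 (f - mult_class L a p) x = rep_l1 f x - a x * u x"
    using mc rep_diff_l1[of f "mult_class L a p"] by eventually_elim simp
  have pg: "prim (rep_l1 (f - mult_class L a p)) x = prim (\<lambda>s. rep_l1 f s - a s * u s) x" if "x < L" for x
    using integrable_upto_mono[OF u(2), of x] that g
    by (intro prim_cong_AE set_integral_diff integrable_upto_rep) (auto elim!: eventually_mono)
  have "is_primitive L p c (f - mult_class L a p)"
    unfolding is_primitive_def
  proof (intro conjI)
    show "p \<in> L1_on L" unfolding p_def by (rule class_on_in_L1_on[OF ui])
    show "f - mult_class L a p \<in> L1_on L" by (intro subspace_diff[OF subspace_L1_on] f mult_class_in_L1_on int)
    show "AE x in lebesgue. x \<in> {0<..<L} \<longrightarrow> rep_l1 p x = c + prim (rep_l1 (f - mult_class L a p)) x"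
      using p by eventually_elim (use u(3) in \<open>simp add: pg\<close>)
  qed
  moreover have "0 \<le> p" if "0 \<le> c" "0 \<le> f"
    unfolding p_def
  proof (rule nonneg_class_on[OF ui])
    have "AE s in lebesgue. s \<in> {0<..<L} \<longrightarrow> 0 \<le> rep_l1 f s"
      using that(2) unfolding nonneg_l1_rep by (auto elim: eventually_mono)
    with u(4) that(1) show "AE x in lebesgue. x \<in> {0<..<L} \<longrightarrow> 0 \<le> u x" by (intro AE_I2) simp
  qed
  ultimately show ?thesis using int unfolding transport_def by blast
qed

lemma transport_zero:
  assumes "transport L a 0 0 p" shows "p = 0"
proof -
  define u where "u x = 0 + prim (rep_l1 (0 - mult_class L a p)) x" for x
  have prm: "is_primitive L p 0 (0 - mult_class L a p)" and int: "integrable_upto L (\<lambda>x. a x * rep_l1 p x)"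
    using assms by (auto simp: transport_def)
  note u = is_primitive_continuous[OF prm int, folded u_def]
  have g: "AE x in lebesgue. x \<in> {0<..<L} \<longrightarrow> rep_l1 (0 - mult_class L a p) x = - (a x * u x)"
    using rep_diff_l1[of 0 "mult_class L a p"] rep_zero_l1 rep_class_on[OF int] u(2)
    unfolding mult_class_def by eventually_elim auto
  have "u x = prim (\<lambda>s. - (a s * u s)) x" if "0 \<le> x" "x \<le> L" for x
  proof -
    have "integrable_upto x (\<lambda>s. - (a s * u s))"
      using set_integrable_mult_right[of "-1", OF integrable_upto_mono[OF u(3) that(2)]] by simp
    then show ?thesis unfolding u_def[of x] using g that
      by (simp, intro prim_cong_AE integrable_upto_rep) (auto elim!: eventually_mono)
  qed
  then have "u x = 0" if "0 \<le> x" "x \<le> L" for x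
    using ode_unique[OF u(3)] that by blast
  moreover have "AE x in lebesgue. x \<in> {0<..<L} \<longrightarrow> rep_l1 p x = u x"
    using prm by (simp add: is_primitive_def u_def)
  ultimately have "AE x in lebesgue. x \<in> {0<..<L} \<longrightarrow> rep_l1 p x = rep_l1 0 x"
    using rep_zero_l1 by (auto elim!: eventually_elim2)
  then show ?thesis
    using prm subspace_0[OF subspace_L1_on] by (intro L1_on_eqI[of _ L]) (auto simp: is_primitive_def)
qed

lemma transport_unique:
  assumes "transport L a c f p" "transport L a c f q" shows "p = q"
  using transport_zero[of "p - q"] transport_add[OF assms(1) transport_scaleR[OF assms(2), of "-1"]] by simp

lemma transport_nonneg:
  assumes "transport L a c f p" "f \<in> L1_on L" "0 \<le> c" "0 \<le> f" shows "0 \<le> p"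
  using transport_exists[OF assms(2), of c] transport_unique[OF assms(1)] assms(3,4) by blast

end

section \<open>Repair rates\<close>

lemma integrable_upto_repair_rate:
  assumes "repair_rate L m" "0 < L"
  shows "x < L \<Longrightarrow> integrable_upto x m"
proof -
  fix x assume "x < L"
  show "integrable_upto x m"
  proof (cases "0 < x")
    case True
    then have "set_integrable lebesgue {0..x} m" using assms \<open>x < L\<close> by (auto simp: repair_rate_def)
    then show ?thesis by (rule set_integrable_subset) auto
  qed (simp add: set_integrable_def)
qed

lemma set_borel_measurable_repair_rate:
  assumes "repair_rate L m" "0 < L" shows "set_borel_measurable lebesgue {0<..<L} m"
  by (rule set_borel_measurable_limit[OF integrable_upto_repair_rate[OF assms] assms(2)])

lemma rate_repair_rate:
  assumes m: "repair_rate L m" and L: "0 < L" and k: "0 \<le> k"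
  shows "rate L (\<lambda>s. k + m s)"
proof
  show "0 < L" by fact
  show "0 \<le> k + m s" if "0 < s" "s < L" for s
    using m k that by (auto simp: repair_rate_def)
  have const: "integrable_upto x (\<lambda>s. k)" for x
    by (intro integrable_upto_continuous continuous_intros)
  show "integrable_upto x (\<lambda>s. k + m s)" if "x < L" for x
    by (intro set_integral_add const integrable_upto_repair_rate[OF m L that])
  show "\<not> integrable_upto L (\<lambda>s. k + m s)"
  proof
    assume "integrable_upto L (\<lambda>s. k + m s)"
    from set_integral_diff(1)[OF this const] have mi: "integrable_upto L m" by simp
    \<comment> \<open>The divergence hypothesis is stated on the closed interval and integrability
      on the open one; they differ by two points.\<close>
    have "(\<integral>\<^sup>+x\<in>{0..L}. ennreal (m x) \<partial>lebesgue) = (\<integral>\<^sup>+x. ennreal (indicator {0<..<L} x *\<^sub>R m x) \<partial>lebesgue)"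
    proof (rule nn_integral_cong_AE)
      have "AE x in lebesgue. x \<notin> {0, L}"
        by (rule AE_not_in) (auto intro!: null_sets_completionI)
      then show "AE x in lebesgue. ennreal (m x) * indicator {0..L} x = ennreal (indicator {0<..<L} x *\<^sub>R m x)"
        by eventually_elim (auto simp: indicator_def)
    qed
    also have "\<dots> = ennreal (\<integral>x. indicator {0<..<L} x *\<^sub>R m x \<partial>lebesgue)"
      using mi m unfolding set_integrable_def
      by (intro nn_integral_eq_integral) (auto simp: repair_rate_def indicator_def)
    finally show False using m by (simp add: repair_rate_def)
  qed
qed

section \<open>Density of primitives\<close>

text \<open>Dominated convergence reduced to the choice of one index. It serves both for continuous
  approximations and for cut-offs.\<close>

lemma prim_dominated_approx:
  fixes h :: "nat \<Rightarrow> real \<Rightarrow> real"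
  assumes h: "\<And>n. set_borel_measurable lebesgue {0<..<L} (h n)" and f: "integrable_upto L f"
    and lim: "AE s in lebesgue. s \<in> {0<..<L} \<longrightarrow> (\<lambda>n. h n s) \<longlonglongrightarrow> f s"
    and w: "integrable_upto L w" "\<And>n s. s \<in> {0<..<L} \<Longrightarrow> \<bar>h n s\<bar> \<le> w s" and e: "0 < e"
  shows "\<exists>n. integrable_upto L (h n) \<and> prim (\<lambda>s. \<bar>f s - h n s\<bar>) L < e"
proof -
  let ?r = "\<lambda>g s. indicator {0<..<L} s *\<^sub>R g s :: real"
  have hm: "?r (h n) \<in> borel_measurable lebesgue" for n using h by (simp add: set_borel_measurable_def)
  have fi: "integrable lebesgue (?r f)" and wi: "integrable lebesgue (?r w)"
    using f w(1) by (simp_all add: set_integrable_def)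
  have hi: "integrable_upto L (h n)" for n
    using w(2)[of _ n] by (intro set_integrable_bound[OF w(1) h] AE_I2) force
  have eq: "prim (\<lambda>s. \<bar>f s - h n s\<bar>) L = (\<integral>s. \<bar>?r f s - ?r (h n) s\<bar> \<partial>lebesgue)" for n
    unfolding prim_def set_lebesgue_integral_def
    by (intro Bochner_Integration.integral_cong) (auto simp: indicator_def)
  have "(\<lambda>n. \<integral>s. \<bar>?r f s - ?r (h n) s\<bar> \<partial>lebesgue) \<longlonglongrightarrow> integral\<^sup>L lebesgue (\<lambda>s::real. 0)"
  proof (rule integral_dominated_convergence[where w = "\<lambda>s. \<bar>?r f s\<bar> + ?r w s"])
    show "integrable lebesgue (\<lambda>s. \<bar>?r f s\<bar> + ?r w s)"
      by (intro Bochner_Integration.integrable_add integrable_abs fi wi)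
    show "(\<lambda>s. \<bar>?r f s - ?r (h n) s\<bar>) \<in> borel_measurable lebesgue" for n
      by (intro borel_measurable_abs borel_measurable_diff borel_measurable_integrable[OF fi] hm)
    show "AE s in lebesgue. (\<lambda>n. \<bar>?r f s - ?r (h n) s\<bar>) \<longlonglongrightarrow> 0"
      using lim
    proof eventually_elim
      case (elim s)
      show ?case
      proof (cases "s \<in> {0<..<L}")
        case True
        then have "(\<lambda>n. \<bar>f s - h n s\<bar>) \<longlonglongrightarrow> \<bar>f s - f s\<bar>" using elim by (intro tendsto_intros) auto
        then show ?thesis using True by simp
      qed simp
    qed
    show "AE s in lebesgue. norm \<bar>?r f s - ?r (h n) s\<bar> \<le> \<bar>?r f s\<bar> + ?r w s" for n
    proof (rule AE_I2)
      fix s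
      show "norm \<bar>?r f s - ?r (h n) s\<bar> \<le> \<bar>?r f s\<bar> + ?r w s"
        using w(2)[of s n] by (cases "s \<in> {0<..<L}") auto
    qed
  qed simp
  then have "(\<lambda>n. prim (\<lambda>s. \<bar>f s - h n s\<bar>) L) \<longlonglongrightarrow> 0" by (simp add: eq)
  then have "\<forall>\<^sub>F n in sequentially. prim (\<lambda>s. \<bar>f s - h n s\<bar>) L < e" using e by (rule order_tendstoD)
  from eventually_happens'[OF sequentially_bot this] show ?thesis using hi by blast
qed

lemma prim_abs_triangle:
  assumes "integrable_upto L f" "integrable_upto L g" "integrable_upto L h"
  shows "prim (\<lambda>s. \<bar>f s - h s\<bar>) L \<le> prim (\<lambda>s. \<bar>f s - g s\<bar>) L + prim (\<lambda>s. \<bar>g s - h s\<bar>) L"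
proof -
  have i: "integrable_upto L (\<lambda>s. \<bar>f s - h s\<bar>)" "integrable_upto L (\<lambda>s. \<bar>f s - g s\<bar>)" "integrable_upto L (\<lambda>s. \<bar>g s - h s\<bar>)"
    by (intro set_integrable_abs set_integral_diff assms)+
  have "prim (\<lambda>s. \<bar>f s - h s\<bar>) L \<le> prim (\<lambda>s. \<bar>f s - g s\<bar> + \<bar>g s - h s\<bar>) L"
    unfolding prim_def by (intro set_integral_mono set_integral_add i) auto
  then show ?thesis by (simp add: prim_add i)
qed

lemma continuous_on_real_polynomial: "real_polynomial_function P \<Longrightarrow> continuous_on S P"
  by (intro continuous_at_imp_continuous_on ballI continuous_real_polymonial_function)

text \<open>A bounded measurable function is an almost everywhere limit of continuous ones.
  Truncated at the bound they converge in L^1, and on the compact interval a continuous function is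
  uniformly close to a polynomial.\<close>

lemma polynomial_approx_L1:
  assumes L: "0 < L" and g: "set_borel_measurable lebesgue {0<..<L} g"
    and M: "\<And>s. s \<in> {0<..<L} \<Longrightarrow> \<bar>g s\<bar> \<le> M" and e: "0 < e"
  shows "\<exists>P. real_polynomial_function P \<and> prim (\<lambda>s. \<bar>g s - P s\<bar>) L < e"
proof -
  define g' where "g' s = indicator {0<..<L} s *\<^sub>R g s" for s
  have "g' measurable_on UNIV"
    using g unfolding set_borel_measurable_def g'_def
    by (subst measurable_on_iff_borel_measurable) auto
  then obtain N G where N: "negligible N" and G: "\<And>n. continuous_on UNIV (G n)"
    and lim: "\<And>x. x \<notin> N \<Longrightarrow> (\<lambda>n. G n x) \<longlonglongrightarrow> g' x"
    unfolding measurable_on_def by auto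
  define M' where "M' = \<bar>M\<bar>"
  \<comment> \<open>Clipping at the bound of g leaves the limit unchanged and provides a constant
    majorant.\<close>
  define H where "H n s = max (- M') (min M' (G n s))" for n :: nat and s
  have H: "continuous_on S (H n)" for n S
    unfolding H_def by (intro continuous_intros continuous_on_subset[OF G]) auto
  have H_bd: "\<bar>H n s\<bar> \<le> M'" for n s by (auto simp: H_def M'_def)
  have const: "integrable_upto L (\<lambda>s. c)" for c by (intro integrable_upto_continuous continuous_intros)
  have gi: "integrable_upto L g"
    using M by (intro set_integrable_bound[OF const[of M] g] AE_I2) force
  have "AE s in lebesgue. s \<in> {0<..<L} \<longrightarrow> (\<lambda>n. H n s) \<longlonglongrightarrow> g s"
    using AE_not_in[OF N[unfolded negligible_iff_null_sets]]
  proof eventually_elim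
    case (elim s)
    show ?case
    proof
      assume s: "s \<in> {0<..<L}"
      then have "(\<lambda>n. G n s) \<longlonglongrightarrow> g s" using lim[OF elim] by (simp add: g'_def)
      then have "(\<lambda>n. H n s) \<longlonglongrightarrow> max (- M') (min M' (g s))"
        unfolding H_def by (intro tendsto_intros)
      moreover have "max (- M') (min M' (g s)) = g s" using M[OF s] by (auto simp: M'_def)
      ultimately show "(\<lambda>n. H n s) \<longlonglongrightarrow> g s" by simp
    qed
  qed
  then obtain n where n: "prim (\<lambda>s. \<bar>g s - H n s\<bar>) L < e / 2"
    using prim_dominated_approx[where h = H and e = "e / 2",
        OF set_borel_measurable_integrable[OF integrable_upto_continuous[OF H]] gi _ const[of M']]
      H_bd e by auto
  obtain P where P: "real_polynomial_function P" "\<And>x. x \<in> {0..L} \<Longrightarrow> \<bar>H n x - P x\<bar> < e / (2 * L)"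
    using Stone_Weierstrass_real_polynomial_function[of "{0..L}" "H n" "e / (2 * L)"] H L e by auto
  have Pi: "integrable_upto L P"
    using P(1) by (intro integrable_upto_continuous continuous_on_real_polynomial)
  have Hi: "integrable_upto L (H n)" by (rule integrable_upto_continuous[OF H])
  have "prim (\<lambda>s. \<bar>H n s - P s\<bar>) L \<le> prim (\<lambda>s. e / (2 * L)) L"
    unfolding prim_def
    by (intro set_integral_mono set_integrable_abs set_integral_diff Hi Pi const) (use P(2) in \<open>force intro: less_imp_le\<close>)
  also have "\<dots> = e / 2" using L by (simp add: prim_def set_integral_const)
  finally show ?thesis
    using prim_abs_triangle[OF gi Hi Pi] n P(1) by (intro exI[of _ P]) auto
qed

text \<open>The primitives \<open>E(x) x P(x)\<close> with \<open>P\<close> a polynomial vanish at \<open>0\<close>, are integrable against the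
  rate, and are dense since \<open>E(x) x > 0\<close>.\<close>
lemma (in rate) primitive_dense:
  assumes f: "f \<in> L1_on L" and e: "0 < e"
  shows "\<exists>q g. is_primitive L q 0 g \<and> integrable_upto L (\<lambda>x. a x * rep_l1 q x) \<and> norm (f - q) < e"
proof -
  define v where "v s = E s * s" for s
  have v_pos: "0 < v s" if "s \<in> {0<..<L}" for s using that E_pos by (simp add: v_def)
  have E_le: "E s \<le> 1" if "s < L" for s
    using a_nonneg that by (auto simp: E_def intro!: prim_nonneg AE_I2)
  have v_le: "\<bar>v s\<bar> \<le> L" if "s \<in> {0<..<L}" for s
    using E_le[of s] that mult_mono[of "E s" 1 s L] E_pos[of s] by (auto simp: v_def abs_mult)
  have Em: "set_borel_measurable lebesgue {0<..<L} E"
    by (intro set_borel_measurable_limit integrable_upto_continuous continuous_on_E L_pos)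
  have id: "integrable_upto L (\<lambda>s. s)" by (intro integrable_upto_continuous continuous_intros)
  have vm: "set_borel_measurable lebesgue {0<..<L} v"
    unfolding v_def by (intro set_borel_measurable_times Em set_borel_measurable_integrable[OF id])
  have fm: "set_borel_measurable lebesgue {0<..<L} (rep_l1 f)"
    by (rule set_borel_measurable_integrable[OF integrable_upto_rep])
  \<comment> \<open>Cutting f off where it exceeds n v makes h / v bounded by n, which polynomial
    approximation requires; v > 0 inside the interval makes the cut-offs converge to f.\<close>
  define h where "h n s = (if \<bar>rep_l1 f s\<bar> \<le> real n * v s then rep_l1 f s else 0)" for n :: nat and s
  define h' where "h' n s = h n s / v s" for n s
  have hm: "set_borel_measurable lebesgue {0<..<L} (h n)" "set_borel_measurable lebesgue {0<..<L} (h' n)" for n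
  proof -
    have [measurable]: "(\<lambda>s. indicator {0<..<L} s *\<^sub>R rep_l1 f s) \<in> borel_measurable lebesgue"
      "(\<lambda>s. indicator {0<..<L} s *\<^sub>R v s) \<in> borel_measurable lebesgue"
      using fm vm by (simp_all add: set_borel_measurable_def)
    have "(\<lambda>s. if \<bar>indicator {0<..<L} s *\<^sub>R rep_l1 f s\<bar> \<le> real n * (indicator {0<..<L} s *\<^sub>R v s)
      then indicator {0<..<L} s *\<^sub>R rep_l1 f s else 0) \<in> borel_measurable lebesgue" by measurable
    also have "(\<lambda>s. if \<bar>indicator {0<..<L} s *\<^sub>R rep_l1 f s\<bar> \<le> real n * (indicator {0<..<L} s *\<^sub>R v s)
      then indicator {0<..<L} s *\<^sub>R rep_l1 f s else 0) = (\<lambda>s. indicator {0<..<L} s *\<^sub>R h n s)"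
      by (auto simp: h_def indicator_def)
    finally show hm: "set_borel_measurable lebesgue {0<..<L} (h n)" unfolding set_borel_measurable_def .
    then have [measurable]: "(\<lambda>s. indicator {0<..<L} s *\<^sub>R h n s) \<in> borel_measurable lebesgue"
      by (simp add: set_borel_measurable_def)
    have "(\<lambda>s. (indicator {0<..<L} s *\<^sub>R h n s) / (indicator {0<..<L} s *\<^sub>R v s)) \<in> borel_measurable lebesgue"
      by measurable
    also have "(\<lambda>s. (indicator {0<..<L} s *\<^sub>R h n s) / (indicator {0<..<L} s *\<^sub>R v s)) = (\<lambda>s. indicator {0<..<L} s *\<^sub>R h' n s)"
      by (auto simp: h'_def indicator_def)
    finally show "set_borel_measurable lebesgue {0<..<L} (h' n)" unfolding set_borel_measurable_def .
  qed
  have lim: "(\<lambda>n. h n s) \<longlonglongrightarrow> rep_l1 f s" if s: "s \<in> {0<..<L}" for s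
  proof (rule tendsto_eventually)
    obtain m :: nat where m: "\<bar>rep_l1 f s\<bar> / v s < m" using reals_Archimedean2 by blast
    have "h n s = rep_l1 f s" if "m \<le> n" for n
    proof -
      have "\<bar>rep_l1 f s\<bar> / v s \<le> n" using m that by (meson less_imp_le of_nat_le_iff order_trans)
      then show ?thesis using v_pos[OF s] by (simp add: h_def pos_divide_le_eq)
    qed
    then show "\<forall>\<^sub>F n in sequentially. h n s = rep_l1 f s" by (rule eventually_sequentiallyI)
  qed
  have "\<exists>n. integrable_upto L (h n) \<and> prim (\<lambda>s. \<bar>rep_l1 f s - h n s\<bar>) L < e / 2"
    by (rule prim_dominated_approx[OF hm(1) integrable_upto_rep _ set_integrable_abs[OF integrable_upto_rep[of _ f]]])
       (use lim e in \<open>auto simp: h_def\<close>)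
  then obtain n where n: "integrable_upto L (h n)" "prim (\<lambda>s. \<bar>rep_l1 f s - h n s\<bar>) L < e / 2" by blast
  have "\<bar>h' n s\<bar> \<le> n" if "s \<in> {0<..<L}" for s
    using v_pos[OF that] by (auto simp: h'_def h_def abs_divide pos_divide_le_eq)
  \<comment> \<open>The tolerance e / (2 L) becomes e / 2 after multiplication by v, since |v| \<le>
    L.\<close>
  then obtain P where P: "real_polynomial_function P" "prim (\<lambda>s. \<bar>h' n s - P s\<bar>) L < e / (2 * L)"
    using polynomial_approx_L1[OF L_pos hm(2), of n "n" "e / (2 * L)"] e L_pos by auto
  obtain P' where P': "real_polynomial_function P'" "\<And>x. (P has_real_derivative P' x) (at x)"
    using has_real_derivative_polynomial_function[OF P(1)] by blast
  define w where "w s = s * P s" for s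
  define w' where "w' s = P s + s * P' s" for s
  have cont: "continuous_on S w" "continuous_on S w'" for S
    unfolding w_def w'_def
    by (intro continuous_intros continuous_on_real_polynomial P(1) P'(1))+
  have w: "w x = 0 + prim w' x" if "0 \<le> x" for x
  proof -
    have "(w has_real_derivative w' s) (at s within {0..x})" for s
      using has_field_derivative_at_within[OF DERIV_mult[OF DERIV_ident P'(2)[of s]], of "{0..x}"]
      unfolding w_def w'_def by (simp add: mult.commute add.commute)
    then have "(w' has_integral w x - w 0) {0..x}"
      using that by (intro fundamental_theorem_of_calculus)
        (auto simp: has_real_derivative_iff_has_vector_derivative[symmetric])
    moreover have "prim w' x = integral {0..x} w'"
      by (intro prim_eq_integral[of x] integrable_upto_continuous cont) auto
    ultimately show ?thesis by (simp add: integral_unique w_def)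
  qed
  \<comment> \<open>\<open>E\<close> is \<open>sol\<close> with c = 1 and f = 0, so a E is
    integrable up to L although a is not.\<close>
  have aE: "integrable_upto L (\<lambda>s. - (a s * E s))"
    using set_integrable_mult_right[of "-1", OF integrable_a_sol_L[of "\<lambda>_. 0" 1]] by (simp add: sol_def prim_def)
  have E: "E x = 1 + prim (\<lambda>s. - (a s * E s)) x" if "0 \<le> x" "x < L" for x
    using sol_eq[of "\<lambda>_. 0" x 1] that by (simp add: sol_def prim_def)
  \<comment> \<open>The derivative of E w by the product rule; E w is the approximating function and
    w(0) = 0 its boundary value.\<close>
  define k where "k s = - (a s * E s) * w s + E s * w' s" for s
  have Ew: "integrable_upto L (\<lambda>s. E s * F s)" if "continuous_on {0..L} F" for F
    using E_pos E_le
    by (intro set_integrable_bound[OF integrable_upto_continuous[OF that]] set_borel_measurable_times Em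
        set_borel_measurable_integrable[OF integrable_upto_continuous[OF that]] AE_I2)
      (auto simp: abs_mult less_imp_le intro!: mult_left_le_one_le)
  have ki: "integrable_upto L k"
    unfolding k_def
    using integrable_upto_mult_continuous[OF aE cont(1)] Ew[OF cont(2)]
    by (intro set_integral_add) (simp_all add: mult.commute)
  have Ew_eq: "E x * w x = 0 + prim k x" if x: "0 \<le> x" "x < L" for x
    using mult_prim(2)[where F = E and c = 1, OF integrable_upto_mono[OF aE] integrable_upto_continuous[OF cont(2)] _ w x(1)] E x
    unfolding k_def by simp
  have Ewi: "integrable_upto L (\<lambda>s. E s * w s)" by (rule Ew[OF cont(1)])
  define q where "q = class_on L (\<lambda>s. E s * w s)"
  have q: "AE s in lebesgue. s \<in> {0<..<L} \<longrightarrow> rep_l1 q s = E s * w s"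
    unfolding q_def using rep_class_on[OF Ewi] by eventually_elim simp
  have kr: "AE s in lebesgue. s \<in> {0<..<L} \<longrightarrow> rep_l1 (class_on L k) s = k s"
    using rep_class_on[OF ki] by eventually_elim simp
  have "prim (rep_l1 (class_on L k)) x = prim k x" if "x < L" for x
    using kr that by (intro prim_cong_AE integrable_upto_rep integrable_upto_mono[OF ki]) (auto elim!: eventually_mono)
  then have "is_primitive L q 0 (class_on L k)"
    unfolding is_primitive_def q_def[symmetric] using q
    by (auto simp: Ew_eq q_def elim!: eventually_mono intro!: class_on_in_L1_on Ewi ki)
  moreover have "integrable_upto L (\<lambda>x. a x * rep_l1 q x)"
  proof (rule set_integrable_AE_eq[OF _ set_borel_measurable_mult_rep[OF measurable_a]])
    show "integrable_upto L (\<lambda>s. (- w s) * - (a s * E s))"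
      by (intro integrable_upto_mult_continuous aE continuous_on_minus cont)
    show "AE x in lebesgue. x \<in> {0<..<L} \<longrightarrow> a x * rep_l1 q x = (- w x) * - (a x * E x)"
      using q by eventually_elim simp
  qed
  moreover have "norm (f - q) < e"
  proof -
    have "norm (f - q) = prim (\<lambda>s. \<bar>rep_l1 f s - E s * w s\<bar>) L"
      unfolding prim_def
    proof (rule norm_L1_on_AE)
      show "f - q \<in> L1_on L" unfolding q_def by (intro subspace_diff[OF subspace_L1_on] f class_on_in_L1_on Ewi)
      show "integrable_upto L (\<lambda>s. rep_l1 f s - E s * w s)" by (intro set_integral_diff integrable_upto_rep Ewi)
      show "AE s in lebesgue. s \<in> {0<..<L} \<longrightarrow> rep_l1 (f - q) s = rep_l1 f s - E s * w s"
        using q rep_diff_l1[of f q] by eventually_elim simp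
    qed
    also have "\<dots> \<le> prim (\<lambda>s. \<bar>rep_l1 f s - h n s\<bar>) L + prim (\<lambda>s. \<bar>h n s - E s * w s\<bar>) L"
      by (intro prim_abs_triangle integrable_upto_rep n Ewi)
    also have "prim (\<lambda>s. \<bar>h n s - E s * w s\<bar>) L \<le> prim (\<lambda>s. L * \<bar>h' n s - P s\<bar>) L"
    proof -
      have h'i: "integrable_upto L (\<lambda>s. L * \<bar>h' n s - P s\<bar>)"
        using \<open>\<And>s. s \<in> {0<..<L} \<Longrightarrow> \<bar>h' n s\<bar> \<le> n\<close> P(1)
        by (intro set_integrable_mult_right set_integrable_abs set_integral_diff
            integrable_upto_continuous continuous_on_real_polynomial
            set_integrable_bound[OF integrable_upto_continuous[OF continuous_on_const[of _ "real n"]] hm(2)] AE_I2) auto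
      have "\<bar>h n s - E s * w s\<bar> \<le> L * \<bar>h' n s - P s\<bar>" if "s \<in> {0<..<L}" for s
      proof -
        have "h n s - E s * w s = v s * (h' n s - P s)"
          using v_pos[OF that] that by (simp add: h'_def w_def v_def algebra_simps)
        then show ?thesis using v_le[OF that] by (simp add: abs_mult mult_right_mono)
      qed
      then show ?thesis
        unfolding prim_def by (intro set_integral_mono h'i set_integrable_abs set_integral_diff n Ewi)
    qed
    also have "\<dots> < e / 2" using P(2) L_pos by (simp add: prim_cmult field_simps)
    finally show ?thesis using n(2) by simp
  qed
  ultimately show ?thesis by blast
qed

section \<open>The repairable system\<close>

lemma l1_pos_neg_parts:
  assumes f: "f \<in> L1_on L"
  obtains p n where "p \<in> L1_on L" "n \<in> L1_on L" "0 \<le> p" "0 \<le> n" "f = p - n" "norm f = lint p + lint n"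
proof
  define p where "p = class_on L (\<lambda>x. max 0 (rep_l1 f x))"
  define n where "n = class_on L (\<lambda>x. max 0 (- rep_l1 f x))"
  have abs: "integrable_upto L (\<lambda>x. \<bar>rep_l1 f x\<bar>)" by (intro set_integrable_abs integrable_upto_rep)
  have "integrable_upto L (\<lambda>x. (rep_l1 f x + \<bar>rep_l1 f x\<bar>) / 2)" "integrable_upto L (\<lambda>x. (\<bar>rep_l1 f x\<bar> - rep_l1 f x) / 2)"
    by (intro set_integrable_divide set_integral_add set_integral_diff abs integrable_upto_rep)+
  moreover have "(\<lambda>x. (rep_l1 f x + \<bar>rep_l1 f x\<bar>) / 2) = (\<lambda>x. max 0 (rep_l1 f x))"
    "(\<lambda>x. (\<bar>rep_l1 f x\<bar> - rep_l1 f x) / 2) = (\<lambda>x. max 0 (- rep_l1 f x))"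
    by (auto simp: max_def abs_if)
  ultimately have i: "integrable_upto L (\<lambda>x. max 0 (rep_l1 f x))" "integrable_upto L (\<lambda>x. max 0 (- rep_l1 f x))"
    by simp_all
  show pn: "p \<in> L1_on L" "n \<in> L1_on L" unfolding p_def n_def by (intro class_on_in_L1_on i)+
  show "0 \<le> p" "0 \<le> n" unfolding p_def n_def by (intro nonneg_class_on i AE_I2; simp)+
  show "f = p - n"
  proof (rule L1_on_eqI[OF f subspace_diff[OF subspace_L1_on pn]])
    show "AE x in lebesgue. x \<in> {0<..<L} \<longrightarrow> rep_l1 f x = rep_l1 (p - n) x"
      using rep_diff_l1[of p n] rep_class_on[OF i(1), folded p_def] rep_class_on[OF i(2), folded n_def]
      by eventually_elim auto
  qed
  have "norm f = prim (\<lambda>x. \<bar>rep_l1 f x\<bar>) L"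
    unfolding prim_def by (rule norm_L1_on_AE[OF f integrable_upto_rep]) simp
  also have "\<dots> = prim (\<lambda>x. max 0 (rep_l1 f x) + max 0 (- rep_l1 f x)) L"
    by (intro prim_cong) auto
  also have "\<dots> = lint p + lint n"
    unfolding p_def n_def lint_class_on[OF i(1)] lint_class_on[OF i(2)] prim_add[OF i] by (simp add: prim_def)
  finally show "norm f = lint p + lint n" .
qed

text \<open>The linear functional that coincides with \<open>state_norm\<close> on the positive
  cone, the total probability of a state.\<close>

definition mass :: "state \<Rightarrow> real" where
  "mass = (\<lambda>(p0, p1, p2). p0 + lint p1 + lint p2)"

lemma linear_mass: "linear mass"
  by (rule linearI) (auto simp: mass_def lint_add lint_scaleR algebra_simps)

lemmas mass_diff = linear_diff[OF linear_mass]
  and mass_scaleR = linear_cmul[OF linear_mass]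

section \<open>Norm and order of the state space\<close>

lemma nonneg_state_iff: "(0 :: state) \<le> (p0, p1, p2) \<longleftrightarrow> 0 \<le> p0 \<and> 0 \<le> p1 \<and> 0 \<le> p2"
  by (simp add: less_eq_prod_def zero_prod_def)

lemma state_norm_nonneg_eq_mass: "0 \<le> p \<Longrightarrow> state_norm p = mass p"
  by (cases p) (auto simp: nonneg_state_iff state_norm_def mass_def nonneg_l1_iff)

lemma state_norm_triangle: "state_norm (p + q) \<le> state_norm p + state_norm q"
proof -
  obtain p0 p1 p2 q0 q1 q2 where [simp]: "p = (p0, p1, p2)" "q = (q0, q1, q2)"
    by (metis prod.exhaust)
  show ?thesis
    using norm_triangle_ineq[of p1 q1] norm_triangle_ineq[of p2 q2] by (simp add: state_norm_def)
qed

lemma state_norm_scaleR: "state_norm (c *\<^sub>R p) = \<bar>c\<bar> * state_norm p"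
  by (cases p) (simp add: state_norm_def abs_mult algebra_simps)

lemma norm_le_state_norm: "norm p \<le> state_norm p"
proof -
  obtain p0 p1 p2 where [simp]: "p = (p0, p1, p2)" by (metis prod.exhaust)
  show ?thesis using norm_Pair_le[of p0 "(p1, p2)"] norm_Pair_le[of p1 p2] by (simp add: state_norm_def)
qed

text \<open>Each of the three components is bounded by the ambient product norm, whence the constant
  3.\<close>

lemma state_norm_le_norm: "state_norm p \<le> 3 * norm p"
proof -
  obtain p0 p1 p2 where [simp]: "p = (p0, p1, p2)" by (metis prod.exhaust)
  show ?thesis
    using norm_fst_le[of p0 "(p1, p2)"] norm_snd_le[of "(p1, p2)" p0] norm_fst_le[of p1 p2] norm_snd_le[of p2 p1]
    by (simp add: state_norm_def)
qed

lemma subspace_state_space: "subspace (state_space L)"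
  unfolding state_space_def by (intro subspace_Times subspace_UNIV subspace_L1_on)

lemma closed_state_space: "closed (state_space L)"
  unfolding state_space_def by (intro closed_Times closed_UNIV closed_L1_on)

lemma closed_nonneg_state: "closed {p :: state. 0 \<le> p}"
proof -
  have "{p :: state. 0 \<le> p} = {0..} \<times> {f. 0 \<le> f} \<times> {f. 0 \<le> f}"
    by (auto simp: nonneg_state_iff)
  then show ?thesis by (simp add: closed_Times closed_nonneg_l1)
qed

locale repairable_system =
  fixes L lam1 lam2 :: real and mu1 mu2 :: "real \<Rightarrow> real"
  assumes L: "0 < L" and lam1: "0 < lam1" and lam2: "0 < lam2"
    and mu1: "repair_rate L mu1" and mu2: "repair_rate L mu2"
begin

abbreviation "V \<equiv> state_space L"
abbreviation "D \<equiv> sys_domain L lam1 lam2 mu1 mu2"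
abbreviation "A \<equiv> sys_operator L lam1 lam2 mu1 mu2"

lemmas rate1 = rate_repair_rate[OF mu1 L] and rate2 = rate_repair_rate[OF mu2 L]

lemma measurable_mu: "set_borel_measurable lebesgue {0<..<L} mu1" "set_borel_measurable lebesgue {0<..<L} mu2"
  by (intro set_borel_measurable_repair_rate mu1 mu2 L)+

text \<open>Domain membership with the weak derivatives as explicit witnesses, so that the operator
  becomes an algebraic expression in g1 and g2.\<close>

definition dom_data :: "state \<Rightarrow> l1 \<Rightarrow> l1 \<Rightarrow> bool" where
  "dom_data = (\<lambda>(p0, p1, p2) g1 g2. is_primitive L p1 (lam1 * p0) g1 \<and>
     is_primitive L p2 (lam2 * p0 + lam2 * lint p1) g2 \<and>
     integrable_upto L (\<lambda>x. mu1 x * rep_l1 p1 x) \<and> integrable_upto L (\<lambda>x. mu2 x * rep_l1 p2 x))"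

section \<open>Linearity and mass balance of the operator\<close>

lemma dom_iff: "p \<in> D \<longleftrightarrow> (\<exists>g1 g2. dom_data p g1 g2)"
proof -
  obtain p0 p1 p2 where p [simp]: "p = (p0, p1, p2)" by (metis prod.exhaust)
  have "p \<in> D \<longleftrightarrow> p1 \<in> L1_on L \<and> p2 \<in> L1_on L \<and> (\<exists>c g. is_primitive L p1 c g) \<and> (\<exists>c g. is_primitive L p2 c g) \<and>
      integrable_upto L (\<lambda>x. mu1 x * rep_l1 p1 x) \<and> integrable_upto L (\<lambda>x. mu2 x * rep_l1 p2 x) \<and>
      value_at_0 L p1 = lam1 * p0 \<and> value_at_0 L p2 = lam2 * p0 + lam2 * lint p1"
    by (auto simp: sys_domain_def state_space_def W11_iff[OF L] lint_L1_on)
  also have "\<dots> \<longleftrightarrow> (\<exists>g1 g2. dom_data p g1 g2)"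
    using value_at_0_eq[OF L] unfolding dom_data_def p prod.case
    by (smt (verit, ccfv_threshold) is_primitive_def)
  finally show ?thesis .
qed

lemma dom_data_A:
  assumes "dom_data (p0, p1, p2) g1 g2"
  shows "A (p0, p1, p2) = (- (lam1 + lam2) * p0 + lint (mult_class L mu1 p1) + lint (mult_class L mu2 p2),
    - g1 - (lam2 *\<^sub>R p1 + mult_class L mu1 p1), - g2 - mult_class L mu2 p2)"
proof -
  have p: "is_primitive L p1 (lam1 * p0) g1" "is_primitive L p2 (lam2 * p0 + lam2 * lint p1) g2"
    "integrable_upto L (\<lambda>x. mu1 x * rep_l1 p1 x)" "integrable_upto L (\<lambda>x. mu2 x * rep_l1 p2 x)"
    "p1 \<in> L1_on L"
    using assms by (auto simp: dom_data_def is_primitive_def)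
  have "class_on L (\<lambda>x. (mu1 x + lam2) * rep_l1 p1 x) = mult_class L (\<lambda>x. lam2 + mu1 x) p1"
    by (simp add: mult_class_def add.commute)
  also have "\<dots> = lam2 *\<^sub>R p1 + mult_class L mu1 p1" by (rule mult_class_shift(2)[OF p(5,3)])
  finally show ?thesis
    using lint_mult_class[OF p(3)] lint_mult_class[OF p(4)]
    by (simp add: sys_operator_def weak_deriv_eq[OF L p(1)] weak_deriv_eq[OF L p(2)] prim_def mult_class_def)
qed

lemma dom_data_add:
  assumes "dom_data p g1 g2" "dom_data q h1 h2"
  shows "dom_data (p + q) (g1 + h1) (g2 + h2)" "A (p + q) = A p + A q"
proof -
  obtain p0 p1 p2 q0 q1 q2 where [simp]: "p = (p0, p1, p2)" "q = (q0, q1, q2)"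
    by (metis prod.exhaust)
  have pq: "integrable_upto L (\<lambda>x. mu1 x * rep_l1 p1 x)" "integrable_upto L (\<lambda>x. mu2 x * rep_l1 p2 x)"
    "integrable_upto L (\<lambda>x. mu1 x * rep_l1 q1 x)" "integrable_upto L (\<lambda>x. mu2 x * rep_l1 q2 x)"
    using assms by (auto simp: dom_data_def)
  note m = mult_class_add[OF measurable_mu(1) pq(1,3)] mult_class_add[OF measurable_mu(2) pq(2,4)]
  show d: "dom_data (p + q) (g1 + h1) (g2 + h2)"
    using assms is_primitive_add[of L p1 "lam1 * p0" g1 q1 "lam1 * q0" h1]
      is_primitive_add[of L p2 "lam2 * p0 + lam2 * lint p1" g2 q2 "lam2 * q0 + lam2 * lint q1" h2] m
    by (simp add: dom_data_def lint_add algebra_simps)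
  show "A (p + q) = A p + A q"
    using dom_data_A[of p0 p1 p2 g1 g2] dom_data_A[of q0 q1 q2 h1 h2] dom_data_A[of "p0 + q0" "p1 + q1" "p2 + q2"] d assms
    by (simp add: m lint_add scaleR_add_right algebra_simps)
qed

lemma dom_data_scaleR:
  assumes "dom_data p g1 g2"
  shows "dom_data (c *\<^sub>R p) (c *\<^sub>R g1) (c *\<^sub>R g2)" "A (c *\<^sub>R p) = c *\<^sub>R A p"
proof -
  obtain p0 p1 p2 where [simp]: "p = (p0, p1, p2)" by (metis prod.exhaust)
  have p: "integrable_upto L (\<lambda>x. mu1 x * rep_l1 p1 x)" "integrable_upto L (\<lambda>x. mu2 x * rep_l1 p2 x)"
    using assms by (auto simp: dom_data_def)
  note m = mult_class_scaleR[OF measurable_mu(1) p(1)] mult_class_scaleR[OF measurable_mu(2) p(2)]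
  show d: "dom_data (c *\<^sub>R p) (c *\<^sub>R g1) (c *\<^sub>R g2)"
    using assms is_primitive_scaleR[of L p1 "lam1 * p0" g1 c]
      is_primitive_scaleR[of L p2 "lam2 * p0 + lam2 * lint p1" g2 c] m
    by (simp add: dom_data_def lint_scaleR algebra_simps)
  show "A (c *\<^sub>R p) = c *\<^sub>R A p"
    using dom_data_A[of p0 p1 p2 g1 g2] dom_data_A[of "c * p0" "c *\<^sub>R p1" "c *\<^sub>R p2"] d assms
    by (simp add: m lint_scaleR algebra_simps)
qed

lemma dom_data_L1_on:
  assumes "dom_data (p0, p1, p2) g1 g2"
  shows "p1 \<in> L1_on L" "p2 \<in> L1_on L" "g1 \<in> L1_on L" "g2 \<in> L1_on L"
    "mult_class L mu1 p1 \<in> L1_on L" "mult_class L mu2 p2 \<in> L1_on L"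
  using assms by (auto simp: dom_data_def is_primitive_def intro: mult_class_in_L1_on)

lemma D_subset_V: "D \<subseteq> V"
  by (auto simp: sys_domain_def)

lemma subspace_dom: "subspace D"
proof (rule subspaceI)
  have "is_primitive L 0 0 0"
    unfolding is_primitive_def
  proof (intro conjI)
    have "prim (rep_l1 0) x = 0" for x
    proof -
      have "prim (rep_l1 0) x = prim (\<lambda>_. 0) x"
        using rep_zero_l1 by (intro prim_cong_AE integrable_upto_rep) (auto simp: set_integrable_def elim: eventually_mono)
      then show ?thesis by (simp add: prim_def)
    qed
    then show "AE x in lebesgue. x \<in> {0<..<L} \<longrightarrow> rep_l1 0 x = 0 + prim (rep_l1 0) x"
      using rep_zero_l1 by auto
  qed (rule subspace_0[OF subspace_L1_on])+
  moreover have "integrable_upto L (\<lambda>x. m x * rep_l1 0 x)" if "set_borel_measurable lebesgue {0<..<L} m" for m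
    using rep_zero_l1
    by (intro set_integrable_AE_eq[OF _ set_borel_measurable_mult_rep[OF that], of "\<lambda>_. 0"])
       (auto simp: set_integrable_def)
  ultimately have "dom_data 0 0 0"
    using measurable_mu by (simp add: dom_data_def zero_prod_def lint_zero)
  then show "0 \<in> D" using dom_iff by blast
  show "p + q \<in> D" if "p \<in> D" "q \<in> D" for p q
    using that dom_data_add(1) dom_iff by meson
  show "c *\<^sub>R p \<in> D" if "p \<in> D" for p c
    using that dom_data_scaleR(1) dom_iff by meson
qed

lemma A_in_V: "p \<in> D \<Longrightarrow> A p \<in> V"
proof -
  assume "p \<in> D"
  moreover obtain p0 p1 p2 where p: "p = (p0, p1, p2)" by (metis prod.exhaust)
  ultimately obtain g1 g2 where d: "dom_data (p0, p1, p2) g1 g2" using dom_iff by blast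
  note s = subspace_diff[OF subspace_L1_on] subspace_neg[OF subspace_L1_on] subspace_add[OF subspace_L1_on]
    subspace_scale[OF subspace_L1_on]
  show "A p \<in> V" unfolding p dom_data_A[OF d] state_space_def
    by (auto intro!: s dom_data_L1_on[OF d])
qed

text \<open>By \<open>is_primitive_end\<close> the integrals of - p_1' and - p_2' are the boundary
  values, that is lam1 p_0 and lam2 p_0 + lam2 int p_1. These offset the losses (lam1 + lam2) p_0
  and lam2 int p_1, while the repair terms leave p_1 and p_2 and enter p_0.\<close>

lemma mass_A: "p \<in> D \<Longrightarrow> mass (A p) = 0"
proof -
  assume "p \<in> D"
  moreover obtain p0 p1 p2 where p: "p = (p0, p1, p2)" by (metis prod.exhaust)
  ultimately obtain g1 g2 where d: "dom_data (p0, p1, p2) g1 g2" using dom_iff by blast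
  interpret r1: rate L "\<lambda>s. 0 + mu1 s" by (rule rate1) simp
  interpret r2: rate L "\<lambda>s. 0 + mu2 s" by (rule rate2) simp
  have "lint g1 = - (lam1 * p0)" "lint g2 = - (lam2 * p0 + lam2 * lint p1)"
    using d r1.is_primitive_end[of p1 "lam1 * p0" g1] r2.is_primitive_end[of p2 "lam2 * p0 + lam2 * lint p1" g2]
    by (auto simp: dom_data_def)
  then show "mass (A p) = 0"
    unfolding p dom_data_A[OF d] by (simp add: mass_def lint_diff lint_minus lint_add lint_scaleR algebra_simps)
qed

text \<open>The resolvent equation, with the balance equation for \<open>p\<^sub>0\<close> traded for conservation of mass.\<close>
lemma resolvent_iff:
  assumes h: "0 < h" and f: "(f0, f1, f2) \<in> V"
  defines "k \<equiv> 1 / h"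
  shows "(p0, p1, p2) \<in> D \<and> (p0, p1, p2) - h *\<^sub>R A (p0, p1, p2) = (f0, f1, f2) \<longleftrightarrow>
    transport L (\<lambda>x. (k + lam2) + mu1 x) (lam1 * p0) (k *\<^sub>R f1) p1 \<and>
    transport L (\<lambda>x. k + mu2 x) (lam2 * p0 + lam2 * lint p1) (k *\<^sub>R f2) p2 \<and>
    mass (p0, p1, p2) = mass (f0, f1, f2)"
proof -
  have k: "k * h = 1" using h by (simp add: k_def)
  have scale: "h *\<^sub>R x = y \<longleftrightarrow> x = k *\<^sub>R y" for x y :: l1
    using h by (auto simp: k_def)
  have eq1: "p1 - h *\<^sub>R (- g1 - (lam2 *\<^sub>R p1 + m)) = f1 \<longleftrightarrow> g1 = k *\<^sub>R f1 - ((k + lam2) *\<^sub>R p1 + m)" for g1 m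
  proof -
    have "p1 - h *\<^sub>R (- g1 - (lam2 *\<^sub>R p1 + m)) = f1 \<longleftrightarrow> h *\<^sub>R (g1 + lam2 *\<^sub>R p1 + m) = f1 - p1"
      by (auto simp: algebra_simps)
    also have "\<dots> \<longleftrightarrow> g1 + lam2 *\<^sub>R p1 + m = k *\<^sub>R (f1 - p1)" by (rule scale)
    also have "\<dots> \<longleftrightarrow> g1 = k *\<^sub>R f1 - ((k + lam2) *\<^sub>R p1 + m)" by (auto simp: algebra_simps)
    finally show ?thesis .
  qed
  have eq2: "p2 - h *\<^sub>R (- g2 - m) = f2 \<longleftrightarrow> g2 = k *\<^sub>R f2 - (k *\<^sub>R p2 + m)" for g2 m
  proof -
    have "p2 - h *\<^sub>R (- g2 - m) = f2 \<longleftrightarrow> h *\<^sub>R (g2 + m) = f2 - p2"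
      by (auto simp: algebra_simps)
    also have "\<dots> \<longleftrightarrow> g2 + m = k *\<^sub>R (f2 - p2)" by (rule scale)
    also have "\<dots> \<longleftrightarrow> g2 = k *\<^sub>R f2 - (k *\<^sub>R p2 + m)" by (auto simp: algebra_simps)
    finally show ?thesis .
  qed
  let ?a1 = "\<lambda>x. (k + lam2) + mu1 x" and ?a2 = "\<lambda>x. k + mu2 x"
  show ?thesis (is "?l \<longleftrightarrow> ?r")
  proof
    assume l: ?l
    then obtain g1 g2 where d: "dom_data (p0, p1, p2) g1 g2" using dom_iff by blast
    note in_L1 = dom_data_L1_on[OF d]
    have i: "integrable_upto L (\<lambda>x. mu1 x * rep_l1 p1 x)" "integrable_upto L (\<lambda>x. mu2 x * rep_l1 p2 x)"
      using d by (auto simp: dom_data_def)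
    have "g1 = k *\<^sub>R f1 - mult_class L ?a1 p1" "g2 = k *\<^sub>R f2 - mult_class L ?a2 p2"
      using l eq1[of g1 "mult_class L mu1 p1"] eq2[of g2 "mult_class L mu2 p2"]
      unfolding mult_class_shift(2)[OF in_L1(1) i(1)] mult_class_shift(2)[OF in_L1(2) i(2)] dom_data_A[OF d]
      by simp_all
    moreover have "mass (f0, f1, f2) = mass (p0, p1, p2)"
      using l mass_A[of "(p0, p1, p2)"] mass_diff[of "(p0, p1, p2)" "h *\<^sub>R A (p0, p1, p2)"] by (simp add: mass_scaleR)
    ultimately show ?r
      using d i mult_class_shift(1)[OF in_L1(1)] mult_class_shift(1)[OF in_L1(2)]
      by (auto simp: dom_data_def transport_def)
  next
    assume r: ?r
    define g1 g2 where "g1 = k *\<^sub>R f1 - mult_class L ?a1 p1" and "g2 = k *\<^sub>R f2 - mult_class L ?a2 p2"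
    have in_L1: "p1 \<in> L1_on L" "p2 \<in> L1_on L" using r by (auto simp: transport_def is_primitive_def)
    have i: "integrable_upto L (\<lambda>x. mu1 x * rep_l1 p1 x)" "integrable_upto L (\<lambda>x. mu2 x * rep_l1 p2 x)"
      using r mult_class_shift(1)[OF in_L1(1)] mult_class_shift(1)[OF in_L1(2)] by (auto simp: transport_def)
    have d: "dom_data (p0, p1, p2) g1 g2"
      using r i by (auto simp: dom_data_def transport_def g1_def g2_def)
    then have D: "(p0, p1, p2) \<in> D" using dom_iff by blast
    have "g1 = k *\<^sub>R f1 - ((k + lam2) *\<^sub>R p1 + mult_class L mu1 p1)" "g2 = k *\<^sub>R f2 - (k *\<^sub>R p2 + mult_class L mu2 p2)"
      unfolding g1_def g2_def by (simp_all only: mult_class_shift(2)[OF in_L1(1) i(1)] mult_class_shift(2)[OF in_L1(2) i(2)])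
    then obtain q0 where q0: "(p0, p1, p2) - h *\<^sub>R A (p0, p1, p2) = (q0, f1, f2)"
      using eq1[of g1 "mult_class L mu1 p1"] eq2[of g2 "mult_class L mu2 p2"] unfolding dom_data_A[OF d] by simp
    \<comment> \<open>The transport equations settle only the last two components; equality of
      masses then identifies the first one as f0.\<close>
    have "mass (q0, f1, f2) = mass (p0, p1, p2)"
      unfolding q0[symmetric] using mass_A[OF D] by (simp only: mass_diff mass_scaleR) simp
    then have "q0 = f0" using r by (simp add: mass_def)
    then show ?l using D q0 by simp
  qed
qed

text \<open>By \<open>transport_mass\<close> the total input c + int f equals the total absorption k
  int p + int m p, whose second term is nonnegative.\<close>

lemma resolvent_mass_bound:
  assumes m: "repair_rate L m" and k: "0 < k" and p: "transport L (\<lambda>x. k + m x) c f p"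
    and "0 \<le> p" "0 \<le> c" "0 \<le> f" "f \<in> L1_on L"
  shows "k * lint p \<le> c + lint f"
proof -
  interpret rate L "\<lambda>x. k + m x" by (rule rate_repair_rate[OF m L]) (use k in simp)
  have pL: "p \<in> L1_on L" using p by (auto simp: transport_def is_primitive_def)
  then have i: "integrable_upto L (\<lambda>x. m x * rep_l1 p x)"
    using p mult_class_shift(1)[OF pL, of k m] by (simp add: transport_def)
  have "c + lint f = k * lint p + lint (mult_class L m p)"
    using transport_mass[OF p] mult_class_shift(2)[OF pL i, of k] by (simp add: lint_add lint_scaleR)
  moreover have "0 \<le> mult_class L m p"
    unfolding mult_class_def using m \<open>0 \<le> p\<close>[unfolded nonneg_l1_rep]
    by (intro nonneg_class_on i) (auto simp: repair_rate_def elim!: eventually_mono)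
  ultimately show ?thesis using lint_nonneg by force
qed

text \<open>Superposition: q_i solves with source k f_i and zero boundary value, e_i with zero
  source and boundary value 1. Hence p_1 and p_2 are affine in p_0, and conservation of mass becomes
  p_0 \<Delta> = r.\<close>

lemma resolvent_exists:
  assumes h: "0 < h" and f: "f \<in> V"
  shows "\<exists>p\<in>D. p - h *\<^sub>R A p = f"
    and "p \<in> D \<Longrightarrow> p - h *\<^sub>R A p = f \<Longrightarrow> 0 \<le> f \<Longrightarrow> 0 \<le> p"
proof -
  obtain f0 f1 f2 where f_eq: "f = (f0, f1, f2)" by (metis prod.exhaust)
  note fV = f[unfolded f_eq]
  have fL: "f1 \<in> L1_on L" "f2 \<in> L1_on L" using fV by (auto simp: state_space_def)
  define k where "k = 1 / h"
  have k: "0 < k" using h by (simp add: k_def)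
  let ?a1 = "\<lambda>x. (k + lam2) + mu1 x" and ?a2 = "\<lambda>x. k + mu2 x"
  interpret r1: rate L ?a1 by (rule rate1) (use k lam2 in simp)
  interpret r2: rate L ?a2 by (rule rate2) (use k in simp)
  note res = resolvent_iff[OF h fV, folded k_def]
  have kfL: "k *\<^sub>R f1 \<in> L1_on L" "k *\<^sub>R f2 \<in> L1_on L" "0 \<in> L1_on L"
    using fL subspace_scale[OF subspace_L1_on] subspace_0[OF subspace_L1_on] by auto
  obtain q1 where q1: "transport L ?a1 0 (k *\<^sub>R f1) q1" "0 \<le> k *\<^sub>R f1 \<longrightarrow> 0 \<le> q1"
    using r1.transport_exists[OF kfL(1), of 0] by auto
  obtain q2 where q2: "transport L ?a2 0 (k *\<^sub>R f2) q2" "0 \<le> k *\<^sub>R f2 \<longrightarrow> 0 \<le> q2"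
    using r2.transport_exists[OF kfL(2), of 0] by auto
  obtain e1 where e1: "transport L ?a1 1 0 e1" "0 \<le> e1" using r1.transport_exists[OF kfL(3), of 1] by auto
  obtain e2 where e2: "transport L ?a2 1 0 e2" "0 \<le> e2" using r2.transport_exists[OF kfL(3), of 1] by auto
  have le: "0 \<le> lint e1" "0 \<le> lint e2" using e1 e2 lint_nonneg by auto
  have t1: "transport L ?a1 c (k *\<^sub>R f1) (q1 + c *\<^sub>R e1)" for c
    using r1.transport_add[OF q1(1) r1.transport_scaleR[OF e1(1), of c]] by simp
  have t2: "transport L ?a2 c (k *\<^sub>R f2) (q2 + c *\<^sub>R e2)" for c
    using r2.transport_add[OF q2(1) r2.transport_scaleR[OF e2(1), of c]] by simp
  \<comment> \<open>The coefficient of p_0 in the mass: p_0 itself, p_1 through lam1, p_2 directly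
    through lam2, and p_2 fed by p_1 through lam1 lam2. The rest of the balance is r.\<close>
  define \<Delta> where "\<Delta> = 1 + lam1 * lint e1 + lam2 * lint e2 + lam1 * lam2 * lint e1 * lint e2"
  have \<Delta>: "0 < \<Delta>" using le lam1 lam2 by (simp add: \<Delta>_def add_pos_nonneg)
  define r where "r = mass f - lint q1 - lint q2 - lam2 * lint q1 * lint e2"
  have mass_eq: "mass (p0, q1 + (lam1 * p0) *\<^sub>R e1,
      q2 + (lam2 * p0 + lam2 * lint (q1 + (lam1 * p0) *\<^sub>R e1)) *\<^sub>R e2) = mass f \<longleftrightarrow> p0 * \<Delta> = r" for p0
    by (auto simp: mass_def lint_add lint_scaleR \<Delta>_def r_def algebra_simps)
  show "\<exists>p\<in>D. p - h *\<^sub>R A p = f"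
  proof -
    define p0 where "p0 = r / \<Delta>"
    define p1 where "p1 = q1 + (lam1 * p0) *\<^sub>R e1"
    define p2 where "p2 = q2 + (lam2 * p0 + lam2 * lint p1) *\<^sub>R e2"
    have "mass (p0, p1, p2) = mass (f0, f1, f2)"
      using mass_eq[of p0] \<Delta> by (simp add: p0_def p1_def p2_def f_eq)
    then have "(p0, p1, p2) \<in> D \<and> (p0, p1, p2) - h *\<^sub>R A (p0, p1, p2) = (f0, f1, f2)"
      unfolding res using t1 t2 by (simp add: p1_def p2_def)
    then show ?thesis unfolding f_eq by blast
  qed
  show "0 \<le> p" if p: "p \<in> D" "p - h *\<^sub>R A p = f" and nonneg: "0 \<le> f"
  proof -
    obtain p0 p1 p2 where p_eq: "p = (p0, p1, p2)" by (metis prod.exhaust)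
    have f: "0 \<le> f0" "0 \<le> f1" "0 \<le> f2" using nonneg by (auto simp: f_eq nonneg_state_iff)
    have kf: "0 \<le> k *\<^sub>R f1" "0 \<le> k *\<^sub>R f2"
      using f k norm_scaleR by (auto simp: nonneg_l1_iff lint_scaleR)
    then have q: "0 \<le> q1" "0 \<le> q2" using q1 q2 by auto
    have t: "transport L ?a1 (lam1 * p0) (k *\<^sub>R f1) p1" "transport L ?a2 (lam2 * p0 + lam2 * lint p1) (k *\<^sub>R f2) p2"
      "mass (p0, p1, p2) = mass f"
      using p res[of p0 p1 p2] unfolding p_eq f_eq by auto
    have "p1 = q1 + (lam1 * p0) *\<^sub>R e1" by (rule r1.transport_unique[OF t(1) t1])
    moreover have "p2 = q2 + (lam2 * p0 + lam2 * lint p1) *\<^sub>R e2" by (rule r2.transport_unique[OF t(2) t2])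
    ultimately have "p0 * \<Delta> = r" using mass_eq[of p0] t(3) by simp
    moreover have "0 \<le> r"
    proof -
      \<comment> \<open>Aim: k r \<ge> k f0. The surplus lam2 int q_1 on the left pays for lam2 int
        q_1 times k int e_2, the part of q_1 fed into the second equation, because k int e_2 \<le>
        1.\<close>
      have b1: "(k + lam2) * lint q1 \<le> k * lint f1"
        using resolvent_mass_bound[OF mu1 _ q1(1) q(1) _ kf(1) kfL(1)] k lam2 by (simp add: lint_scaleR)
      have b2: "k * lint q2 \<le> k * lint f2"
        using resolvent_mass_bound[OF mu2 k q2(1) q(2) _ kf(2) kfL(2)] by (simp add: lint_scaleR)
      have b3: "k * lint e2 \<le> 1"
        using resolvent_mass_bound[OF mu2 k e2(1) e2(2) _ _ kfL(3)] by (simp add: lint_zero)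
      have "(lam2 * lint q1) * (k * lint e2) \<le> lam2 * lint q1"
        using b3 lint_nonneg[OF q(1)] lam2 mult_left_mono[OF b3, of "lam2 * lint q1"] by simp
      then have "k * r \<ge> k * f0"
        using b1 b2 unfolding r_def f_eq mass_def by (simp add: algebra_simps)
      moreover have "k * f0 \<ge> 0" using k f by simp
      ultimately have "0 \<le> k * r" by linarith
      then show ?thesis using k by (simp add: zero_le_mult_iff)
    qed
    ultimately have p0: "0 \<le> p0" using \<Delta> by (metis zero_le_mult_iff not_le order_less_imp_le)
    then have p1: "0 \<le> p1" using lam1 by (intro r1.transport_nonneg[OF t(1) kfL(1) _ kf(1)]) simp
    then have "0 \<le> p2" using lam2 p0 lint_nonneg[OF p1] by (intro r2.transport_nonneg[OF t(2) kfL(2) _ kf(2)]) simp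
    then show ?thesis using p0 p1 by (simp add: p_eq nonneg_state_iff)
  qed
qed

text \<open>Positivity of the resolvent already implies uniqueness: with right side 0 both p and - p
  are nonnegative.\<close>

lemma resolvent_zero:
  assumes h: "0 < h" and p: "p \<in> D" "p - h *\<^sub>R A p = 0" shows "p = 0"
proof -
  have V0: "0 \<in> V" by (rule subspace_0[OF subspace_state_space])
  have "0 \<le> p" by (rule resolvent_exists(2)[OF h V0 p]) simp
  obtain g1 g2 where "dom_data p g1 g2" using p dom_iff by blast
  then have "- p \<in> D" "A (- p) = - A p"
    using dom_data_scaleR[of p g1 g2 "-1"] dom_iff by auto
  moreover have "- p - h *\<^sub>R - A p = 0" using p(2) by (simp add: algebra_simps)
  ultimately have "0 \<le> - p" using resolvent_exists(2)[OF h V0] by simp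
  obtain p0 p1 p2 where p_eq: "p = (p0, p1, p2)" by (metis prod.exhaust)
  have "f = 0" if "0 \<le> f" "0 \<le> - f" for f :: l1
    using that by (auto simp: nonneg_l1_iff lint_minus)
  then show "p = 0"
    using \<open>0 \<le> p\<close> \<open>0 \<le> - p\<close> by (auto simp: p_eq nonneg_state_iff zero_prod_def)
qed

text \<open>Split f = a - b into positive and negative parts, whose masses add up to the norm of f.
  Their resolvents u and v are positive with unchanged mass, p = u - v by uniqueness, and the
  triangle inequality finishes.\<close>

lemma sys_dissipative:
  assumes h: "0 < h" and p: "p \<in> D" shows "state_norm p \<le> state_norm (p - h *\<^sub>R A p)"
proof -
  define f where "f = p - h *\<^sub>R A p"
  have fV: "f \<in> V" unfolding f_def
    using D_subset_V p A_in_V[OF p] subspace_diff[OF subspace_state_space] subspace_scale[OF subspace_state_space] by blast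
  obtain f0 f1 f2 where f_eq: "f = (f0, f1, f2)" by (metis prod.exhaust)
  have fL: "f1 \<in> L1_on L" "f2 \<in> L1_on L" using fV by (auto simp: f_eq state_space_def)
  obtain a1 b1 where 1: "a1 \<in> L1_on L" "b1 \<in> L1_on L" "0 \<le> a1" "0 \<le> b1" "f1 = a1 - b1" "norm f1 = lint a1 + lint b1"
    by (rule l1_pos_neg_parts[OF fL(1)])
  obtain a2 b2 where 2: "a2 \<in> L1_on L" "b2 \<in> L1_on L" "0 \<le> a2" "0 \<le> b2" "f2 = a2 - b2" "norm f2 = lint a2 + lint b2"
    by (rule l1_pos_neg_parts[OF fL(2)])
  define a b where "a = (max 0 f0, a1, a2)" and "b = (max 0 (- f0), b1, b2)"
  have ab: "a \<in> V" "b \<in> V" "0 \<le> a" "0 \<le> b" "f = a - b" "state_norm f = mass a + mass b"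
    using 1 2 by (auto simp: a_def b_def state_space_def nonneg_state_iff f_eq state_norm_def mass_def max_def)
  obtain u where u: "u \<in> D" "u - h *\<^sub>R A u = a" using resolvent_exists(1)[OF h ab(1)] by blast
  obtain v where v: "v \<in> D" "v - h *\<^sub>R A v = b" using resolvent_exists(1)[OF h ab(2)] by blast
  have "0 \<le> u" "0 \<le> v"
    using resolvent_exists(2)[OF h ab(1) u ab(3)] resolvent_exists(2)[OF h ab(2) v ab(4)] by auto
  moreover have "mass u = mass a" "mass v = mass b"
    using mass_A[OF u(1)] mass_A[OF v(1)] u(2)[symmetric] v(2)[symmetric] by (simp_all add: mass_diff mass_scaleR)
  ultimately have uv: "state_norm u = mass a" "state_norm v = mass b"
    by (simp_all add: state_norm_nonneg_eq_mass)
  obtain g1 g2 h1 h2 k1 k2 where d: "dom_data p g1 g2" "dom_data u h1 h2" "dom_data v k1 k2"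
    using p u(1) v(1) dom_iff by metis
  \<comment> \<open>Linearity of \<open>A\<close> is available for sums and scalar multiples, so p -
    (u - v) is built with factors -1.\<close>
  note dv = dom_data_scaleR[OF d(3), of "-1"]
  note duv = dom_data_add[OF d(2) dv(1)]
  note d' = dom_data_scaleR[OF duv(1), of "-1"]
  note d'' = dom_data_add[OF d(1) d'(1)]
  have "p + - 1 *\<^sub>R (u + - 1 *\<^sub>R v) = 0"
  proof (rule resolvent_zero[OF h])
    show "p + - 1 *\<^sub>R (u + - 1 *\<^sub>R v) \<in> D" using d''(1) dom_iff by blast
    have "(p - h *\<^sub>R A p) - ((u - h *\<^sub>R A u) - (v - h *\<^sub>R A v)) = 0"
      using ab(5) u(2) v(2) by (simp add: f_def)
    then show "p + - 1 *\<^sub>R (u + - 1 *\<^sub>R v) - h *\<^sub>R A (p + - 1 *\<^sub>R (u + - 1 *\<^sub>R v)) = 0"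
      unfolding d''(2) d'(2) duv(2) dv(2) by (simp add: algebra_simps)
  qed
  then have "p = u + (- 1) *\<^sub>R v" by (simp add: add_eq_0_iff2)
  then have "state_norm p \<le> state_norm u + state_norm v"
    using state_norm_triangle[of u "(- 1) *\<^sub>R v"] by (simp only: state_norm_scaleR)
  then show ?thesis using uv ab(6) by (simp add: f_def)
qed

text \<open>Strong absorption at rate k confines the inflow c to a layer near 0: by
  \<open>resolvent_mass_bound\<close> the solution has norm at most |c| / k.\<close>

lemma small_boundary_layer:
  assumes m: "repair_rate L m" and e: "0 < e"
  shows "\<exists>p g. is_primitive L p c g \<and> integrable_upto L (\<lambda>x. m x * rep_l1 p x) \<and> norm p < e"
proof -
  \<comment> \<open>Makes |c| / k < e while keeping k positive when c = 0.\<close>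
  define k where "k = (\<bar>c\<bar> + 1) / e"
  have k: "0 < k" using e by (simp add: k_def)
  interpret rate L "\<lambda>x. k + m x" by (rule rate_repair_rate[OF m L]) (use k in simp)
  have 0: "0 \<in> L1_on L" by (rule subspace_0[OF subspace_L1_on])
  obtain q where q: "transport L (\<lambda>x. k + m x) 1 0 q" "0 \<le> q" using transport_exists[OF 0, of 1] by auto
  have "k * lint q \<le> 1" using resolvent_mass_bound[OF m k q _ _ 0] by (simp add: lint_zero)
  then have "norm q \<le> 1 / k" using q(2) k by (simp add: nonneg_l1_iff field_simps)
  then have "\<bar>c\<bar> * norm q \<le> \<bar>c\<bar> * (1 / k)" by (intro mult_left_mono) auto
  also have "\<dots> < e" using e by (simp add: k_def field_simps)
  finally have small: "norm (c *\<^sub>R q) < e" by simp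
  have t: "transport L (\<lambda>x. k + m x) c 0 (c *\<^sub>R q)" using transport_scaleR[OF q(1), of c] by simp
  then have "c *\<^sub>R q \<in> L1_on L" by (auto simp: transport_def is_primitive_def)
  then have "integrable_upto L (\<lambda>x. m x * rep_l1 (c *\<^sub>R q) x)"
    using t mult_class_shift(1)[of "c *\<^sub>R q" L k m] by (simp add: transport_def)
  then show ?thesis using t small unfolding transport_def by blast
qed

text \<open>Approximate f by a primitive with value 0 at 0, then add a boundary layer carrying the
  prescribed value c.\<close>

lemma primitive_approx:
  assumes m: "repair_rate L m" and f: "f \<in> L1_on L" and e: "0 < e"
  shows "\<exists>p g. is_primitive L p c g \<and> integrable_upto L (\<lambda>x. m x * rep_l1 p x) \<and> norm (f - p) < e"
proof -
  interpret rate L "\<lambda>x. 0 + m x" by (rule rate_repair_rate[OF m L]) simp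
  obtain q g where q: "is_primitive L q 0 g" "integrable_upto L (\<lambda>x. m x * rep_l1 q x)" "norm (f - q) < e / 2"
    using primitive_dense[OF f, of "e / 2"] e by auto
  obtain r g' where r: "is_primitive L r c g'" "integrable_upto L (\<lambda>x. m x * rep_l1 r x)" "norm r < e / 2"
    using small_boundary_layer[OF m, of "e / 2" c] e by auto
  have "norm (f - (q + r)) < e"
    using norm_triangle_ineq4[of "f - q" r] q(3) r(3) by (simp add: algebra_simps)
  moreover have "set_borel_measurable lebesgue {0<..<L} m"
    by (rule set_borel_measurable_repair_rate[OF m L])
  then have "integrable_upto L (\<lambda>x. m x * rep_l1 (q + r) x)" using mult_class_add(1) q(2) r(2) by blast
  ultimately show ?thesis using is_primitive_add[OF q(1) r(1)] by auto
qed

lemma sys_dense: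
  assumes f: "f \<in> V" and e: "0 < e" shows "\<exists>p\<in>D. state_norm (f - p) < e"
proof -
  obtain f0 f1 f2 where f_eq: "f = (f0, f1, f2)" by (metis prod.exhaust)
  have fL: "f1 \<in> L1_on L" "f2 \<in> L1_on L" using f by (auto simp: f_eq state_space_def)
  obtain p1 g1 where p1: "is_primitive L p1 (lam1 * f0) g1" "integrable_upto L (\<lambda>x. mu1 x * rep_l1 p1 x)" "norm (f1 - p1) < e / 2"
    using primitive_approx[OF mu1 fL(1) half_gt_zero[OF e]] by blast
  \<comment> \<open>The boundary value of p_2 contains the integral of p_1, so p_1 is fixed first.
    This works because \<open>primitive_approx\<close> allows every boundary value, and p_0 = f_0 is
    kept exactly.\<close>
  obtain p2 g2 where p2: "is_primitive L p2 (lam2 * f0 + lam2 * lint p1) g2"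
    "integrable_upto L (\<lambda>x. mu2 x * rep_l1 p2 x)" "norm (f2 - p2) < e / 2"
    using primitive_approx[OF mu2 fL(2) half_gt_zero[OF e]] by blast
  have "dom_data (f0, p1, p2) g1 g2" using p1 p2 by (simp add: dom_data_def)
  then have "(f0, p1, p2) \<in> D" using dom_iff by blast
  moreover have "state_norm (f - (f0, p1, p2)) < e" using p1(3) p2(3) by (simp add: f_eq state_norm_def)
  ultimately show ?thesis by blast
qed

sublocale m_dissipative V D state_norm A 3
proof
  show "A (p + q) = A p + A q" if "p \<in> D" "q \<in> D" for p q
    using that dom_data_add(2) dom_iff by metis
  show "A (c *\<^sub>R p) = c *\<^sub>R A p" if "p \<in> D" for p c
    using that dom_data_scaleR(2) dom_iff by metis
qed (use subspace_state_space closed_state_space state_norm_triangle state_norm_scaleR norm_le_state_norm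
  state_norm_le_norm subspace_dom D_subset_V A_in_V resolvent_exists(1) sys_dissipative sys_dense in auto)

lemma positive_T: "positive_on V T"
  unfolding positive_on_def
proof (intro allI ballI impI)
  fix t :: real and p assume t: "0 \<le> t" and p: "p \<in> V" "0 \<le> p"
  have "T t p \<in> {p. 0 \<le> p}"
  proof (rule T_in_closed[OF closed_nonneg_state _ t p(1)])
    show "J h f \<in> {p. 0 \<le> p}" if "0 < h" "f \<in> V" "f \<in> {p. 0 \<le> p}" for h f
      using resolvent_exists(2)[OF that(1,2) J_in_D[OF that(1,2)] J_eq[OF that(1,2)]] that(3) by simp
  qed (use p(2) in simp)
  then show "0 \<le> T t p" by simp
qed

end

theorem theorem2p1:
  fixes L lam1 lam2 :: real and mu1 mu2 :: "real \<Rightarrow> real"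
  assumes "0 < L" and "0 < lam1" and "0 < lam2"
    and "repair_rate L mu1" and "repair_rate L mu2"
    and "\<exists>N::nat. 0 < N \<and>
           (\<exists>c. ((\<lambda>x. mu1 x * (L - x) ^ N) \<longlongrightarrow> c) (at_left L)) \<and>
           (\<exists>c. ((\<lambda>x. mu2 x * (L - x) ^ N) \<longlongrightarrow> c) (at_left L))"
  shows "\<exists>T. C0_semigroup_on (state_space L) state_norm T \<and>
             generator_on (state_space L) state_norm T
               (sys_domain L lam1 lam2 mu1 mu2) (sys_operator L lam1 lam2 mu1 mu2) \<and>
             positive_on (state_space L) T \<and>
             contractive_on (state_space L) state_norm T"
proof -
  interpret repairable_system L lam1 lam2 mu1 mu2
    using assms by unfold_locales
  show ?thesis
    using C0_semigroup_T generator_T positive_T contractive_T by blast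
qed

end
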